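(* As $\mathcal{A}$-modules, $$L_{\mathcal{A}}(1)=M_{\mathcal{A}}(1)/J\simeq M(1),$$ where $J$ is the $\mathcal{A}$-submodule of $M_{\mathcal{A}}(1)$ generated by the vectors $$Y_{-\lambda}v_1-(-1)^{|\lambda|}Y^{*}_{-\lambda'}v_1\qquad(\lambda\in\mathcal{P}),$$ with $\lambda'$ the dual of $\lambda$. Furthermore, there is a non-degenerate symmetric invariant bilinear form $\langle\cdot,\cdot\rangle$ on $M(1)$ with $\{Y_{-\lambda}1\mid\lambda\in\mathcal{P}\}$ as an orthonormal basis.
   Context: $\mathbb{N}$ is the set of nonnegative integers. $\mathcal{A}$ denotes the associative algebra with identity over $\mathbb{C}$ with generators $Y_n, Y_n^{*}$ ($n\in\mathbb{Z}$), subject to the relations $$Y_mY_n+Y_{n+1}Y_{m-1}=0,\qquad Y_m^{*}Y_n^{*}+Y_{n+1}^{*}Y_{m-1}^{*}=0,\qquad Y_mY_n^{*}+Y_{n-1}^{*}Y_{m+1}=\delta_{m+n,0}$$ for $m,n\in\mathbb{Z}$. It is $\mathbb{Z}$-graded by $\deg Y_n=-n=\deg Y_n^{*}$; $\mathcal{A}_n$ is the homogeneous subspace of degree $n$, and $\mathcal{A}_{-}=\oplus_{n\ge1}\mathcal{A}_{-n}$. Let $I_0=\sum_{n\ge1}\mathcal{A}_n\mathcal{A}_{-n}$, an ideal of $\mathcal{A}_0$, and $\bar{\mathcal{A}}_0=\mathcal{A}_0/I_0$. There is a $1$-dimensional $\bar{\mathcal{A}}_0$-module $\mathbb{C}_1=\mathbb{C}$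 on which (the images of) $Y_0$ and $Y_0^{*}$ act as $1$. View it as an $(\mathcal{A}_-+\mathcal{A}_0)$-module with $\mathcal{A}_-$ acting as zero, and set $M_{\mathcal{A}}(1)=\mathcal{A}\otimes_{(\mathcal{A}_-+\mathcal{A}_0)}\mathbb{C}_1$, an $\mathbb{N}$-graded $\mathcal{A}$-module with degree-$0$ subspace $\mathbb{C}_1$; $v_1$ denotes its generator $1\in\mathbb{C}$. $L_{\mathcal{A}}(1)$ is the quotient of $M_{\mathcal{A}}(1)$ by its maximal proper $\mathbb{N}$-graded submodule. $M(1)=\mathbb{C}[x_1,x_2,\dots]$ with operators $a_n=n\,\partial/\partial x_n$ and $a_{-n}=x_n$ (multiplication) for $n\ge1$. By a result of Jing and Nie, $M(1)$ is an $\mathcal{A}$-module with $Y(z)=\sum_{n\in\mathbb{Z}}Y_nz^{-n}$ and $Y^{*}(z)=\sum_{n\in\mathbb{Z}}Y_n^{*}z^{-n}$ acting as $$Y(z)=\exp\Big(\sum_{n\ge1}\tfrac{a_{-n}}{n}z^n\Big)\exp\Big(-\sum_{n\ge1}\tfrac{a_n}{n}(z^{-n}+z^n)\Big),$$ $$Y^{*}(z)=(1-z^2)\exp\Big(-\sum_{n\ge1}\tfrac{a_{-n}}{n}z^n\Big)\exp\Big(\sum_{n\ge1}\tfrac{a_n}{n}(z^{-n}+z^n)\Big).$$ $\mathcal{P}$ is the set of all partitions (non-increasing sequences of nonnegative integers with finitely many nonzero terms); $|\lambda|$ is the sum of the terms of $\lambda$; $\lambda'$ is the dual (conjugate) partition.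 For $\lambda=(\lambda_1,\dots,\lambda_r)$, with $\lambda_i$ the nonzero terms, $Y_{-\lambda}=Y_{-\lambda_1}\cdots Y_{-\lambda_r}$ and $Y^{*}_{-\lambda}=Y^{*}_{-\lambda_1}\cdots Y^{*}_{-\lambda_r}$ (the empty product being $1$). Let $\theta$ be the involutive anti-automorphism of $\mathcal{A}$ determined by $\theta(Y_n)=Y_{-n}^{*}$, $\theta(Y_n^{*})=Y_{-n}$ for $n\in\mathbb{Z}$. A bilinear form $\langle\cdot,\cdot\rangle$ on an $\mathcal{A}$-module $W$ is invariant if $\langle au,v\rangle=\langle u,\theta(a)v\rangle$ for all $a\in\mathcal{A}$, $u,v\in W$. *)

theory Defs
  imports Complex_Main "HOL-Algebra.Module" "HOL-Algebra.QuotRing" "HOL-Algebra.Generated_Groups"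
    "HOL-Algebra.Free_Abelian_Groups" "HOL-Library.Groups_Big_Fun"
begin

section \<open>Modules over non-commutative rings\<close>

text \<open>The module locale of HOL-Algebra requires a commutative ring of scalars. We keep its record
  and its notion of submodule; the fields \<open>mult\<close> and \<open>one\<close> of a module record are irrelevant.\<close>

locale left_module = R?: ring R + M?: abelian_group M
  for R :: "('a, 'r) ring_scheme" (structure) and M :: "('a, 'b, 'm) module_scheme" (structure) +
  assumes smult_closed:
      "\<lbrakk>a \<in> carrier R; x \<in> carrier M\<rbrakk> \<Longrightarrow> a \<odot>\<^bsub>M\<^esub> x \<in> carrier M"
    and smult_l_distr:
      "\<lbrakk>a \<in> carrier R; b \<in> carrier R; x \<in> carrier M\<rbrakk> \<Longrightarrow>
        (a \<oplus>\<^bsub>R\<^esub> b) \<odot>\<^bsub>M\<^esub> x = a \<odot>\<^bsub>M\<^esub> x \<oplus>\<^bsub>M\<^esub> b \<odot>\<^bsub>M\<^esub> x"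
    and smult_r_distr:
      "\<lbrakk>a \<in> carrier R; x \<in> carrier M; y \<in> carrier M\<rbrakk> \<Longrightarrow>
        a \<odot>\<^bsub>M\<^esub> (x \<oplus>\<^bsub>M\<^esub> y) = a \<odot>\<^bsub>M\<^esub> x \<oplus>\<^bsub>M\<^esub> a \<odot>\<^bsub>M\<^esub> y"
    and smult_assoc:
      "\<lbrakk>a \<in> carrier R; b \<in> carrier R; x \<in> carrier M\<rbrakk> \<Longrightarrow>
        (a \<otimes>\<^bsub>R\<^esub> b) \<odot>\<^bsub>M\<^esub> x = a \<odot>\<^bsub>M\<^esub> (b \<odot>\<^bsub>M\<^esub> x)"
    and smult_one:
      "x \<in> carrier M \<Longrightarrow> \<one>\<^bsub>R\<^esub> \<odot>\<^bsub>M\<^esub> x = x"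

definition module_isomorphic ::
  "('a, 'r) ring_scheme \<Rightarrow> ('a, 'b, 'm) module_scheme \<Rightarrow> ('a, 'c, 'n) module_scheme \<Rightarrow> bool"
  where "module_isomorphic R M N \<longleftrightarrow> left_module R M \<and> left_module R N \<and>
    (\<exists>h. bij_betw h (carrier M) (carrier N) \<and>
      (\<forall>x\<in>carrier M. \<forall>y\<in>carrier M. h (x \<oplus>\<^bsub>M\<^esub> y) = h x \<oplus>\<^bsub>N\<^esub> h y) \<and>
      (\<forall>a\<in>carrier R. \<forall>x\<in>carrier M. h (a \<odot>\<^bsub>M\<^esub> x) = a \<odot>\<^bsub>N\<^esub> h x))"

definition generated_submodule ::
  "('a, 'r) ring_scheme \<Rightarrow> ('a, 'b, 'm) module_scheme \<Rightarrow> 'b set \<Rightarrow> 'b set"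
  where "generated_submodule R M S = \<Inter>{N. submodule N R M \<and> S \<subseteq> N}"

definition quotient_module ::
  "('a, 'b, 'm) module_scheme \<Rightarrow> 'b set \<Rightarrow> ('a, 'b set) module"
  where "quotient_module M N =
    \<lparr>carrier = a_rcosets\<^bsub>M\<^esub> N, monoid.mult = undefined, one = undefined,
     ring.zero = N, add = set_add M, smult = (\<lambda>a C. \<Union>x\<in>C. N +>\<^bsub>M\<^esub> (a \<odot>\<^bsub>M\<^esub> x))\<rparr>"

text \<open>In the next two definitions \<open>G n\<close> is the homogeneous subspace of degree \<open>n\<close>.\<close>

definition graded_submodule ::
  "('a, 'r) ring_scheme \<Rightarrow> ('a, 'b, 'm) module_scheme \<Rightarrow> (nat \<Rightarrow> 'b set) \<Rightarrow> 'b set \<Rightarrow> bool"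
  where "graded_submodule R M G N \<longleftrightarrow>
    submodule N R M \<and> N = generate (add_monoid M) (\<Union>n. N \<inter> G n)"

definition maximal_graded_submodule ::
  "('a, 'r) ring_scheme \<Rightarrow> ('a, 'b, 'm) module_scheme \<Rightarrow> (nat \<Rightarrow> 'b set) \<Rightarrow> 'b set \<Rightarrow> bool"
  where "maximal_graded_submodule R M G N \<longleftrightarrow>
    graded_submodule R M G N \<and> N \<noteq> carrier M \<and>
    (\<forall>N'. graded_submodule R M G N' \<and> N' \<noteq> carrier M \<and> N \<subseteq> N' \<longrightarrow> N' = N)"

text \<open>The tensor product of \<open>R\<close>, as a right module over its subring \<open>B\<close>, with a left \<open>B\<close>-module
  \<open>N\<close>: the free abelian group on \<open>R \<times> N\<close> modulo biadditivity and balancedness, with \<open>R\<close> acting by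
  left multiplication on the first factor.\<close>

definition tensor_relations ::
  "('a, 'r) ring_scheme \<Rightarrow> 'a set \<Rightarrow> ('a, 'b, 'n) module_scheme \<Rightarrow> ('a \<times> 'b \<Rightarrow>\<^sub>0 int) set"
  where "tensor_relations R B N =
    {frag_of (a \<oplus>\<^bsub>R\<^esub> a', x) - frag_of (a, x) - frag_of (a', x) | a a' x.
       a \<in> carrier R \<and> a' \<in> carrier R \<and> x \<in> carrier N} \<union>
    {frag_of (a, x \<oplus>\<^bsub>N\<^esub> x') - frag_of (a, x) - frag_of (a, x') | a x x'.
       a \<in> carrier R \<and> x \<in> carrier N \<and> x' \<in> carrier N} \<union>
    {frag_of (a \<otimes>\<^bsub>R\<^esub> b, x) - frag_of (a, b \<odot>\<^bsub>N\<^esub> x) | a b x.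
       a \<in> carrier R \<and> b \<in> B \<and> x \<in> carrier N}"

definition tensor_null ::
  "('a, 'r) ring_scheme \<Rightarrow> 'a set \<Rightarrow> ('a, 'b, 'n) module_scheme \<Rightarrow> ('a \<times> 'b \<Rightarrow>\<^sub>0 int) set"
  where "tensor_null R B N =
    generate (free_Abelian_group (carrier R \<times> carrier N)) (tensor_relations R B N)"

definition pure_tensor ::
  "('a, 'r) ring_scheme \<Rightarrow> 'a set \<Rightarrow> ('a, 'b, 'n) module_scheme \<Rightarrow> 'a \<Rightarrow> 'b \<Rightarrow> ('a \<times> 'b \<Rightarrow>\<^sub>0 int) set"
  where "pure_tensor R B N a x =
    tensor_null R B N #>\<^bsub>free_Abelian_group (carrier R \<times> carrier N)\<^esub> frag_of (a, x)"

definition tensor_module ::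
  "('a, 'r) ring_scheme \<Rightarrow> 'a set \<Rightarrow> ('a, 'b, 'n) module_scheme
    \<Rightarrow> ('a, ('a \<times> 'b \<Rightarrow>\<^sub>0 int) set) module"
  where "tensor_module R B N =
    (let F = free_Abelian_group (carrier R \<times> carrier N); K = tensor_null R B N in
     \<lparr>carrier = rcosets\<^bsub>F\<^esub> K, monoid.mult = undefined, one = undefined, ring.zero = K, add = set_mult F,
      smult = (\<lambda>r C. \<Union>f\<in>C. K #>\<^bsub>F\<^esub> frag_extend (\<lambda>(a, x). frag_of (r \<otimes>\<^bsub>R\<^esub> a, x)) f)\<rparr>)"


section \<open>The algebra\<close>

datatype generator = Gen_Y int | Gen_Ys int

text \<open>The free monoid on the generators, written additively so that finitely supported functions
  on it, with convolution as product, are the free associative algebra.\<close>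

datatype word = Word (letters: "generator list")

instantiation word :: monoid_add
begin
definition zero_word :: word where "zero_word = Word []"
definition plus_word :: "word \<Rightarrow> word \<Rightarrow> word" where "plus_word u v = Word (letters u @ letters v)"
instance by standard (auto simp: zero_word_def plus_word_def)
end

type_synonym free_algebra = "word \<Rightarrow>\<^sub>0 complex"

definition free_ring :: "free_algebra ring"
  where "free_ring = \<lparr>carrier = UNIV, monoid.mult = (*), one = 1, ring.zero = 0, add = (+)\<rparr>"

definition free_Y :: "int \<Rightarrow> free_algebra"
  where "free_Y n = Poly_Mapping.single (Word [Gen_Y n]) 1"

definition free_Ys :: "int \<Rightarrow> free_algebra"
  where "free_Ys n = Poly_Mapping.single (Word [Gen_Ys n]) 1"

definition defining_relations :: "free_algebra set"
  where "defining_relations =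
    {free_Y m * free_Y n + free_Y (n + 1) * free_Y (m - 1) | m n. True} \<union>
    {free_Ys m * free_Ys n + free_Ys (n + 1) * free_Ys (m - 1) | m n. True} \<union>
    {free_Y m * free_Ys n + free_Ys (n - 1) * free_Y (m + 1) - (if m + n = 0 then 1 else 0) | m n. True}"

definition relation_ideal :: "free_algebra set"
  where "relation_ideal = genideal free_ring defining_relations"

type_synonym alg = "free_algebra set"

definition algA :: "alg ring" (\<open>\<A>\<close>)
  where "\<A> = free_ring Quot relation_ideal"

definition algA_class :: "free_algebra \<Rightarrow> alg"
  where "algA_class f = relation_ideal +>\<^bsub>free_ring\<^esub> f"

definition Y :: "int \<Rightarrow> alg" where "Y n = algA_class (free_Y n)"

definition Ys :: "int \<Rightarrow> alg" where "Ys n = algA_class (free_Ys n)"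

definition scalar :: "complex \<Rightarrow> alg"
  where "scalar c = algA_class (Poly_Mapping.single 0 c)"

fun generator_degree :: "generator \<Rightarrow> int" where
  "generator_degree (Gen_Y n) = - n"
| "generator_degree (Gen_Ys n) = - n"

definition word_degree :: "word \<Rightarrow> int"
  where "word_degree w = sum_list (map generator_degree (letters w))"

definition algA_deg :: "int \<Rightarrow> alg set"
  where "algA_deg n = algA_class ` {f. \<forall>w\<in>Poly_Mapping.keys f. word_degree w = n}"

definition algA_minus :: "alg set"
  where "algA_minus = generate (add_monoid \<A>) (\<Union>n\<in>{1..}. algA_deg (- n))"

subsection \<open>The anti-automorphism\<close>

fun generator_theta :: "generator \<Rightarrow> generator" where
  "generator_theta (Gen_Y n) = Gen_Ys (- n)"
| "generator_theta (Gen_Ys n) = Gen_Y (- n)"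

definition word_theta :: "word \<Rightarrow> word"
  where "word_theta w = Word (rev (map generator_theta (letters w)))"

text \<open>\<open>map_key\<close> is precomposition. As \<open>word_theta\<close> is an involution, the map sends the basis
  word \<open>w\<close> to \<open>word_theta w\<close>.\<close>

definition free_theta :: "free_algebra \<Rightarrow> free_algebra"
  where "free_theta = Poly_Mapping.map_key word_theta"

definition theta :: "alg \<Rightarrow> alg"
  where "theta C = free_theta ` C"


subsection \<open>Consequences of the definitions\<close>

lemma ring_free_ring: "ring free_ring"
proof -
  have "\<exists>y. x + y = 0" "\<exists>y. y + x = 0" for x :: free_algebra
    by (rule exI[of _ "- x"], simp)+
  then show ?thesis
    by unfold_locales (auto simp: free_ring_def algebra_simps Units_def)
qed

lemma ideal_relation_ideal: "ideal relation_ideal free_ring"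
  unfolding relation_ideal_def
  by (rule ring.genideal_ideal[OF ring_free_ring]) (simp add: free_ring_def)

lemma ring_algA: "ring \<A>"
  unfolding algA_def by (rule ideal.quotient_is_ring[OF ideal_relation_ideal])

lemma algA_class_hom: "algA_class \<in> ring_hom free_ring \<A>"
  unfolding algA_def algA_class_def by (rule ideal.rcos_ring_hom[OF ideal_relation_ideal])

lemma algA_class_add: "algA_class f \<oplus>\<^bsub>\<A>\<^esub> algA_class g = algA_class (f + g)"
  using ring_hom_add[OF algA_class_hom, of f g] by (simp add: free_ring_def)

lemma algA_class_mult: "algA_class f \<otimes>\<^bsub>\<A>\<^esub> algA_class g = algA_class (f * g)"
  using ring_hom_mult[OF algA_class_hom, of f g] by (simp add: free_ring_def)

lemma algA_class_one: "\<one>\<^bsub>\<A>\<^esub> = algA_class 1"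
  using ring_hom_one[OF algA_class_hom] by (simp add: free_ring_def)

lemma algA_class_eq: "algA_class f = {r + f | r. r \<in> relation_ideal}"
  by (auto simp: algA_class_def a_r_coset_def' free_ring_def)

lemma relation_ideal_closed:
  "0 \<in> relation_ideal"
  "f \<in> relation_ideal \<Longrightarrow> g \<in> relation_ideal \<Longrightarrow> f + g \<in> relation_ideal"
  "f \<in> relation_ideal \<Longrightarrow> g * f \<in> relation_ideal"
  "f \<in> relation_ideal \<Longrightarrow> f * g \<in> relation_ideal"
  using additive_subgroup.zero_closed[OF ideal.axioms(1)[OF ideal_relation_ideal]]
    additive_subgroup.a_closed[OF ideal.axioms(1)[OF ideal_relation_ideal], of f g]
    ideal.I_l_closed[OF ideal_relation_ideal, of f g]
    ideal.I_r_closed[OF ideal_relation_ideal, of f g]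
  by (simp_all add: free_ring_def)

lemma algA_class_eq_iff: "algA_class f = algA_class g \<longleftrightarrow> f - g \<in> relation_ideal"
proof
  assume "algA_class f = algA_class g"
  moreover have "f \<in> algA_class f"
    unfolding algA_class_eq using relation_ideal_closed(1) by force
  ultimately show "f - g \<in> relation_ideal"
    unfolding algA_class_eq by auto
next
  assume a: "f - g \<in> relation_ideal"
  then have b: "g - f \<in> relation_ideal"
    using relation_ideal_closed(3)[OF a, of "- 1"] by simp
  have sub: "algA_class h \<subseteq> algA_class h'" if "h - h' \<in> relation_ideal" for h h'
    unfolding algA_class_eq
    using relation_ideal_closed(2)[OF _ that] by clarsimp (metis add.assoc diff_add_cancel)
  then show "algA_class f = algA_class g"
    using a b by blast
qed

lemma defining_relations_subset: "defining_relations \<subseteq> relation_ideal"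
  unfolding relation_ideal_def
  by (rule ring.genideal_self[OF ring_free_ring]) (simp add: free_ring_def)

lemma algA_relations:
  "Y m \<otimes>\<^bsub>\<A>\<^esub> Y n \<oplus>\<^bsub>\<A>\<^esub> Y (n + 1) \<otimes>\<^bsub>\<A>\<^esub> Y (m - 1) = \<zero>\<^bsub>\<A>\<^esub>"
  "Ys m \<otimes>\<^bsub>\<A>\<^esub> Ys n \<oplus>\<^bsub>\<A>\<^esub> Ys (n + 1) \<otimes>\<^bsub>\<A>\<^esub> Ys (m - 1) = \<zero>\<^bsub>\<A>\<^esub>"
  "Y m \<otimes>\<^bsub>\<A>\<^esub> Ys n \<oplus>\<^bsub>\<A>\<^esub> Ys (n - 1) \<otimes>\<^bsub>\<A>\<^esub> Y (m + 1) = (if m + n = 0 then \<one>\<^bsub>\<A>\<^esub> else \<zero>\<^bsub>\<A>\<^esub>)"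
proof -
  have zero: "\<zero>\<^bsub>\<A>\<^esub> = algA_class 0"
    unfolding algA_class_eq by (simp add: algA_def FactRing_def)
  have if_class: "(if P then algA_class f else algA_class g) = algA_class (if P then f else g)" for P f g
    by simp
  show "Y m \<otimes>\<^bsub>\<A>\<^esub> Y n \<oplus>\<^bsub>\<A>\<^esub> Y (n + 1) \<otimes>\<^bsub>\<A>\<^esub> Y (m - 1) = \<zero>\<^bsub>\<A>\<^esub>"
    and "Ys m \<otimes>\<^bsub>\<A>\<^esub> Ys n \<oplus>\<^bsub>\<A>\<^esub> Ys (n + 1) \<otimes>\<^bsub>\<A>\<^esub> Ys (m - 1) = \<zero>\<^bsub>\<A>\<^esub>"
    and "Y m \<otimes>\<^bsub>\<A>\<^esub> Ys n \<oplus>\<^bsub>\<A>\<^esub> Ys (n - 1) \<otimes>\<^bsub>\<A>\<^esub> Y (m + 1) = (if m + n = 0 then \<one>\<^bsub>\<A>\<^esub> else \<zero>\<^bsub>\<A>\<^esub>)"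
    unfolding Y_def Ys_def algA_class_mult algA_class_add zero algA_class_one if_class algA_class_eq_iff
    by (rule subsetD[OF defining_relations_subset], unfold defining_relations_def, fastforce)+
qed

lemma word_theta_invol [simp]: "word_theta (word_theta w) = w"
proof -
  have "generator_theta (generator_theta g) = g" for g by (cases g) auto
  then show ?thesis by (cases w) (simp add: word_theta_def rev_map comp_def)
qed

lemma inj_word_theta: "inj word_theta"
  by (metis injI word_theta_invol)

lemma word_theta_add: "word_theta (u + v) = word_theta v + word_theta u"
  by (simp add: word_theta_def plus_word_def)

lemma free_theta_add: "free_theta (f + g) = free_theta f + free_theta g"
  by (simp add: free_theta_def map_key_plus[OF inj_word_theta])

lemma free_theta_zero: "free_theta 0 = 0"
  by (simp add: free_theta_def Poly_Mapping.map_key_zero[OF inj_word_theta])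

lemma free_theta_single:
  "free_theta (Poly_Mapping.single w c) = Poly_Mapping.single (word_theta w) c"
  using map_key_single[OF inj_word_theta, of "word_theta w" c] by (simp add: free_theta_def)

lemma free_theta_invol: "free_theta (free_theta f) = f"
  by (simp add: free_theta_def map_key_compose[OF inj_word_theta inj_word_theta] comp_def
      map_key_id)

lemma free_algebra_induct [case_names single add]:
  assumes "\<And>w c. P (Poly_Mapping.single w c)" "\<And>f g. P f \<Longrightarrow> P g \<Longrightarrow> P (f + g)"
  shows "P (f :: free_algebra)"
proof (induction f rule: update_induct)
  case const
  show ?case using assms(1)[of 0 0] by simp
next
  case (update f w c)
  have "Poly_Mapping.update w c f = f + Poly_Mapping.single w c"
    using update.hyps
    by (intro poly_mapping_eqI) (auto simp: lookup_update lookup_add lookup_single in_keys_iff)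
  then show ?case using assms update.IH by metis
qed

lemma free_theta_mult: "free_theta (f * g) = free_theta g * free_theta f"
proof (induction f rule: free_algebra_induct)
  case (single v c)
  show ?case
  proof (induction g rule: free_algebra_induct)
    case (single w d)
    show ?case by (simp add: free_theta_single mult_single word_theta_add mult.commute)
  qed (simp add: free_theta_add algebra_simps)
qed (simp add: free_theta_add algebra_simps)

lemma free_theta_uminus: "free_theta (- f) = - free_theta f"
  using free_theta_add[of f "- f"] by (simp add: free_theta_zero eq_neg_iff_add_eq_0 add.commute)

lemma free_theta_relation_ideal: "f \<in> relation_ideal \<Longrightarrow> free_theta f \<in> relation_ideal"
proof -
  let ?K = "{f. free_theta f \<in> relation_ideal}"
  have "word_theta 0 = 0"
    by (simp add: word_theta_def zero_word_def)
  then have one: "free_theta 1 = 1"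
    using free_theta_single[of 0 1] by simp
  have gens: "free_theta (free_Y n) = free_Ys (- n)" "free_theta (free_Ys n) = free_Y (- n)" for n
    by (simp_all add: free_Y_def free_Ys_def free_theta_single word_theta_def)
  have rel: "free_theta f \<in> defining_relations" if f: "f \<in> defining_relations" for f
  proof -
    consider m n where "f = free_Y m * free_Y n + free_Y (n + 1) * free_Y (m - 1)"
      | m n where "f = free_Ys m * free_Ys n + free_Ys (n + 1) * free_Ys (m - 1)"
      | m n where "f = free_Y m * free_Ys n + free_Ys (n - 1) * free_Y (m + 1) - (if m + n = 0 then 1 else 0)"
      using f unfolding defining_relations_def by blast
    then show ?thesis
    proof cases
      case (1 m n)
      then have "free_theta f = free_Ys (- n) * free_Ys (- m) + free_Ys (- m + 1) * free_Ys (- n - 1)"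
        by (simp add: free_theta_add free_theta_mult gens)
      then show ?thesis unfolding defining_relations_def by blast
    next
      case (2 m n)
      then have "free_theta f = free_Y (- n) * free_Y (- m) + free_Y (- m + 1) * free_Y (- n - 1)"
        by (simp add: free_theta_add free_theta_mult gens)
      then show ?thesis unfolding defining_relations_def by blast
    next
      case (3 m n)
      have "free_theta f = free_Y (- n) * free_Ys (- m) + free_Ys (- m - 1) * free_Y (- n + 1)
          - (if - n + - m = 0 then 1 else 0)"
        unfolding 3 diff_conv_add_uminus free_theta_add free_theta_mult gens free_theta_uminus
        by (auto simp: one free_theta_zero)
      then show ?thesis unfolding defining_relations_def by blast
    qed
  qed
  have uminus: "- f \<in> relation_ideal" if "f \<in> relation_ideal" for f
    using relation_ideal_closed(3)[OF that, of "- 1"] by simp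
  have "ideal ?K free_ring"
  proof (rule idealI[OF ring_free_ring])
    show "subgroup ?K (add_monoid free_ring)"
    proof (rule group.subgroupI)
      show "group (add_monoid free_ring)"
        by (rule abelian_group.a_group[OF ring.is_abelian_group[OF ring_free_ring]])
      have inv: "m_inv (add_monoid free_ring) f = - f" for f
        using abelian_group.minus_equality[OF ring.is_abelian_group[OF ring_free_ring], of "- f" f]
        by (simp add: free_ring_def a_inv_def)
      show "\<And>f. f \<in> ?K \<Longrightarrow> m_inv (add_monoid free_ring) f \<in> ?K"
        unfolding inv using uminus by (simp add: free_theta_uminus)
    qed (use relation_ideal_closed free_theta_zero in
        \<open>auto simp: free_ring_def free_theta_add intro!: exI[of _ 0]\<close>)
  qed (auto simp: free_ring_def free_theta_mult relation_ideal_closed)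
  moreover have "defining_relations \<subseteq> ?K"
    using rel defining_relations_subset by blast
  ultimately have "relation_ideal \<subseteq> ?K"
    using ring.genideal_minimal[OF ring_free_ring] by (simp add: relation_ideal_def)
  then show "f \<in> relation_ideal \<Longrightarrow> free_theta f \<in> relation_ideal" by blast
qed

lemma theta_class: "theta (algA_class f) = algA_class (free_theta f)"
proof
  show "theta (algA_class f) \<subseteq> algA_class (free_theta f)"
    using free_theta_relation_ideal by (auto simp: theta_def algA_class_eq free_theta_add)
  show "algA_class (free_theta f) \<subseteq> theta (algA_class f)"
  proof
    fix g assume "g \<in> algA_class (free_theta f)"
    then obtain r where r: "r \<in> relation_ideal" "g = r + free_theta f"
      by (auto simp: algA_class_eq)
    then have "g = free_theta (free_theta r + f)" "free_theta r \<in> relation_ideal"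
      by (simp_all add: free_theta_add free_theta_invol free_theta_relation_ideal)
    then show "g \<in> theta (algA_class f)"
      unfolding theta_def algA_class_eq by blast
  qed
qed

lemma carrier_algA: "carrier \<A> = range algA_class"
  by (auto simp: algA_def FactRing_def A_RCOSETS_def' algA_class_def free_ring_def)

lemma theta_involutive_anti_automorphism:
  "a \<in> carrier \<A> \<Longrightarrow> theta a \<in> carrier \<A>"
  "a \<in> carrier \<A> \<Longrightarrow> theta (theta a) = a"
  "a \<in> carrier \<A> \<Longrightarrow> b \<in> carrier \<A> \<Longrightarrow> theta (a \<oplus>\<^bsub>\<A>\<^esub> b) = theta a \<oplus>\<^bsub>\<A>\<^esub> theta b"
  "a \<in> carrier \<A> \<Longrightarrow> b \<in> carrier \<A> \<Longrightarrow> theta (a \<otimes>\<^bsub>\<A>\<^esub> b) = theta b \<otimes>\<^bsub>\<A>\<^esub> theta a"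
  "theta (scalar c) = scalar c"
  "theta (Y n) = Ys (- n)"
  "theta (Ys n) = Y (- n)"
  by (auto simp: carrier_algA theta_class algA_class_add algA_class_mult free_theta_add
      free_theta_mult free_theta_invol scalar_def Y_def Ys_def free_Y_def free_Ys_def
      free_theta_single word_theta_def zero_word_def)


section \<open>The modules induced from degree zero\<close>

definition algA0 :: "alg ring"
  where "algA0 = \<A>\<lparr>carrier := algA_deg 0\<rparr>"

definition I0 :: "alg set"
  where "I0 = generate (add_monoid \<A>)
    (\<Union>n\<in>{1..}. {a \<otimes>\<^bsub>\<A>\<^esub> b | a b. a \<in> algA_deg n \<and> b \<in> algA_deg (- n)})"

definition algA0_bar :: "alg set ring"
  where "algA0_bar = algA0 Quot I0"

definition complex_module :: "('a \<Rightarrow> complex \<Rightarrow> complex) \<Rightarrow> ('a, complex) module"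
  where "complex_module s =
    \<lparr>carrier = UNIV, monoid.mult = (*), one = 1, ring.zero = 0, add = (+), smult = s\<rparr>"

text \<open>\<open>s\<close> is the action of a module over the complex algebra \<open>algA0_bar\<close> on the vector space
  of complex numbers in which the images of \<open>Y 0\<close> and \<open>Ys 0\<close> act as 1.\<close>

definition C1_action :: "(alg set \<Rightarrow> complex \<Rightarrow> complex) \<Rightarrow> bool"
  where "C1_action s \<longleftrightarrow>
    left_module algA0_bar (complex_module s) \<and>
    (\<forall>c z. s (I0 +>\<^bsub>algA0\<^esub> scalar c) z = c * z) \<and>
    (\<forall>z. s (I0 +>\<^bsub>algA0\<^esub> Y 0) z = z) \<and>
    (\<forall>z. s (I0 +>\<^bsub>algA0\<^esub> Ys 0) z = z)"

definition algA_le0 :: "alg set"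
  where "algA_le0 = algA_minus <+>\<^bsub>\<A>\<^esub> algA_deg 0"

text \<open>An element \<open>x + a\<close> with \<open>x\<close> in \<open>algA_minus\<close> and \<open>a\<close> of degree 0 acts as \<open>a\<close>.\<close>

definition extended_action :: "(alg set \<Rightarrow> complex \<Rightarrow> complex) \<Rightarrow> alg \<Rightarrow> complex \<Rightarrow> complex"
  where "extended_action s b =
    s (I0 +>\<^bsub>algA0\<^esub> (THE a. a \<in> algA_deg 0 \<and> (\<exists>x\<in>algA_minus. b = x \<oplus>\<^bsub>\<A>\<^esub> a)))"

definition MA1 :: "(alg set \<Rightarrow> complex \<Rightarrow> complex) \<Rightarrow> (alg, (alg \<times> complex \<Rightarrow>\<^sub>0 int) set) module"
  where "MA1 s = tensor_module \<A> algA_le0 (complex_module (extended_action s))"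

definition MA1_tensor ::
  "(alg set \<Rightarrow> complex \<Rightarrow> complex) \<Rightarrow> alg \<Rightarrow> complex \<Rightarrow> (alg \<times> complex \<Rightarrow>\<^sub>0 int) set"
  where "MA1_tensor s = pure_tensor \<A> algA_le0 (complex_module (extended_action s))"

definition v1 :: "(alg set \<Rightarrow> complex \<Rightarrow> complex) \<Rightarrow> (alg \<times> complex \<Rightarrow>\<^sub>0 int) set"
  where "v1 s = MA1_tensor s \<one>\<^bsub>\<A>\<^esub> 1"

definition MA1_deg ::
  "(alg set \<Rightarrow> complex \<Rightarrow> complex) \<Rightarrow> nat \<Rightarrow> (alg \<times> complex \<Rightarrow>\<^sub>0 int) set set"
  where "MA1_deg s n =
    generate (add_monoid (MA1 s)) {MA1_tensor s a z | a z. a \<in> algA_deg (int n)}"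

definition LA1 ::
  "(alg set \<Rightarrow> complex \<Rightarrow> complex) \<Rightarrow> (alg, (alg \<times> complex \<Rightarrow>\<^sub>0 int) set set) module"
  where "LA1 s =
    quotient_module (MA1 s) (THE N. maximal_graded_submodule \<A> (MA1 s) (MA1_deg s) N)"


section \<open>Partitions\<close>

text \<open>Terms are numbered from 0. By monotonicity the nonzero terms are the first
  \<open>partition_length l\<close> ones.\<close>

definition partitions :: "(nat \<Rightarrow> nat) set"
  where "partitions = {l. antimono l \<and> finite {i. l i \<noteq> 0}}"

definition partition_size :: "(nat \<Rightarrow> nat) \<Rightarrow> nat"
  where "partition_size l = (\<Sum>i | l i \<noteq> 0. l i)"

definition partition_length :: "(nat \<Rightarrow> nat) \<Rightarrow> nat"
  where "partition_length l = card {i. l i \<noteq> 0}"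

definition conjugate :: "(nat \<Rightarrow> nat) \<Rightarrow> nat \<Rightarrow> nat"
  where "conjugate l j = card {i. j < l i}"

definition Y_neg :: "(nat \<Rightarrow> nat) \<Rightarrow> alg"
  where "Y_neg l = foldr (\<lambda>i a. Y (- int (l i)) \<otimes>\<^bsub>\<A>\<^esub> a) [0..<partition_length l] \<one>\<^bsub>\<A>\<^esub>"

definition Ys_neg :: "(nat \<Rightarrow> nat) \<Rightarrow> alg"
  where "Ys_neg l = foldr (\<lambda>i a. Ys (- int (l i)) \<otimes>\<^bsub>\<A>\<^esub> a) [0..<partition_length l] \<one>\<^bsub>\<A>\<^esub>"

definition J :: "(alg set \<Rightarrow> complex \<Rightarrow> complex) \<Rightarrow> (alg \<times> complex \<Rightarrow>\<^sub>0 int) set set"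
  where "J s = generated_submodule \<A> (MA1 s)
    {(Y_neg l \<odot>\<^bsub>MA1 s\<^esub> v1 s) \<ominus>\<^bsub>MA1 s\<^esub>
       (scalar ((- 1) ^ partition_size l) \<odot>\<^bsub>MA1 s\<^esub> (Ys_neg (conjugate l) \<odot>\<^bsub>MA1 s\<^esub> v1 s))
     | l. l \<in> partitions}"


section \<open>The Fock space\<close>

text \<open>Polynomials in \<open>x\<^sub>1, x\<^sub>2, \<dots>\<close>. Since monomials are indexed from 0, the variable \<open>x\<^sub>n\<close> has index
  \<open>n - 1\<close>.\<close>

type_synonym fock = "(nat \<Rightarrow>\<^sub>0 nat) \<Rightarrow>\<^sub>0 complex"

definition fock_scale :: "complex \<Rightarrow> fock \<Rightarrow> fock"
  where "fock_scale c p = Poly_Mapping.single 0 c * p"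

interpretation fock: vector_space fock_scale
  by standard (simp_all add: fock_scale_def algebra_simps single_add mult_single
      flip: mult.assoc single_one)

definition fock_var :: "nat \<Rightarrow> fock"
  where "fock_var n = Poly_Mapping.single (Poly_Mapping.single (n - 1) 1) 1"

definition fock_pderiv :: "nat \<Rightarrow> fock \<Rightarrow> fock"
  where "fock_pderiv n p = (\<Sum>m\<in>Poly_Mapping.keys p.
    Poly_Mapping.single (m - Poly_Mapping.single (n - 1) 1)
      (of_nat (Poly_Mapping.lookup m (n - 1)) * Poly_Mapping.lookup p m))"

text \<open>The operators \<open>a\<^sub>n\<close> and \<open>a\<^sub>-\<^sub>n\<close> for \<open>n \<ge> 1\<close>.\<close>

definition annihilate :: "nat \<Rightarrow> fock \<Rightarrow> fock"
  where "annihilate n p = fock_scale (of_nat n) (fock_pderiv n p)"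

definition create :: "nat \<Rightarrow> fock \<Rightarrow> fock"
  where "create n p = fock_var n * p"

text \<open>Formal series in \<open>z\<^sup>\<plusminus>\<^sup>1\<close> with operators as coefficients: \<open>F k\<close> is the coefficient of \<open>z\<^sup>k\<close>.
  All sums below are locally finite, i.e. have finitely many nonzero terms on each polynomial.\<close>

type_synonym op_series = "int \<Rightarrow> fock \<Rightarrow> fock"

definition series_mult :: "op_series \<Rightarrow> op_series \<Rightarrow> op_series"
  where "series_mult F G k p = Sum_any (\<lambda>i. F i (G (k - i) p))"

primrec series_power :: "op_series \<Rightarrow> nat \<Rightarrow> op_series" where
  "series_power F 0 = (\<lambda>k p. if k = 0 then p else 0)"
| "series_power F (Suc j) = series_mult F (series_power F j)"

definition series_exp :: "op_series \<Rightarrow> op_series"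
  where "series_exp F k p = Sum_any (\<lambda>j. fock_scale (1 / fact j) (series_power F j k p))"

text \<open>\<open>create_series\<close> is the sum of \<open>(a\<^sub>-\<^sub>n / n) z\<^sup>n\<close> and \<open>annihilate_series\<close> that of
  \<open>(a\<^sub>n / n) (z\<^sup>-\<^sup>n + z\<^sup>n)\<close>, over \<open>n \<ge> 1\<close>.\<close>

definition create_series :: op_series
  where "create_series k p =
    (if k \<ge> 1 then fock_scale (1 / of_int k) (create (nat k) p) else 0)"

definition annihilate_series :: op_series
  where "annihilate_series k p =
    (if k \<noteq> 0 then fock_scale (1 / of_int \<bar>k\<bar>) (annihilate (nat \<bar>k\<bar>) p) else 0)"

definition Y_series :: op_series
  where "Y_series =
    series_mult (series_exp create_series) (series_exp (\<lambda>k p. - annihilate_series k p))"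

definition Ys_series :: op_series
  where "Ys_series =
    (let G = series_mult (series_exp (\<lambda>k p. - create_series k p)) (series_exp annihilate_series)
     in (\<lambda>k p. G k p - G (k - 2) p))"

definition Y_op :: "int \<Rightarrow> fock \<Rightarrow> fock" where "Y_op n = Y_series (- n)"

definition Ys_op :: "int \<Rightarrow> fock \<Rightarrow> fock" where "Ys_op n = Ys_series (- n)"

fun generator_action :: "generator \<Rightarrow> fock \<Rightarrow> fock" where
  "generator_action (Gen_Y n) = Y_op n"
| "generator_action (Gen_Ys n) = Ys_op n"

definition free_action :: "free_algebra \<Rightarrow> fock \<Rightarrow> fock"
  where "free_action f p = (\<Sum>w\<in>Poly_Mapping.keys f.
    fock_scale (Poly_Mapping.lookup f w) (foldr generator_action (letters w) p))"

text \<open>An element of \<open>\<A>\<close> acts as any of its representatives in the free algebra.\<close>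

definition M1 :: "(alg, fock) module"
  where "M1 = \<lparr>carrier = UNIV, monoid.mult = (*), one = 1, ring.zero = 0, add = (+),
    smult = (\<lambda>C p. the_elem ((\<lambda>f. free_action f p) ` C))\<rparr>"

definition bilinear_form :: "(fock \<Rightarrow> fock \<Rightarrow> complex) \<Rightarrow> bool"
  where "bilinear_form B \<longleftrightarrow>
    (\<forall>v. Vector_Spaces.linear fock_scale (*) (\<lambda>u. B u v)) \<and>
    (\<forall>u. Vector_Spaces.linear fock_scale (*) (B u))"

definition symmetric_form :: "(fock \<Rightarrow> fock \<Rightarrow> complex) \<Rightarrow> bool"
  where "symmetric_form B \<longleftrightarrow> (\<forall>u v. B u v = B v u)"

definition nondegenerate_form :: "(fock \<Rightarrow> fock \<Rightarrow> complex) \<Rightarrow> bool"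
  where "nondegenerate_form B \<longleftrightarrow> (\<forall>u. (\<forall>v. B u v = 0) \<longrightarrow> u = 0)"

definition invariant_form :: "(fock \<Rightarrow> fock \<Rightarrow> complex) \<Rightarrow> bool"
  where "invariant_form B \<longleftrightarrow>
    (\<forall>a\<in>carrier \<A>. \<forall>u v. B (a \<odot>\<^bsub>M1\<^esub> u) v = B u (theta a \<odot>\<^bsub>M1\<^esub> v))"

end

theory Submission
  imports Defs "HOL-Computational_Algebra.Formal_Power_Series" "HOL-Algebra.Subrings"
begin

text \<open>The relations allow one to rewrite every word in the generators, modulo the left ideal that
  annihilates a vacuum vector, as a combination of the \<open>Y\<^sub>-\<^sub>\<lambda>\<close>, and the identity between \<open>Y\<^sub>-\<^sub>\<lambda>\<close> and
  \<open>(-1)\<^sup>|\<^sup>\<lambda>\<^sup>| Y\<^sup>*\<^sub>-\<^sub>\<lambda>\<^sub>'\<close> already holds modulo this ideal. So \<open>J\<close> is zero, and the induced module is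
  spanned by the \<open>Y\<^sub>-\<^sub>\<lambda> v\<^sub>1\<close>.

  On the Fock space the relations commute, up to a scalar series, with multiplication by the \<open>x\<^sub>n\<close>,
  so it suffices to check them on the vacuum 1. A Gaussian functional \<open>\<epsilon>\<close> satisfies
  \<open>\<epsilon> \<circ> Y\<^sub>-\<^sub>n = \<epsilon> \<circ> Y\<^sup>*\<^sub>-\<^sub>n = 0\<close> for \<open>n > 0\<close> and is fixed by \<open>Y\<^sub>0\<close>, \<open>Y\<^sup>*\<^sub>0\<close>; hence
  \<open>\<langle>a 1, b 1\<rangle> = \<epsilon> (\<theta>(a) b 1)\<close> is a well-defined symmetric invariant form, for which the relations make
  the \<open>Y\<^sub>-\<^sub>\<lambda> 1\<close> orthonormal. They are therefore independent, so that the induced module is isomorphic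
  to the Fock space. Applying the adjoint of a \<open>Y\<^sub>-\<^sub>\<lambda>\<close> of maximal size shows that every nonzero vector
  generates the vacuum, so the module is irreducible and its maximal graded submodule is zero.\<close>

section \<open>Operators on the Fock space\<close>

text \<open>The constants of the Gaussian functional come from one computation. If
  \<open>vev (x_n p) = vev (a_n p) + c_n vev p\<close>, then moving exp(sum x_n z^n/n) out of Y(z)
  to the left cancels the positive powers of the annihilation factor and leaves the scalar exp(sum
  z^(2n)/(2n) + sum c_n z^n/n). It is 1 for c_n = -1 at even n and c_n = 0 at odd n. For Ys(z) the
  same c_n give exp(sum z^(2n)/n) = 1/(1 - z^2), which the prefactor 1 - z^2 cancels.

  The obstacle in the relations on the Fock space is that the inverse of (1 - z w) (1 - w/z) has
  different expansions, depending on the order of the two operators. It is therefore never expanded: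
  the factor itself is multiplied to the other side, as a finite difference operator, and identities
  follow from uniqueness for differential equations in w.

  Degrees are carried along in \<open>vac_null\<close> because the one-dimensional module sees
  degree 0 only: there f Y_n with n > 0 lies in \<open>I0\<close> because f has degree n.\<close>

abbreviation fock_linear :: "(fock \<Rightarrow> fock) \<Rightarrow> bool"
  where "fock_linear \<equiv> Vector_Spaces.linear fock_scale fock_scale"

lemma fock_linearI:
  assumes "\<And>p q. f (p + q) = f p + f q" "\<And>c p. f (fock_scale c p) = fock_scale c (f p)"
  shows "fock_linear f"
  using assms fock.vector_space_axioms
  by (simp add: Vector_Spaces.linear_iff)

lemma fock_linearD:
  assumes "fock_linear f"
  shows "f (p + q) = f p + f q" "f (fock_scale c p) = fock_scale c (f p)" "f 0 = 0"
    "f (- p) = - f p" "f (p - q) = f p - f q"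
proof -
  interpret module_hom fock_scale fock_scale f
    using assms by (simp add: Vector_Spaces.linear_def)
  show "f (p + q) = f p + f q" "f (fock_scale c p) = fock_scale c (f p)" "f 0 = 0"
    "f (- p) = - f p" "f (p - q) = f p - f q"
    by (simp_all add: add scale zero neg diff)
qed

lemma fock_linear_sum:
  assumes "fock_linear f"
  shows "f (sum g A) = (\<Sum>a\<in>A. f (g a))"
proof -
  interpret module_hom fock_scale fock_scale f
    using assms by (simp add: Vector_Spaces.linear_def)
  show ?thesis by (simp add: sum)
qed

lemma fock_linear_Sum_any:
  assumes "fock_linear f" "finite {a. g a \<noteq> 0}"
  shows "f (Sum_any g) = Sum_any (\<lambda>a. f (g a))"
proof -
  have "{a. f (g a) \<noteq> 0} \<subseteq> {a. g a \<noteq> 0}"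
    using fock_linearD(3)[OF assms(1)] by auto
  then show ?thesis
    using assms(2) Sum_any.expand_superset[of "{a. g a \<noteq> 0}" "\<lambda>a. f (g a)"]
    by (simp add: Sum_any.expand_set fock_linear_sum[OF assms(1)])
qed

lemma Sum_any_linear:
  assumes "\<And>i. fock_linear (f i)" "\<And>p. finite {i. f i p \<noteq> 0}"
  shows "fock_linear (\<lambda>p. Sum_any (\<lambda>i. f i p))"
proof (rule fock_linearI)
  show "Sum_any (\<lambda>i. f i (p + q)) = Sum_any (\<lambda>i. f i p) + Sum_any (\<lambda>i. f i q)" for p q
    using assms by (simp add: fock_linearD(1) Sum_any.distrib)
  show "Sum_any (\<lambda>i. f i (fock_scale c p)) = fock_scale c (Sum_any (\<lambda>i. f i p))" for c p
    using assms by (simp add: fock_linearD(2)) (simp add: fock_scale_def Sum_any_right_distrib)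
qed

lemma fock_scale_mult: "fock_scale c (p * q) = fock_scale c p * q"
  "p * fock_scale c q = fock_scale c (p * q)"
  by (simp_all add: fock_scale_def ac_simps)

lemma of_nat_mult_fock: "of_nat n * p = fock_scale (of_nat n) p" for p :: fock
  by (simp add: fock_scale_def)

lemma fock_linear_mult: "fock_linear ((*) r)"
  by (rule fock_linearI) (simp_all only: distrib_left fock_scale_mult(2))

lemma fock_linear_comp: "fock_linear f \<Longrightarrow> fock_linear g \<Longrightarrow> fock_linear (\<lambda>p. f (g p))"
  by (rule fock_linearI) (simp_all add: fock_linearD)

lemma fock_linear_add: "fock_linear f \<Longrightarrow> fock_linear g \<Longrightarrow> fock_linear (\<lambda>p. f p + g p)"
  by (rule fock_linearI) (simp_all add: fock_linearD algebra_simps)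

lemma fock_linear_diff: "fock_linear f \<Longrightarrow> fock_linear g \<Longrightarrow> fock_linear (\<lambda>p. f p - g p)"
  by (rule fock_linearI) (simp_all add: fock_linearD algebra_simps)

lemma fock_linear_scale: "fock_linear f \<Longrightarrow> fock_linear (\<lambda>p. fock_scale c (f p))"
  by (rule fock_linearI) (simp_all add: fock_linearD algebra_simps)

lemma fock_linear_zero: "fock_linear (\<lambda>p. 0)"
  by (rule fock_linearI) simp_all

lemma fock_linear_id: "fock_linear (\<lambda>p. p)"
  by (rule fock_linearI) simp_all

lemma poly_mapping_single_induct [case_names single add]:
  fixes p :: "'a \<Rightarrow>\<^sub>0 'b::monoid_add"
  assumes "\<And>m c. P (Poly_Mapping.single m c)" "\<And>p q. P p \<Longrightarrow> P q \<Longrightarrow> P (p + q)"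
  shows "P p"
proof (induction p rule: update_induct)
  case const
  show ?case using assms(1)[of undefined 0] by simp
next
  case (update p m c)
  have "Poly_Mapping.update m c p = p + Poly_Mapping.single m c"
    using update.hyps
    by (intro poly_mapping_eqI) (auto simp: lookup_update lookup_add lookup_single in_keys_iff)
  then show ?case using assms update.IH by metis
qed

subsection \<open>Partial derivatives\<close>

lemma fock_pderiv_superset:
  assumes "finite K" "Poly_Mapping.keys p \<subseteq> K"
  shows "fock_pderiv n p = (\<Sum>m\<in>K. Poly_Mapping.single (m - Poly_Mapping.single (n - 1) 1)
      (of_nat (Poly_Mapping.lookup m (n - 1)) * Poly_Mapping.lookup p m))"
  unfolding fock_pderiv_def using assms
  by (intro sum.mono_neutral_left) (auto simp: in_keys_iff)

lemma fock_pderiv_add: "fock_pderiv n (p + q) = fock_pderiv n p + fock_pderiv n q"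
proof -
  let ?K = "Poly_Mapping.keys p \<union> Poly_Mapping.keys q"
  have "Poly_Mapping.keys (p + q) \<subseteq> ?K" by (rule keys_add)
  then show ?thesis
    by (simp add: fock_pderiv_superset[of ?K] lookup_add algebra_simps single_add sum.distrib)
qed

lemma fock_pderiv_scale: "fock_pderiv n (fock_scale c p) = fock_scale c (fock_pderiv n p)"
proof -
  have l: "Poly_Mapping.lookup (fock_scale c p) m = c * Poly_Mapping.lookup p m" for m
    by (simp add: fock_scale_def Poly_Mapping.map.rep_eq when_def flip: mult_map_scale_conv_mult)
  have "Poly_Mapping.keys (fock_scale c p) \<subseteq> Poly_Mapping.keys p"
    by (auto simp: in_keys_iff l)
  then show ?thesis
    by (simp add: fock_pderiv_superset[of "Poly_Mapping.keys p"] l fock.scale_sum_right)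
      (simp add: fock_scale_def mult_single mult.left_commute)
qed

lemma fock_linear_pderiv: "fock_linear (fock_pderiv n)"
  by (rule fock_linearI) (simp_all add: fock_pderiv_add fock_pderiv_scale)

lemma fock_pderiv_single:
  "fock_pderiv n (Poly_Mapping.single m c) =
    Poly_Mapping.single (m - Poly_Mapping.single (n - 1) 1) (of_nat (Poly_Mapping.lookup m (n - 1)) * c)"
  by (subst fock_pderiv_superset[of "{m}"]) auto

text \<open>Induction on the total degree of a monomial. In the step for x_n p the hypothesis is
  available for a_n p as well, which is needed where multiplication by x_n is traded for a_n, as in
  \<open>vev_Y\<close>.\<close>

lemma fock_annihilate_induct [case_names one add scale var]:
  assumes "P 1" "\<And>p q. P p \<Longrightarrow> P q \<Longrightarrow> P (p + q)" "\<And>c p. P p \<Longrightarrow> P (fock_scale c p)"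
    "\<And>n p. n \<ge> 1 \<Longrightarrow> P p \<Longrightarrow> P (annihilate n p) \<Longrightarrow> P (fock_var n * p)"
  shows "P p"
proof -
  define size where "size m = (\<Sum>i\<in>Poly_Mapping.keys m. Poly_Mapping.lookup m i)" for m :: "nat \<Rightarrow>\<^sub>0 nat"
  have size_less: "size (m - Poly_Mapping.single i 1) < size m" if "i \<in> Poly_Mapping.keys m" for m i
  proof -
    let ?m = "m - Poly_Mapping.single i 1"
    have "Poly_Mapping.keys ?m \<subseteq> Poly_Mapping.keys m"
      by (auto simp: in_keys_iff lookup_minus)
    then have "size ?m = (\<Sum>i\<in>Poly_Mapping.keys m. Poly_Mapping.lookup ?m i)"
      unfolding size_def by (intro sum.mono_neutral_left) (auto simp: in_keys_iff)
    also have "\<dots> < size m"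
      unfolding size_def
      by (rule sum_strict_mono_ex1) (use that in \<open>auto simp: lookup_minus lookup_single when_def in_keys_iff\<close>)
    finally show ?thesis .
  qed
  have "P (Poly_Mapping.single m c)" for m c
  proof (induction "size m" arbitrary: m c rule: less_induct)
    case less
    show ?case
    proof (cases "m = 0")
      case True
      then show ?thesis using assms(3)[OF assms(1), of c] by (simp add: fock_scale_def)
    next
      case False
      then obtain i where i: "i \<in> Poly_Mapping.keys m" by (metis ex_in_conv keys_eq_empty)
      define m' where "m' = m - Poly_Mapping.single i 1"
      have "Poly_Mapping.lookup m i \<ge> 1" using i by (simp add: in_keys_iff)
      then have m: "m = Poly_Mapping.single i 1 + m'"
        unfolding m'_def
        by (intro poly_mapping_eqI) (auto simp: lookup_add lookup_minus lookup_single when_def)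
      have 1: "P (Poly_Mapping.single m' c)" for c
        using less size_less[OF i] by (simp add: m'_def)
      have "P (Poly_Mapping.single (m' - Poly_Mapping.single i 1) d)" if "i \<in> Poly_Mapping.keys m'" for d
        using less size_less[OF i] size_less[OF that] by (simp add: m'_def)
      \<comment> \<open>If x_(i+1) does not occur in m', the derivative is 0, and \<open>P 0\<close>
        comes from scaling by 0.\<close>
      then have "P (annihilate (Suc i) (Poly_Mapping.single m' c))"
        using assms(3)[OF 1, of 0 0] 
        by (cases "i \<in> Poly_Mapping.keys m'")
          (auto simp: annihilate_def fock_pderiv_single in_keys_iff intro: assms(3))
      then have "P (fock_var (Suc i) * Poly_Mapping.single m' c)"
        using 1 by (intro assms(4)) auto
      then show ?thesis by (simp add: fock_var_def mult_single m)
    qed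
  qed
  then show ?thesis by (induction p rule: poly_mapping_single_induct) (auto intro: assms(2))
qed

lemma fock_induct [case_names one add scale var]:
  assumes "P 1" "\<And>p q. P p \<Longrightarrow> P q \<Longrightarrow> P (p + q)" "\<And>c p. P p \<Longrightarrow> P (fock_scale c p)"
    "\<And>n p. n \<ge> 1 \<Longrightarrow> P p \<Longrightarrow> P (fock_var n * p)"
  shows "P p"
  by (induction p rule: fock_annihilate_induct) (simp_all add: assms)

lemma fock_pderiv_one [simp]: "fock_pderiv n 1 = 0"
  using fock_pderiv_single[of n 0 1] by simp

lemma fock_pderiv_var:
  assumes "n \<ge> 1" "k \<ge> 1"
  shows "fock_pderiv n (fock_var k * p) = fock_var k * fock_pderiv n p + (if n = k then p else 0)"
proof (induction p rule: poly_mapping_single_induct)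
  case (single m c)
  show ?case
  proof (cases "n = k")
    case True
    let ?i = "n - 1"
    have 1: "Poly_Mapping.single ?i 1 + m - Poly_Mapping.single ?i 1 = m" by simp
    \<comment> \<open>Subtraction of exponents is truncated. It can be undone only if x_n divides
      the monomial; otherwise the coefficient of the derivative is 0.\<close>
    have 2: "Poly_Mapping.single ?i 1 + (m - Poly_Mapping.single ?i 1) = m"
      if "Poly_Mapping.lookup m ?i \<noteq> 0"
      using that
      by (intro poly_mapping_eqI) (auto simp: lookup_add lookup_minus lookup_single when_def)
    show ?thesis
      using True 2 by (cases "Poly_Mapping.lookup m ?i = 0")
        (auto simp: fock_var_def mult_single fock_pderiv_single 1 lookup_add lookup_single
          algebra_simps single_add)
  next
    case False
    then have ne: "n - 1 \<noteq> k - 1" using assms by auto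
    have "Poly_Mapping.single (k - 1) 1 + m - Poly_Mapping.single (n - 1) 1
        = Poly_Mapping.single (k - 1) 1 + (m - Poly_Mapping.single (n - 1) 1)"
      using ne by (intro poly_mapping_eqI) (auto simp: lookup_add lookup_minus lookup_single when_def)
    then show ?thesis
      using False ne
      by (simp add: fock_var_def mult_single fock_pderiv_single lookup_add lookup_single)
  qed
next
  case (add p q)
  then show ?case by (simp add: algebra_simps fock_pderiv_add)
qed

subsection \<open>Exponentials of the annihilation operators\<close>

definition locally_finite :: "op_series \<Rightarrow> bool"
  where "locally_finite F \<longleftrightarrow> (\<forall>k. fock_linear (F k)) \<and> (\<forall>p. finite {k. F k p \<noteq> 0})"

text \<open>Local finiteness is demanded of the right factor alone: the exponential of the creation
  operators, which stands on the left in a vertex operator, is infinite in z.\<close>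

lemma finite_series_mult:
  assumes F: "\<And>i. fock_linear (F i)" and G: "locally_finite G"
  shows "finite {i. F i (G (k - i) p) \<noteq> 0}"
proof -
  have "{i. F i (G (k - i) p) \<noteq> 0} \<subseteq> (\<lambda>l. k - l) ` {l. G l p \<noteq> 0}"
  proof
    fix i assume "i \<in> {i. F i (G (k - i) p) \<noteq> 0}"
    then have "G (k - i) p \<noteq> 0" using fock_linearD(3)[OF F] by auto
    then show "i \<in> (\<lambda>l. k - l) ` {l. G l p \<noteq> 0}" by (intro image_eqI[of _ _ "k - i"]) auto
  qed
  then show ?thesis
    by (rule finite_subset) (use G in \<open>auto simp: locally_finite_def\<close>)
qed

lemma linear_series_mult:
  assumes F: "\<And>i. fock_linear (F i)" and G: "locally_finite G"
  shows "fock_linear (series_mult F G k)"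
  unfolding series_mult_def
  by (rule Sum_any_linear)
    (use assms in \<open>auto simp: locally_finite_def intro: fock_linear_comp finite_series_mult[OF assms]\<close>)

lemma locally_finite_series_mult:
  assumes F: "locally_finite F" and G: "locally_finite G"
  shows "locally_finite (series_mult F G)"
  unfolding locally_finite_def
proof (intro conjI allI)
  show "fock_linear (series_mult F G k)" for k
    using F G by (intro linear_series_mult) (auto simp: locally_finite_def)
next
  fix p
  let ?L = "{l. G l p \<noteq> 0}"
  have "{k. series_mult F G k p \<noteq> 0} \<subseteq> (\<Union>l\<in>?L. (\<lambda>i. i + l) ` {i. F i (G l p) \<noteq> 0})"
  proof
    fix k assume "k \<in> {k. series_mult F G k p \<noteq> 0}"
    then obtain i where i: "F i (G (k - i) p) \<noteq> 0"
      unfolding series_mult_def by (auto elim: Sum_any.not_neutral_obtains_not_neutral)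
    then have "k - i \<in> ?L" using F fock_linearD(3) by (auto simp: locally_finite_def)
    with i show "k \<in> (\<Union>l\<in>?L. (\<lambda>i. i + l) ` {i. F i (G l p) \<noteq> 0})"
      by (intro UN_I[of "k - i"] image_eqI[of _ _ i]) auto
  qed
  then show "finite {k. series_mult F G k p \<noteq> 0}"
    by (rule finite_subset) (use F G in \<open>auto simp: locally_finite_def\<close>)
qed

text \<open>As a_n / n is d/dx_n, this is c times the sum of (z^n + z^-n) d/dx_n.\<close>

definition pderiv_series :: "complex \<Rightarrow> op_series"
  where "pderiv_series c k p = (if k \<noteq> 0 then fock_scale c (fock_pderiv (nat \<bar>k\<bar>) p) else 0)"

lemma annihilate_series_eq:
  "annihilate_series = pderiv_series 1" "(\<lambda>k p. - annihilate_series k p) = pderiv_series (- 1)"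
  by (auto simp: fun_eq_iff annihilate_series_def pderiv_series_def annihilate_def)

lemma fock_pderiv_eventually_zero: "\<exists>N. \<forall>n\<ge>N. fock_pderiv n p = 0"
proof (induction p rule: fock_induct)
  case (add p q)
  then obtain M N where "\<forall>n\<ge>M. fock_pderiv n p = 0" "\<forall>n\<ge>N. fock_pderiv n q = 0" by auto
  then show ?case by (intro exI[of _ "max M N"]) (auto simp: fock_pderiv_add)
next
  case (scale c p)
  then show ?case by (auto simp: fock_pderiv_scale)
next
  case (var k p)
  then obtain N where "\<forall>n\<ge>N. fock_pderiv n p = 0" by auto
  then show ?case using var(1) by (intro exI[of _ "N + k + 1"]) (auto simp: fock_pderiv_var)
qed auto

lemma locally_finite_pderiv_series: "locally_finite (pderiv_series c)"
  unfolding locally_finite_def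
proof (intro conjI allI)
  show "fock_linear (pderiv_series c k)" for k
    using fock_linear_scale[OF fock_linear_pderiv] fock_linear_zero
    by (cases "k = 0") (simp_all add: pderiv_series_def[abs_def])
next
  fix p
  obtain N where N: "\<forall>n\<ge>N. fock_pderiv n p = 0" using fock_pderiv_eventually_zero by blast
  have "{k. pderiv_series c k p \<noteq> 0} \<subseteq> {- int N..int N}"
  proof
    fix k assume "k \<in> {k. pderiv_series c k p \<noteq> 0}"
    then have "fock_pderiv (nat \<bar>k\<bar>) p \<noteq> 0" by (auto simp: pderiv_series_def split: if_splits)
    then have "nat \<bar>k\<bar> < N" using N by (meson not_le)
    then show "k \<in> {- int N..int N}" by auto
  qed
  then show "finite {k. pderiv_series c k p \<noteq> 0}" by (rule finite_subset) simp
qed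

lemma pderiv_series_one: "pderiv_series c k 1 = 0"
  by (simp add: pderiv_series_def)

lemma pderiv_series_var:
  assumes "n \<ge> 1"
  shows "pderiv_series c k (fock_var n * p) =
    fock_var n * pderiv_series c k p + (if \<bar>k\<bar> = int n then fock_scale c p else 0)"
proof (cases "k = 0")
  case False
  then have "nat \<bar>k\<bar> \<ge> 1" by auto
  then show ?thesis using assms False
    by (auto simp: pderiv_series_def fock_pderiv_var fock.scale_right_distrib fock_scale_mult(2))
qed (use assms in \<open>simp add: pderiv_series_def\<close>)

lemma locally_finite_series_power:
  assumes "locally_finite F"
  shows "locally_finite (series_power F j)"
proof (induction j)
  case 0
  have "fock_linear (\<lambda>p. if k = 0 then p else 0)" for k :: int
    using fock_linear_id fock_linear_zero by (cases "k = 0") auto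
  moreover have "{k. (if k = 0 then p else 0) \<noteq> 0} \<subseteq> {0}" for p :: fock by auto
  then have "finite {k::int. (if k = 0 then p else 0) \<noteq> 0}" for p :: fock
    by (rule finite_subset) simp
  ultimately show ?case by (simp add: locally_finite_def)
qed (simp add: locally_finite_series_mult assms)

lemma series_power_pderiv_Suc_one: "series_power (pderiv_series c) (Suc j) k 1 = 0"
proof (induction j arbitrary: k)
  case 0
  have e: "(\<lambda>i. pderiv_series c i (if k - i = 0 then 1 else 0)) = (\<lambda>i. 0)"
    using fock_linearD(3) locally_finite_pderiv_series
    by (auto simp: fun_eq_iff pderiv_series_one locally_finite_def)
  show ?case unfolding series_power.simps series_mult_def e by simp
next
  case (Suc j)
  show ?case
    unfolding series_power.simps(2)[of _ "Suc j"] series_mult_def Suc.IH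
    using fock_linearD(3)[of "pderiv_series c _"] locally_finite_pderiv_series
    by (simp add: locally_finite_def)
qed

text \<open>The commutator of the series A with x_n is the scalar series c (z^n + z^-n), hence
  [A^j, x_n] = j c (z^n + z^-n) A^(j-1). For j = 0 the factor j hides the truncated
  exponent.\<close>

lemma series_power_pderiv_var:
  assumes n: "n \<ge> 1"
  shows "series_power (pderiv_series c) j k (fock_var n * p) =
    fock_var n * series_power (pderiv_series c) j k p
    + fock_scale (of_nat j * c) (series_power (pderiv_series c) (j - 1) (k - int n) p
        + series_power (pderiv_series c) (j - 1) (k + int n) p)"
proof (induction j arbitrary: k)
  case 0
  then show ?case by simp
next
  case (Suc j)
  let ?A = "pderiv_series c" and ?S = "\<lambda>j k. series_power (pderiv_series c) j k p"
  have lin: "fock_linear (?A i)" "fock_linear (series_power ?A j i)" for i j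
    using locally_finite_series_power[OF locally_finite_pderiv_series] locally_finite_pderiv_series
    by (auto simp: locally_finite_def)
  have fin: "finite {i. ?A i (?S j (k - i)) \<noteq> 0}" for j k
    using finite_series_mult[OF lin(1) locally_finite_series_power[OF locally_finite_pderiv_series]] .
  \<comment> \<open>\<open>?B\<close> is the commutator of x_n with the leftmost factor. It is
    supported at i = n and i = -n, which are distinct because n >= 1.\<close>
  let ?B = "\<lambda>i. if \<bar>i\<bar> = int n then fock_scale c (?S j (k - i)) else 0"
  let ?d = "of_nat j * c :: complex"
  have sup: "{i. ?B i \<noteq> 0} \<subseteq> {int n, - int n}" by auto
  have finB: "finite {i. ?B i \<noteq> 0}" by (rule finite_subset[OF sup]) simp
  have B: "Sum_any ?B = fock_scale c (?S j (k - int n) + ?S j (k + int n))"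
    using n by (subst Sum_any.expand_superset[OF _ sup]) (simp_all add: fock.scale_right_distrib)
  have IH: "series_power ?A j (k - i) (fock_var n * p) = fock_var n * ?S j (k - i)
      + fock_scale ?d (?S (j - 1) (k - int n - i) + ?S (j - 1) (k + int n - i))" for i
    using Suc.IH[of "k - i"] by (simp add: algebra_simps)
  have "series_power ?A (Suc j) k (fock_var n * p) = Sum_any (\<lambda>i. ?A i (fock_var n * ?S j (k - i)
      + fock_scale ?d (?S (j - 1) (k - int n - i) + ?S (j - 1) (k + int n - i))))"
    by (simp only: series_power.simps series_mult_def IH)
  also have "\<dots> = Sum_any (\<lambda>i. (fock_var n * ?A i (?S j (k - i)) + ?B i)
      + (fock_scale ?d (?A i (?S (j - 1) (k - int n - i))) + fock_scale ?d (?A i (?S (j - 1) (k + int n - i)))))"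
    by (intro Sum_any.cong)
       (simp add: fock_linearD[OF lin(1)] pderiv_series_var[OF n] fock.scale_right_distrib)
  also have "\<dots> = (fock_var n * Sum_any (\<lambda>i. ?A i (?S j (k - i))) + Sum_any ?B)
      + (fock_scale ?d (Sum_any (\<lambda>i. ?A i (?S (j - 1) (k - int n - i))))
       + fock_scale ?d (Sum_any (\<lambda>i. ?A i (?S (j - 1) (k + int n - i)))))"
  proof -
    have f: "finite {i. h (?A i (?S j (k - i))) \<noteq> 0}" if "h 0 = 0" for h :: "fock \<Rightarrow> fock" and j k
      by (rule finite_subset[OF _ fin[of j k]]) (use that in auto)
    have f1: "finite {i. fock_var n * ?A i (?S j (k - i)) \<noteq> 0}" for k
      by (rule f) simp
    have f2: "finite {i. fock_scale ?d (?A i (?S (j - 1) (k - i))) \<noteq> 0}" for k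
      by (rule f) simp
    have sm: "Sum_any (\<lambda>i. fock_scale ?d (?A i (?S (j - 1) (k - i)))) =
        fock_scale ?d (Sum_any (\<lambda>i. ?A i (?S (j - 1) (k - i))))" for k
      using fock_linear_Sum_any[OF fock_linear_scale[OF fock_linear_id] fin] by metis
    have f12: "finite {i. fock_var n * ?A i (?S j (k - i)) + ?B i \<noteq> 0}"
      by (rule finite_subset[OF _ finite_UnI[OF f1 finB]]) auto
    have f22: "finite {i. fock_scale ?d (?A i (?S (j - 1) (k - int n - i)))
        + fock_scale ?d (?A i (?S (j - 1) (k + int n - i))) \<noteq> 0}"
      by (rule finite_subset[OF _ finite_UnI[OF f2[of "k - int n"] f2[of "k + int n"]]]) auto
    show ?thesis
      unfolding Sum_any.distrib[OF f12 f22] Sum_any.distrib[OF f1 finB]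
        Sum_any.distrib[OF f2[of "k - int n"] f2[of "k + int n"]]
        sm Sum_any_right_distrib[OF fin, symmetric] ..
  qed
  also have "\<dots> = fock_var n * ?S (Suc j) k + fock_scale c (?S j (k - int n) + ?S j (k + int n))
      + fock_scale ?d (?S (Suc (j - 1)) (k - int n) + ?S (Suc (j - 1)) (k + int n))"
    by (simp add: B series_mult_def fock.scale_right_distrib)
  also have "\<dots> = fock_var n * ?S (Suc j) k
      + fock_scale (of_nat (Suc j) * c) (?S j (k - int n) + ?S j (k + int n))"
  proof (cases j)
    case (Suc i)
    have "of_nat (Suc j) * c = c + ?d" by (simp add: algebra_simps)
    then show ?thesis by (simp only: Suc diff_Suc_1 fock.scale_left_distrib add.assoc)
  qed simp
  finally show ?case by simp
qed

text \<open>Every application of the series lowers the polynomial degree. The bound does not depend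
  on k, so all coefficients of the exponential are finite sums over the same range.\<close>

lemma series_power_pderiv_eventually_zero:
  "\<exists>N. \<forall>j\<ge>N. \<forall>k. series_power (pderiv_series c) j k p = 0"
proof -
  have lin: "fock_linear (series_power (pderiv_series c) j i)" for i j
    using locally_finite_series_power[OF locally_finite_pderiv_series]
    by (auto simp: locally_finite_def)
  show ?thesis
  proof (induction p rule: fock_induct)
    case one
    show ?case
      by (intro exI[of _ 1]) (metis series_power_pderiv_Suc_one Suc_le_D One_nat_def)
  next
    case (add p q)
    then obtain M N where "\<forall>j\<ge>M. \<forall>k. series_power (pderiv_series c) j k p = 0"
      "\<forall>j\<ge>N. \<forall>k. series_power (pderiv_series c) j k q = 0" by auto
    then show ?case by (intro exI[of _ "max M N"]) (auto simp: fock_linearD[OF lin])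
  next
    case (scale d p)
    then show ?case by (auto simp: fock_linearD[OF lin])
  next
    case (var n p)
    then obtain N where "\<forall>j\<ge>N. \<forall>k. series_power (pderiv_series c) j k p = 0" by auto
    then show ?case using var(1)
      by (intro exI[of _ "Suc N"]) (auto simp: series_power_pderiv_var)
  qed
qed

abbreviation exp_pderiv :: "complex \<Rightarrow> op_series"
  where "exp_pderiv c \<equiv> series_exp (pderiv_series c)"

lemma exp_pderiv_eq_sum:
  assumes "\<And>j k. j \<ge> N \<Longrightarrow> series_power (pderiv_series c) j k p = 0"
  shows "exp_pderiv c k p = (\<Sum>j<N. fock_scale (1 / fact j) (series_power (pderiv_series c) j k p))"
  unfolding series_exp_def
  by (rule Sum_any.expand_superset) (use assms in \<open>auto intro: ccontr simp: not_less\<close>)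

lemma locally_finite_exp_pderiv: "locally_finite (exp_pderiv c)"
  unfolding locally_finite_def
proof (intro conjI allI)
  have lf: "locally_finite (series_power (pderiv_series c) j)" for j
    by (rule locally_finite_series_power[OF locally_finite_pderiv_series])
  show "fock_linear (exp_pderiv c k)" for k
    unfolding series_exp_def
  proof (rule Sum_any_linear)
    show "fock_linear (\<lambda>p. fock_scale (1 / fact j) (series_power (pderiv_series c) j k p))" for j
      using lf by (intro fock_linear_scale) (simp add: locally_finite_def)
    fix p
    obtain N where N: "\<forall>j\<ge>N. \<forall>k. series_power (pderiv_series c) j k p = 0"
      using series_power_pderiv_eventually_zero by blast
    show "finite {j. fock_scale (1 / fact j) (series_power (pderiv_series c) j k p) \<noteq> 0}"
      by (rule finite_subset[of _ "{..<N}"]) (use N in \<open>auto intro: ccontr simp: not_less\<close>)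
  qed
  fix p
  obtain N where N: "\<forall>j\<ge>N. \<forall>k. series_power (pderiv_series c) j k p = 0"
    using series_power_pderiv_eventually_zero by blast
  have "{k. exp_pderiv c k p \<noteq> 0} \<subseteq> (\<Union>j<N. {k. series_power (pderiv_series c) j k p \<noteq> 0})"
  proof
    fix k assume "k \<in> {k. exp_pderiv c k p \<noteq> 0}"
    then have "(\<Sum>j<N. fock_scale (1 / fact j) (series_power (pderiv_series c) j k p)) \<noteq> 0"
      using exp_pderiv_eq_sum[of N c p k] N by auto
    then obtain j where "j < N" "series_power (pderiv_series c) j k p \<noteq> 0"
      by (force elim: sum.not_neutral_contains_not_neutral)
    then show "k \<in> (\<Union>j<N. {k. series_power (pderiv_series c) j k p \<noteq> 0})" by auto
  qed
  then show "finite {k. exp_pderiv c k p \<noteq> 0}"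
    by (rule finite_subset) (use lf in \<open>auto simp: locally_finite_def\<close>)
qed

lemma exp_pderiv_one: "exp_pderiv c k 1 = (if k = 0 then 1 else 0)"
proof -
  have "exp_pderiv c k 1 = (\<Sum>j<1. fock_scale (1 / fact j) (series_power (pderiv_series c) j k 1))"
    by (rule exp_pderiv_eq_sum) (metis series_power_pderiv_Suc_one Suc_le_D One_nat_def)
  then show ?thesis by simp
qed

text \<open>Conjugating x_n by exp(A) adds the scalar commutator [A, x_n] = c (z^n + z^-n).\<close>

lemma exp_pderiv_var:
  assumes n: "n \<ge> 1"
  shows "exp_pderiv c k (fock_var n * p) = fock_var n * exp_pderiv c k p
    + fock_scale c (exp_pderiv c (k - int n) p + exp_pderiv c (k + int n) p)"
proof -
  let ?S = "\<lambda>j k. series_power (pderiv_series c) j k p"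
  obtain N where "\<forall>j\<ge>N. \<forall>k. ?S j k = 0"
    using series_power_pderiv_eventually_zero by blast
  then have N: "\<And>j k. j \<ge> N \<Longrightarrow> ?S j k = 0" by simp
  have "exp_pderiv c k (fock_var n * p) =
      (\<Sum>j<Suc N. fock_scale (1 / fact j) (series_power (pderiv_series c) j k (fock_var n * p)))"
    by (rule exp_pderiv_eq_sum) (use N n in \<open>auto simp: series_power_pderiv_var\<close>)
  also have "\<dots> = (\<Sum>j<Suc N. fock_var n * fock_scale (1 / fact j) (?S j k))
      + (\<Sum>j<Suc N. fock_scale (1 / fact j * (of_nat j * c)) (?S (j - 1) (k - int n) + ?S (j - 1) (k + int n)))"
    by (simp only: series_power_pderiv_var[OF n] fock.scale_right_distrib fock_scale_mult(2)
        fock.scale_scale sum.distrib)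
  also have "(\<Sum>j<Suc N. fock_var n * fock_scale (1 / fact j) (?S j k)) = fock_var n * exp_pderiv c k p"
    unfolding sum_distrib_left[symmetric]
    by (subst exp_pderiv_eq_sum[of "Suc N"]) (use N in auto)
  \<comment> \<open>The commutator term carries a factor j, so it starts at j = 1, and j / j! = 1 /
    (j-1)! turns it into the same exponential series.\<close>
  also have "(\<Sum>j<Suc N. fock_scale (1 / fact j * (of_nat j * c)) (?S (j - 1) (k - int n) + ?S (j - 1) (k + int n)))
      = (\<Sum>j<N. fock_scale (1 / fact (Suc j) * (of_nat (Suc j) * c)) (?S j (k - int n) + ?S j (k + int n)))"
    by (subst sum.lessThan_Suc_shift) simp
  also have "\<dots> = (\<Sum>j<N. fock_scale c (fock_scale (1 / fact j) (?S j (k - int n) + ?S j (k + int n))))"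
  proof (intro sum.cong refl)
    fix j
    have "1 / fact (Suc j) * (of_nat (Suc j) * c) = c * (1 / fact j)"
      by (simp del: of_nat_Suc)
    then show "fock_scale (1 / fact (Suc j) * (of_nat (Suc j) * c)) (?S j (k - int n) + ?S j (k + int n))
        = fock_scale c (fock_scale (1 / fact j) (?S j (k - int n) + ?S j (k + int n)))"
      by (simp only: fock.scale_scale)
  qed
  also have "\<dots> = fock_scale c (exp_pderiv c (k - int n) p + exp_pderiv c (k + int n) p)"
    using N by (simp add: exp_pderiv_eq_sum[of N] fock.scale_right_distrib fock.scale_sum_right sum.distrib)
  finally show ?thesis .
qed

unbundle fps_syntax

subsection \<open>Exponentials of the creation operators\<close>

text \<open>Multiplication operators commute, so powers of the operator series become powers of this
  power series over the polynomial ring.\<close>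

definition create_fps :: "complex \<Rightarrow> fock fps"
  where "create_fps c = Abs_fps (\<lambda>k. if k = 0 then 0 else fock_scale (c / of_nat k) (fock_var k))"

text \<open>In terms of the power sums \<open>x\<^sub>n\<close>, \<open>hsym 1 k\<close> is the complete symmetric function of degree \<open>k\<close>,
  and \<open>hsym (- 1) k\<close> is the elementary one up to sign.\<close>

definition hsym :: "complex \<Rightarrow> int \<Rightarrow> fock"
  where "hsym c k = (if k \<ge> 0
    then \<Sum>j\<le>nat k. fock_scale (1 / fact j) (create_fps c ^ j $ nat k) else 0)"

abbreviation create_term :: "complex \<Rightarrow> op_series"
  where "create_term c \<equiv> (\<lambda>k p. if k \<ge> 1 then fock_scale (c / of_int k) (create (nat k) p) else 0)"

lemma create_series_eq: "create_series = create_term 1" "(\<lambda>k p. - create_series k p) = create_term (- 1)"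
  by (auto simp: fun_eq_iff create_series_def fock.scale_left_distrib)

lemma series_power_create:
  "series_power (create_term c) j k p = (if k \<ge> 0 then create_fps c ^ j $ nat k * p else 0)"
proof (induction j arbitrary: k)
  case (Suc j)
  let ?f = "\<lambda>i. create_term c i (if k - i \<ge> 0 then create_fps c ^ j $ nat (k - i) * p else 0)"
  have "series_power (create_term c) (Suc j) k p = Sum_any ?f"
    by (simp only: series_power.simps series_mult_def Suc.IH)
  also have "\<dots> = sum ?f {0..k}"
    by (rule Sum_any.expand_superset) (auto split: if_splits simp: create_def)
  also have "\<dots> = (\<Sum>i\<in>{0..k}. create_fps c $ nat i * (create_fps c ^ j $ (nat k - nat i)) * p)"
    by (intro sum.cong refl) (auto simp: create_fps_def create_def fock_scale_mult(1) nat_diff_distrib mult.assoc)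
  also have "\<dots> = (if k \<ge> 0 then \<Sum>i=0..nat k. create_fps c $ i * (create_fps c ^ j $ (nat k - i)) * p else 0)"
  proof (cases "k \<ge> 0")
    case True
    have "(\<Sum>i\<in>{0..k}. create_fps c $ nat i * (create_fps c ^ j $ (nat k - nat i)) * p)
      = (\<Sum>i=0..nat k. create_fps c $ i * (create_fps c ^ j $ (nat k - i)) * p)"
      by (rule sum.reindex_bij_witness[of _ int nat]) (use True in auto)
    then show ?thesis using True by simp
  qed simp
  finally show ?case by (simp add: fps_mult_nth sum_distrib_right)
qed simp

lemma create_fps_power_nth: "k < j \<Longrightarrow> create_fps c ^ j $ k = 0"
  using startsby_zero_power_prefix[of "create_fps c"] by (simp add: create_fps_def)

lemma series_exp_create: "series_exp (create_term c) k p = hsym c k * p"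
proof (cases "k \<ge> 0")
  case True
  have "series_exp (create_term c) k p = (\<Sum>j\<le>nat k. fock_scale (1 / fact j) (series_power (create_term c) j k p))"
    unfolding series_exp_def
    by (rule Sum_any.expand_superset)
      (use True create_fps_power_nth in \<open>auto simp: series_power_create intro: ccontr simp: not_le\<close>)
  then show ?thesis
    using True by (simp add: series_power_create hsym_def sum_distrib_right fock_scale_mult(1))
next
  case False
  then have "series_power (create_term c) j k p = 0" for j
    by (simp only: series_power_create if_False)
  then show ?thesis using False by (simp add: series_exp_def hsym_def)
qed

lemma series_exp_create_eq: "series_exp (create_term c) = (\<lambda>k. (*) (hsym c k))"
  by (simp only: fun_eq_iff series_exp_create simp_thms)

lemma hsym_neg: "k < 0 \<Longrightarrow> hsym c k = 0"
  by (simp add: hsym_def)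

lemma hsym_0: "hsym c 0 = 1"
  by (simp add: hsym_def)

text \<open>Newton's identity. The series H = exp(C) satisfies H' = C' H, and C' has the
  coefficients c x_(n+1).\<close>

lemma hsym_rec:
  "of_nat m * hsym c (int m) = fock_scale c (\<Sum>i=1..m. fock_var i * hsym c (int m - int i))"
proof (cases m)
  case (Suc n)
  let ?C = "create_fps c"
  have N: "hsym c (int k) = (\<Sum>j\<le>N. fock_scale (1 / fact j) (?C ^ j $ k))" if "k \<le> N" for k N
    unfolding hsym_def using that
    by (auto intro!: sum.mono_neutral_left intro: ccontr simp: create_fps_power_nth not_le)
  have d: "fps_deriv ?C $ i = fock_scale c (fock_var (Suc i))" for i
  proof -
    have "of_nat (Suc i) * (c / of_nat (Suc i)) = c" by (simp del: of_nat_Suc)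
    then show ?thesis by (simp only: fps_deriv_nth create_fps_def fps_nth_Abs_fps Suc_eq_plus1[symmetric]
        of_nat_mult_fock fock.scale_scale nat.distinct if_False)
  qed
  have "of_nat (Suc n) * hsym c (int (Suc n))
      = (\<Sum>j\<le>Suc n. fock_scale (1 / fact j) (fps_deriv (?C ^ j) $ n))"
    unfolding N[OF order_refl] sum_distrib_left fock_scale_mult(2) fps_deriv_nth Suc_eq_plus1 ..
  also have "\<dots> = (\<Sum>j\<le>n. fock_scale (1 / fact (Suc j)) (fps_deriv (?C ^ Suc j) $ n))"
    by (subst sum.atMost_Suc_shift) simp
  also have "\<dots> = (\<Sum>j\<le>n. fock_scale (1 / fact j) ((fps_deriv ?C * ?C ^ j) $ n))"
  proof (intro sum.cong refl)
    fix j
    have "1 / fact (Suc j) * of_nat (Suc j) = (1 / fact j :: complex)" by (simp del: of_nat_Suc)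
    then show "fock_scale (1 / fact (Suc j)) (fps_deriv (?C ^ Suc j) $ n)
        = fock_scale (1 / fact j) ((fps_deriv ?C * ?C ^ j) $ n)"
      by (simp only: fps_deriv_power diff_Suc_1 mult.assoc fps_mult_left_const_nth of_nat_mult_fock fock.scale_scale)
  qed
  also have "\<dots> = (\<Sum>j\<le>n. \<Sum>i=0..n. fps_deriv ?C $ i * fock_scale (1 / fact j) (?C ^ j $ (n - i)))"
    by (simp add: fps_mult_nth fock.scale_sum_right fock_scale_mult(2))
  also have "\<dots> = (\<Sum>i=0..n. fps_deriv ?C $ i * hsym c (int n - int i))"
    by (subst sum.swap) (auto intro!: sum.cong simp: N[of _ n] sum_distrib_left simp flip: of_nat_diff)
  also have "\<dots> = fock_scale c (\<Sum>i=0..n. fock_var (Suc i) * hsym c (int n - int i))"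
    by (simp only: d fock.scale_sum_right fock_scale_mult(1))
  also have "(\<Sum>i=0..n. fock_var (Suc i) * hsym c (int n - int i))
      = (\<Sum>i=1..Suc n. fock_var i * hsym c (int (Suc n) - int i))"
    by (rule sum.reindex_bij_witness[of _ "\<lambda>i. i - 1" Suc]) (auto simp: of_nat_diff)
  finally show ?thesis using Suc by simp
qed simp

lemma fock_of_nat_mult_cancel: "m > 0 \<Longrightarrow> of_nat m * p = of_nat m * q \<Longrightarrow> p = q" for p q :: fock
  unfolding of_nat_mult_fock by (metis fock.scale_left_imp_eq of_nat_eq_0_iff neq0_conv fock.scale_left_commute fock.scale_cancel_left)

subsection \<open>Vertex operators\<close>

text \<open>\<open>vop 1 a\<close> is the coefficient of \<open>z\<^sup>a\<close> in \<open>Y(z)\<close>, and \<open>vop (- 1) a\<close> that in \<open>Y\<^sup>*(z) / (1 - z\<^sup>2)\<close>.\<close>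

definition vop :: "complex \<Rightarrow> op_series"
  where "vop c = series_mult (\<lambda>k. (*) (hsym c k)) (exp_pderiv (- c))"

lemma Y_op_eq: "Y_op n = vop 1 (- n)"
  unfolding Y_op_def Y_series_def vop_def annihilate_series_eq(2) create_series_eq(1)
    series_exp_create_eq ..

lemma Ys_op_eq: "Ys_op n p = vop (- 1) (- n) p - vop (- 1) (- n - 2) p"
  unfolding Ys_op_def Ys_series_def vop_def annihilate_series_eq(1) create_series_eq(2)
    series_exp_create_eq by (simp add: Let_def)

lemma fock_linear_vop: "fock_linear (vop c a)"
  unfolding vop_def by (rule linear_series_mult[OF fock_linear_mult locally_finite_exp_pderiv])

lemmas vop_linear = fock_linearD[OF fock_linear_vop]

lemma vop_one: "vop c a 1 = hsym c a"
  by (simp add: vop_def series_mult_def exp_pderiv_one if_distrib cong: if_cong)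

text \<open>x_n commutes with the creation factor, so its commutator with the whole operator comes
  from the annihilation factor and is a scalar series times the operator.\<close>

lemma vop_var:
  assumes n: "n \<ge> 1"
  shows "vop c a (fock_var n * p) =
    fock_var n * vop c a p - fock_scale c (vop c (a - int n) p + vop c (a + int n) p)"
proof -
  let ?X = "exp_pderiv (- c)"
  have fin: "finite {i. hsym c i * ?X (a - i) p \<noteq> 0}" for a
    by (rule finite_series_mult[OF fock_linear_mult locally_finite_exp_pderiv])
  have fin': "finite {i. h (hsym c i * ?X (a - i) p) \<noteq> 0}" if "h 0 = 0" for h :: "fock \<Rightarrow> fock" and a
    by (rule finite_subset[OF _ fin[of a]]) (use that in auto)
  have f1: "finite {i. fock_var n * (hsym c i * ?X (a - i) p) \<noteq> 0}" for a by (rule fin') simp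
  have f2: "finite {i. fock_scale (- c) (hsym c i * ?X (a - i) p) \<noteq> 0}" for a by (rule fin') simp
  have f22: "finite {i. fock_scale (- c) (hsym c i * ?X (a - int n - i) p)
      + fock_scale (- c) (hsym c i * ?X (a + int n - i) p) \<noteq> 0}"
    by (rule finite_subset[OF _ finite_UnI[OF f2[of "a - int n"] f2[of "a + int n"]]]) auto
  have e: "hsym c i * ?X (a - i) (fock_var n * p) = fock_var n * (hsym c i * ?X (a - i) p)
      + (fock_scale (- c) (hsym c i * ?X (a - int n - i) p)
        + fock_scale (- c) (hsym c i * ?X (a + int n - i) p))" for i
  proof -
    have "a - i - int n = a - int n - i" "a - i + int n = a + int n - i" by simp_all
    then show ?thesis
      unfolding exp_pderiv_var[OF n]
      by (simp only: distrib_left fock_scale_mult(2) fock.scale_right_distrib mult.left_commute)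
  qed
  have s: "Sum_any (\<lambda>i. fock_scale (- c) (hsym c i * ?X (a - i) p))
      = fock_scale (- c) (Sum_any (\<lambda>i. hsym c i * ?X (a - i) p))" for a
    using fock_linear_Sum_any[OF fock_linear_scale[OF fock_linear_id] fin] by metis
  show ?thesis
    unfolding vop_def series_mult_def e Sum_any.distrib[OF f1 f22]
      Sum_any.distrib[OF f2[of "a - int n"] f2[of "a + int n"]] s
      Sum_any_right_distrib[OF fin, symmetric]
    by (simp add: fock.scale_right_distrib)
qed

lemma fock_linear_annihilate: "fock_linear (annihilate n)"
  unfolding annihilate_def[abs_def] by (rule fock_linear_scale[OF fock_linear_pderiv])

lemmas annihilate_linear = fock_linearD[OF fock_linear_annihilate]

lemma annihilate_one: "annihilate n 1 = 0"
  by (simp add: annihilate_def)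

lemma annihilate_var:
  "n \<ge> 1 \<Longrightarrow> k \<ge> 1 \<Longrightarrow>
    annihilate n (fock_var k * p) = fock_var k * annihilate n p + (if n = k then of_nat n * p else 0)"
  by (simp add: annihilate_def fock_pderiv_var fock.scale_right_distrib fock_scale_mult(2)
      of_nat_mult_fock)

text \<open>Differentiating exp(c sum x_n z^n / n) by x_n multiplies it by c z^n / n, and a_n = n
  d/dx_n removes the denominator. Coefficientwise this is an induction along
  \<open>hsym_rec\<close>.\<close>

lemma annihilate_hsym:
  assumes n: "n \<ge> 1"
  shows "annihilate n (hsym c k) = fock_scale c (hsym c (k - int n))"
proof (cases "k \<ge> 0")
  case True
  have "annihilate n (hsym c (int m)) = fock_scale c (hsym c (int m - int n))" for m
  proof (induction m rule: less_induct)
    case (less m)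
    show ?case
    proof (cases "m = 0")
      case True
      then show ?thesis using n by (simp add: hsym_0 hsym_neg annihilate_one)
    next
      case False
      let ?h = "\<lambda>i. hsym c (int m - int i)"
      have IH: "annihilate n (?h i) = fock_scale c (hsym c (int m - int n - int i))" if "i \<in> {1..m}" for i
        using less[of "m - i"] that by (simp add: algebra_simps of_nat_diff)
      have "of_nat m * annihilate n (hsym c (int m)) = fock_scale c (\<Sum>i=1..m. annihilate n (fock_var i * ?h i))"
      proof -
        have "of_nat m * annihilate n (hsym c (int m)) = annihilate n (of_nat m * hsym c (int m))"
          by (simp add: of_nat_mult_fock annihilate_linear(2))
        then show ?thesis by (simp only: hsym_rec annihilate_linear(2) fock_linear_sum[OF fock_linear_annihilate])
      qed
      also have "(\<Sum>i=1..m. annihilate n (fock_var i * ?h i))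
          = (\<Sum>i=1..m. fock_var i * fock_scale c (hsym c (int m - int n - int i)))
            + (\<Sum>i=1..m. if n = i then of_nat n * ?h i else 0)"
        unfolding sum.distrib[symmetric] by (intro sum.cong refl) (use n in \<open>auto simp: annihilate_var IH\<close>)
      also have "(\<Sum>i=1..m. if n = i then of_nat n * ?h i else 0) = of_nat n * ?h n"
        using n by (auto simp: hsym_neg)
      also have "(\<Sum>i=1..m. fock_var i * fock_scale c (hsym c (int m - int n - int i)))
          = of_nat (m - n) * hsym c (int m - int n)"
      proof (cases "n \<le> m")
        case True
        then have e: "int m - int n = int (m - n)" by simp
        have "(\<Sum>i=1..m. fock_var i * fock_scale c (hsym c (int (m - n) - int i)))
            = (\<Sum>i=1..m - n. fock_var i * fock_scale c (hsym c (int (m - n) - int i)))"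
          using True by (intro sum.mono_neutral_right) (auto simp: hsym_neg)
        then show ?thesis unfolding e hsym_rec by (simp add: fock.scale_sum_right fock_scale_mult(2))
      next
        case False
        then show ?thesis by (simp add: hsym_neg)
      qed
      \<comment> \<open>Newton's identity contributes m - n and the derivative of x_n itself
        contributes n; for n > m both sides are 0.\<close>
      also have "of_nat (m - n) * hsym c (int m - int n) + of_nat n * ?h n = of_nat m * ?h n"
        by (cases "n \<le> m") (simp_all add: hsym_neg of_nat_diff algebra_simps)
      finally show ?thesis
        using False fock_of_nat_mult_cancel[of m "annihilate n (hsym c (int m))" "fock_scale c (?h n)"]
        by (simp add: fock_scale_mult(2))
    qed
  qed
  from this[of "nat k"] True show ?thesis by simp
qed (use n in \<open>simp add: hsym_neg annihilate_linear\<close>)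

text \<open>Only the creation factor fails to commute with a_n, whence the one-sided shift to a - n,
  in contrast to \<open>vop_var\<close>.\<close>

lemma annihilate_vop:
  assumes n: "n \<ge> 1"
  shows "annihilate n (vop c a p) = vop c a (annihilate n p) + fock_scale c (vop c (a - int n) p)"
proof (induction p arbitrary: a rule: fock_induct)
  case one
  then show ?case by (simp add: vop_one vop_linear annihilate_one annihilate_hsym[OF n])
next
  case (add p q)
  then show ?case by (simp add: vop_linear annihilate_linear fock.scale_right_distrib)
next
  case (scale d p)
  then show ?case
    by (simp only: vop_linear annihilate_linear fock.scale_right_distrib fock.scale_left_commute)
next
  case (var k p)
  have e: "a - int k - int n = a - int n - int k" "a + int k - int n = a - int n + int k" by simp_all
  define d where "d = (if n = k then of_nat n else 0 :: complex)"
  have v: "annihilate n (fock_var k * q) = fock_var k * annihilate n q + fock_scale d q" for q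
    by (simp add: annihilate_var[OF n var(1)] d_def of_nat_mult_fock)
  show ?case
    by (simp add: vop_var[OF var(1)] v annihilate_linear vop_linear var(2) e
        distrib_left right_diff_distrib fock.scale_right_distrib
        fock.scale_right_diff_distrib fock_scale_mult(2) mult.commute[of d])
qed

subsection \<open>The defining relations\<close>

text \<open>If \<open>f m k\<close> is the coefficient of \<open>w\<^sup>m z\<^sup>k\<close> in \<open>F\<close>, then \<open>twist f m k\<close> is that in
  \<open>(1 - z w) (1 - w / z) F\<close>, and \<open>twist_rec d e f\<close> is a differential equation in \<open>w\<close> in which
  twisting by this factor lowers \<open>e\<close> by 1.\<close>

definition twist :: "(int \<Rightarrow> int \<Rightarrow> fock) \<Rightarrow> int \<Rightarrow> int \<Rightarrow> fock"
  where "twist f m k = f m k - f (m - 1) (k - 1) - f (m - 1) (k + 1) + f (m - 2) k"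

definition twist_rec :: "complex \<Rightarrow> complex \<Rightarrow> (int \<Rightarrow> int \<Rightarrow> fock) \<Rightarrow> bool"
  where "twist_rec d e f \<longleftrightarrow> (\<forall>m<0. \<forall>k. f m k = 0) \<and>
    (\<forall>m::nat. \<forall>k. of_nat m * f (int m) k =
      fock_scale d (\<Sum>i=1..m. fock_var i * f (int m - int i) k)
      + fock_scale e (\<Sum>i=1..m. f (int m - int i) (k - int i) + f (int m - int i) (k + int i)))"

text \<open>The recursion with a common summation bound for all m <= N, so that shifted copies of it
  can be added termwise in \<open>twist_rec_twist\<close>.\<close>

lemma twist_rec_le:
  assumes "twist_rec d e f" "m \<le> int N"
  shows "of_int m * f m k = fock_scale d (\<Sum>i=1..N. fock_var i * f (m - int i) k)
      + fock_scale e (\<Sum>i=1..N. f (m - int i) (k - int i) + f (m - int i) (k + int i))"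
proof (cases "m < 0")
  case True
  then show ?thesis using assms by (simp add: twist_rec_def)
next
  case False
  then obtain n where n: "m = int n" "n \<le> N" using assms(2) by (metis nonneg_int_cases not_less of_nat_le_iff)
  have "(\<Sum>i=1..n. fock_var i * f (m - int i) k) = (\<Sum>i=1..N. fock_var i * f (m - int i) k)"
    using n assms(1) by (intro sum.mono_neutral_left) (auto simp: twist_rec_def)
  moreover have "(\<Sum>i=1..n. f (m - int i) (k - int i) + f (m - int i) (k + int i))
      = (\<Sum>i=1..N. f (m - int i) (k - int i) + f (m - int i) (k + int i))"
    using n assms(1) by (intro sum.mono_neutral_left) (auto simp: twist_rec_def)
  ultimately show ?thesis
    using assms(1) n(1) by (simp add: twist_rec_def)
qed

lemma twist_rec_unique:
  assumes f: "twist_rec d e f" and g: "twist_rec d e g" and "\<And>k. f 0 k = g 0 k"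
  shows "f m k = g m k"
proof (cases "m < 0")
  case True
  then show ?thesis using f g by (simp add: twist_rec_def)
next
  case False
  have "f (int n) k = g (int n) k" for n k
  proof (induction n arbitrary: k rule: less_induct)
    case (less n)
    have "f (int n - int i) k = g (int n - int i) k" if "i \<in> {1..n}" for i k
      using less[of "n - i"] that by (simp add: of_nat_diff)
    then have "of_nat n * f (int n) k = of_nat n * g (int n) k"
      using f g by (simp add: twist_rec_def)
    then show ?case using assms(3) fock_of_nat_mult_cancel by (cases "n = 0") auto
  qed
  from this[of "nat m"] False show ?thesis by simp
qed

text \<open>In generating functions: the sum of w^i (z^i + z^-i) over i >= 1, multiplied by (1 - z
  w) (1 - w/z), is the polynomial w (z + 1/z) - 2 w^2. This is why \<open>twist\<close> preserves
  equations of the type \<open>twist_rec\<close>.\<close>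

lemma twist_telescope:
  assumes "\<And>m k. m < 0 \<Longrightarrow> f m k = 0"
  shows "(\<Sum>i=1..m. twist f (int m - int i) (k - int i) + twist f (int m - int i) (k + int i))
    = f (int m - 1) (k - 1) + f (int m - 1) (k + 1) - 2 * f (int m - 2) k"
proof -
  \<comment> \<open>Chosen so that the summand is \<open>?t i - ?t (Suc i)\<close>; the last term
    involves f only at negative powers of w and vanishes.\<close>
  let ?t = "\<lambda>i. f (int m - int i) (k - int i) + f (int m - int i) (k + int i)
    - f (int m - int i - 1) (k - int i + 1) - f (int m - int i - 1) (k + int i - 1)"
  have "(\<Sum>i=1..m. twist f (int m - int i) (k - int i) + twist f (int m - int i) (k + int i))
      = (\<Sum>i=1..m. ?t i - ?t (Suc i))"
    by (intro sum.cong refl) (simp add: twist_def algebra_simps)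
  also have "\<dots> = - (\<Sum>i=1..m. ?t (Suc i) - ?t i)"
    by (simp add: sum_negf[symmetric])
  also have "(\<Sum>i=1..m. ?t (Suc i) - ?t i) = ?t (Suc m) - ?t 1"
    by (rule sum_Suc_diff) simp
  also have "?t (Suc m) = 0" using assms by simp
  finally show ?thesis by (simp add: algebra_simps)
qed

text \<open>The logarithmic derivative w d/dw of (1 - z w) (1 - w/z) is minus the sum of w^i (z^i +
  z^-i); the product rule adds it to e times that sum.\<close>

lemma twist_rec_twist:
  assumes f: "twist_rec d e f"
  shows "twist_rec d (e - 1) (twist f)"
  unfolding twist_rec_def
proof (intro conjI allI impI)
  have neg: "\<And>m k. m < 0 \<Longrightarrow> f m k = 0" using f by (simp add: twist_rec_def)
  then show "twist f m k = 0" if "m < 0" for m k using that by (simp add: twist_def)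
  fix m :: nat and k
  let ?R = "\<lambda>a k. fock_scale d (\<Sum>i=1..m. fock_var i * f (a - int i) k)
      + fock_scale e (\<Sum>i=1..m. f (a - int i) (k - int i) + f (a - int i) (k + int i))"
  let ?T = "\<Sum>i=1..m. twist f (int m - int i) (k - int i) + twist f (int m - int i) (k + int i)"
  let ?m = "int m"
  have R: "of_int a * f a k = ?R a k" if "a \<le> ?m" for a k
    using twist_rec_le[OF f that] .
  \<comment> \<open>Each shifted copy of f has its own weight m, m - 1 or m - 2; the defect against
    m is what \<open>twist_telescope\<close> evaluates.\<close>
  have "of_nat m * twist f ?m k = of_int ?m * f ?m k - of_int (?m - 1) * f (?m - 1) (k - 1)
      - of_int (?m - 1) * f (?m - 1) (k + 1) + of_int (?m - 2) * f (?m - 2) k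
      - (f (?m - 1) (k - 1) + f (?m - 1) (k + 1) - 2 * f (?m - 2) k)"
    by (simp add: twist_def algebra_simps)
  also have "\<dots> = ?R ?m k - ?R (?m - 1) (k - 1) - ?R (?m - 1) (k + 1) + ?R (?m - 2) k - ?T"
    using R[of ?m k] R[of "?m - 1" "k - 1"] R[of "?m - 1" "k + 1"] R[of "?m - 2" k]
      twist_telescope[of f m k, OF neg] by simp
  also have "?R ?m k - ?R (?m - 1) (k - 1) - ?R (?m - 1) (k + 1) + ?R (?m - 2) k
      = fock_scale d (\<Sum>i=1..m. fock_var i * twist f (?m - int i) k) + fock_scale e ?T"
  proof -
    have 1: "fock_var i * twist f (?m - int i) k = fock_var i * f (?m - int i) k
        - fock_var i * f (?m - 1 - int i) (k - 1) - fock_var i * f (?m - 1 - int i) (k + 1)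
        + fock_var i * f (?m - 2 - int i) k" for i
      by (simp add: twist_def algebra_simps)
    have 2: "twist f (?m - int i) (k - int i) + twist f (?m - int i) (k + int i)
        = (f (?m - int i) (k - int i) + f (?m - int i) (k + int i))
        - (f (?m - 1 - int i) (k - 1 - int i) + f (?m - 1 - int i) (k - 1 + int i))
        - (f (?m - 1 - int i) (k + 1 - int i) + f (?m - 1 - int i) (k + 1 + int i))
        + (f (?m - 2 - int i) (k - int i) + f (?m - 2 - int i) (k + int i))" for i
      by (simp add: twist_def algebra_simps)
    show ?thesis
      unfolding 1 2 sum.distrib[of "\<lambda>i. a i + b i - c i - d i" for a b c d] sum.distrib sum_subtractf
        fock.scale_right_distrib fock.scale_right_diff_distrib
      by (simp only: algebra_simps)
  qed
  also have "\<dots> - ?T = fock_scale d (\<Sum>i=1..m. fock_var i * twist f (?m - int i) k) + fock_scale (e - 1) ?T"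
    by (simp add: fock.scale_left_diff_distrib)
  finally show "of_nat m * twist f ?m k = fock_scale d (\<Sum>i=1..m. fock_var i * twist f (?m - int i) k)
      + fock_scale (e - 1) ?T" .
qed

lemma twist_rec_hsym: "twist_rec d 0 (\<lambda>m k. hsym d m * p k)"
proof -
  have "of_nat m * (hsym d (int m) * p k)
      = fock_scale d (\<Sum>i=1..m. fock_var i * (hsym d (int m - int i) * p k))" for m k
    by (simp only: mult.assoc[symmetric] hsym_rec fock_scale_mult(1)[symmetric] sum_distrib_right)
  then show ?thesis by (simp add: twist_rec_def hsym_neg)
qed

text \<open>Commuting each x_i of Newton's identity for H_d(w) past the vertex operator adds -c d
  times (w z)^i + (w/z)^i. The solution is thus ((1 - z w) (1 - w/z))^(c d) H_c(z) H_d(w), expanded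
  in w.\<close>

lemma twist_rec_vop: "twist_rec d (- c * d) (\<lambda>m k. vop c k (hsym d m))"
  unfolding twist_rec_def
proof (intro conjI allI impI)
  show "vop c k (hsym d m) = 0" if "m < 0" for m k using that by (simp add: hsym_neg vop_linear)
  fix m :: nat and k
  have "of_nat m * vop c k (hsym d (int m)) = vop c k (of_nat m * hsym d (int m))"
    by (simp add: of_nat_mult_fock vop_linear)
  also have "\<dots> = fock_scale d (\<Sum>i=1..m. vop c k (fock_var i * hsym d (int m - int i)))"
    by (simp only: hsym_rec vop_linear fock_linear_sum[OF fock_linear_vop])
  also have "(\<Sum>i=1..m. vop c k (fock_var i * hsym d (int m - int i)))
      = (\<Sum>i=1..m. fock_var i * vop c k (hsym d (int m - int i)))
        - fock_scale c (\<Sum>i=1..m. vop c (k - int i) (hsym d (int m - int i)) + vop c (k + int i) (hsym d (int m - int i)))"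
    unfolding fock.scale_sum_right sum_subtractf[symmetric] by (intro sum.cong refl) (simp add: vop_var)
  finally show "of_nat m * vop c k (hsym d (int m)) =
      fock_scale d (\<Sum>i=1..m. fock_var i * vop c k (hsym d (int m - int i)))
      + fock_scale (- c * d) (\<Sum>i=1..m. vop c (k - int i) (hsym d (int m - int i)) + vop c (k + int i) (hsym d (int m - int i)))"
    by (simp add: fock.scale_right_diff_distrib mult.commute)
qed

text \<open>Here c d = 1, so the factor is a polynomial: one \<open>twist\<close> of the product
  H_c(w) H_c(z).\<close>

lemma vop_hsym_same:
  assumes "c * c = 1"
  shows "vop c a (hsym c b) = hsym c b * hsym c a - hsym c (b - 1) * hsym c (a - 1)
    - hsym c (b - 1) * hsym c (a + 1) + hsym c (b - 2) * hsym c a"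
proof -
  have 1: "twist_rec c (0 - 1) (\<lambda>m k. vop c k (hsym c m))"
    using twist_rec_vop[of c c] assms by simp
  have 2: "twist_rec c (0 - 1) (twist (\<lambda>m k. hsym c m * hsym c k))"
    by (rule twist_rec_twist[OF twist_rec_hsym])
  show ?thesis
    using twist_rec_unique[OF 1 2, where m = b and k = a]
    by (simp add: twist_def hsym_0 hsym_neg vop_one)
qed

text \<open>Here c d = -1; instead of expanding the inverse of the factor, the factor is multiplied
  to the left side.\<close>

lemma vop_hsym_opposite:
  assumes "c * c = 1"
  shows "vop c a (hsym (- c) b) - vop c (a - 1) (hsym (- c) (b - 1)) - vop c (a + 1) (hsym (- c) (b - 1))
    + vop c a (hsym (- c) (b - 2)) = hsym c a * hsym (- c) b"
proof -
  have 1: "twist_rec (- c) (1 - 1) (twist (\<lambda>m k. vop c k (hsym (- c) m)))"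
    using twist_rec_twist[OF twist_rec_vop[of "- c" c]] assms by simp
  have 2: "twist_rec (- c) (1 - 1) (\<lambda>m k. hsym (- c) m * hsym c k)"
    using twist_rec_hsym[of "- c"] by simp
  show ?thesis
    using twist_rec_unique[OF 1 2, where m = b and k = a]
    by (simp add: twist_def hsym_0 hsym_neg vop_one vop_linear mult.commute)
qed

text \<open>The defining expression satisfies a homogeneous commutation relation with every \<open>x\<^sub>n\<close>, hence
  it vanishes as soon as it kills the vacuum vector 1.\<close>

lemma vop_relation_same:
  assumes c: "c * c = 1"
  shows "vop c a (vop c b p) + vop c (b - 1) (vop c (a + 1) p) = 0"
proof (induction p arbitrary: a b rule: fock_induct)
  case one
  \<comment> \<open>z (1 - z w) (1 - w/z) is antisymmetric in z and w.\<close>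
  show ?case by (simp add: vop_one vop_hsym_same[OF c] algebra_simps)
next
  case (add p q)
  have "vop c a (vop c b (p + q)) + vop c (b - 1) (vop c (a + 1) (p + q))
    = (vop c a (vop c b p) + vop c (b - 1) (vop c (a + 1) p))
      + (vop c a (vop c b q) + vop c (b - 1) (vop c (a + 1) q))"
    by (simp add: vop_linear)
  then show ?case using add by simp
next
  case (scale d p)
  then show ?case by (simp add: vop_linear flip: fock.scale_right_distrib)
next
  case (var n p)
  let ?O = "\<lambda>a b. vop c a (vop c b p) + vop c (b - 1) (vop c (a + 1) p)"
  have "vop c a (vop c b (fock_var n * p)) + vop c (b - 1) (vop c (a + 1) (fock_var n * p))
     = fock_var n * ?O a b - fock_scale c (?O (a - int n) b + ?O (a + int n) b
         + (?O a (b - int n) + ?O a (b + int n)))"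
    by (simp only: vop_var[OF var(1)] vop_linear)
      (simp add: fock.scale_right_distrib fock.scale_right_diff_distrib algebra_simps)
  then show ?case by (simp only: var(2)) simp
qed

text \<open>H_1(z) H_(-1)(z) = 1: by Newton's identity the derivative of the product vanishes, and
  its constant term is 1.\<close>

lemma sum_hsym_mult: "(\<Sum>k<Suc s. hsym 1 (int k) * hsym (- 1) (int s - int k)) = (if s = 0 then 1 else 0)"
proof -
  define H where "H c = Abs_fps (\<lambda>k. hsym c (int k))" for c
  define D where "D = Abs_fps (\<lambda>k. fock_var (Suc k))"
  have H: "fps_deriv (H c) = fps_const (Poly_Mapping.single 0 c) * D * H c" for c
  proof (rule fps_ext)
    fix n
    have "(\<Sum>i=1..Suc n. fock_var i * hsym c (int (Suc n) - int i))
        = (\<Sum>i=0..n. fock_var (Suc i) * hsym c (int n - int i))"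
      by (rule sum.reindex_bij_witness[of _ Suc "\<lambda>i. i - 1"]) (auto simp: of_nat_diff algebra_simps)
    then have "fps_deriv (H c) $ n = fock_scale c (\<Sum>i=0..n. fock_var (Suc i) * hsym c (int n - int i))"
      using hsym_rec[of "Suc n" c] by (simp add: H_def)
    also have "(\<Sum>i=0..n. fock_var (Suc i) * hsym c (int n - int i)) = (D * H c) $ n"
      unfolding fps_mult_nth by (rule sum.cong) (auto simp: H_def D_def of_nat_diff)
    also have "fock_scale c ((D * H c) $ n) = (fps_const (Poly_Mapping.single 0 c) * (D * H c)) $ n"
      unfolding fps_mult_left_const_nth fock_scale_def ..
    finally show "fps_deriv (H c) $ n = (fps_const (Poly_Mapping.single 0 c) * D * H c) $ n"
      by (simp only: mult.assoc)
  qed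
  have "fps_deriv (H 1 * H (- 1)) = 0"
    by (simp add: H single_uminus fps_const_neg[symmetric] del: fps_const_neg)
  then have "H 1 * H (- 1) = fps_const ((H 1 * H (- 1)) $ 0)"
    by (simp only: fps_deriv_eq_0_iff)
  also have "(H 1 * H (- 1)) $ 0 = 1" by (simp add: H_def hsym_0)
  finally have "(H 1 * H (- 1)) $ s = (if s = 0 then 1 else 0)"
    by simp
  moreover have "(H 1 * H (- 1)) $ s = (\<Sum>k<Suc s. hsym 1 (int k) * hsym (- 1) (int s - int k))"
    unfolding fps_mult_nth
    by (rule sum.cong) (auto simp: H_def of_nat_diff)
  ultimately show ?thesis by simp
qed

lemma int_shift_const:
  fixes f :: "int \<Rightarrow> 'a"
  assumes "\<And>x. f (x + 1) = f x"
  shows "f x = f 0"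
proof (induction x rule: int_induct[of _ 0])
  case (step2 i)
  then show ?case using assms[of "i - 1"] by simp
qed (simp_all add: assms)

text \<open>\<open>R + S\<close> below is constant on the antidiagonals, so the delta function that arises from the two
  different expansions of the rational coefficient is found without an infinite sum.\<close>

lemma vop_relation_mixed_one:
  "(vop 1 a (hsym (- 1) b) + vop (- 1) (b + 1) (hsym 1 (a - 1)))
    - (vop 1 a (hsym (- 1) (b - 2)) + vop (- 1) (b - 1) (hsym 1 (a - 1)))
    = (if a + b = 0 then 1 else 0)"
proof -
  define U where "U a b = vop 1 a (hsym (- 1) b)" for a b
  define V where "V a b = vop (- 1) b (hsym 1 a)" for a b
  define T where "T a b = U a b + V (a - 1) (b + 1)" for a b
  define R where "R a b = U a b - U (a - 1) (b - 1)" for a b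
  define S where "S a b = V (a - 1) (b + 1) - V (a - 2) b" for a b
  have negU: "U a b = 0" if "b < 0" for a b using that by (simp add: U_def hsym_neg vop_linear)
  have negV: "V a b = 0" if "a < 0" for a b using that by (simp add: V_def hsym_neg vop_linear)
  have lin: "x - y = (z - w) + p" if "x - y - z + w = p" for x y z w p :: fock
    unfolding that[symmetric] by simp
  have e: "b - 1 - 1 = b - 2" "a + 1 - 1 = a" "a + 1 - 2 = a - 1" "b - 1 + 1 = b" for a b :: int by simp_all
  \<comment> \<open>\<open>R\<close> and \<open>S\<close> obey recursions along the antidiagonals
    with opposite source terms, so the source cancels in R + S.\<close>
  have R: "R a b = R (a + 1) (b - 1) + hsym 1 a * hsym (- 1) b" for a b
    using lin[OF vop_hsym_opposite[of 1 a b]] unfolding R_def U_def e by simp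
  have S: "S (a + 1) (b - 1) = S a b + hsym 1 a * hsym (- 1) b" for a b
    using lin[OF vop_hsym_opposite[of "- 1" b a]] unfolding S_def V_def e
    by (simp only: mult.commute[of "hsym 1 a"] minus_minus mult_minus1 simp_thms)
  \<comment> \<open>Walking along the antidiagonal until the second index is negative, where
    \<open>R\<close> vanishes, collects the complete sum of \<open>sum_hsym_mult\<close>.\<close>
  have R0: "R 0 s = (if s = 0 then 1 else 0)" for s
  proof (cases "s < 0")
    case True
    then show ?thesis by (simp add: R_def negU)
  next
    case False
    then obtain n where n: "s = int n" by (metis nonneg_int_cases not_less)
    have "R 0 s = R (int k) (s - int k) + (\<Sum>i<k. hsym 1 (int i) * hsym (- 1) (s - int i))" for k
    proof (induction k)
      case (Suc k)
      have "int (Suc k) = int k + 1" "s - int (Suc k) = s - int k - 1" by simp_all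
      then show ?case by (simp only: Suc R[of "int k" "s - int k"] sum.lessThan_Suc ac_simps)
    qed simp
    from this[of "Suc n"] show ?thesis
      unfolding n sum_hsym_mult by (simp add: R_def negU)
  qed
  have Z: "R a b + S a b = (if a + b = 0 then 1 else 0)" for a b
  proof -
    have "R a ((a + b) - a) + S a ((a + b) - a) = R 0 (a + b - 0) + S 0 (a + b - 0)"
    proof (rule int_shift_const[where f = "\<lambda>x. R x ((a + b) - x) + S x ((a + b) - x)"])
      fix x
      have e: "a + b - (x + 1) = a + b - x - 1" by simp
      show "R (x + 1) (a + b - (x + 1)) + S (x + 1) (a + b - (x + 1)) = R x (a + b - x) + S x (a + b - x)"
        unfolding e R[of x "a + b - x"] S[of x "a + b - x"] by (simp add: add_ac)
    qed
    also have "S 0 (a + b - 0) = 0" by (simp add: S_def negV)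
    finally show ?thesis by (simp add: R0)
  qed
  have T: "T a b - T (a - 1) (b - 1) = (if a + b = 0 then 1 else 0)" for a b
    unfolding Z[symmetric] T_def R_def S_def by simp
  define d :: "int \<Rightarrow> fock" where "d x = (if x = 0 then 1 else 0)" for x
  \<comment> \<open>\<open>W\<close> measures the failure of the claim. It is constant on diagonals,
    and far down both indices are negative, so that \<open>U\<close>, \<open>V\<close> and the delta
    vanish.\<close>
  define W where "W a b = T a b - T a (b - 2) - d (a + b)" for a b
  have W: "W (a - 1) (b - 1) = W a b" for a b
  proof -
    have e: "b - 1 - 2 = b - 2 - 1" "a - 1 + (b - 1) = a + (b - 2)" by simp_all
    have "T (a - 1) (b - 1) = T a b - d (a + b)" "T (a - 1) (b - 2 - 1) = T a (b - 2) - d (a + (b - 2))"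
      using T[of a b] T[of a "b - 2"] unfolding d_def by (simp_all only: diff_eq_eq eq_diff_eq add.commute)
    then show ?thesis unfolding W_def e by simp
  qed
  have shift: "W (a - int k) (b - int k) = W a b" for k
  proof (induction k)
    case (Suc k)
    have "a - int (Suc k) = a - int k - 1" "b - int (Suc k) = b - int k - 1" by simp_all
    then show ?case using W[of "a - int k" "b - int k"] Suc by (simp only:)
  qed simp
  obtain x y where xy: "W a b = W x y" "x < 0" "y < 0"
  proof
    let ?k = "nat \<bar>a\<bar> + nat \<bar>b\<bar> + 1"
    show "W a b = W (a - int ?k) (b - int ?k)" by (rule shift[symmetric])
    show "a - int ?k < 0" "b - int ?k < 0" by simp_all
  qed
  then have "W x y = 0" by (simp add: W_def T_def d_def negU negV)
  then have "T a b - T a (b - 2) = d (a + b)" using xy(1) by (simp add: W_def)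
  then show ?thesis by (simp add: T_def U_def V_def d_def)
qed

text \<open>Commuting x_n past the two operators shifts a and b with opposite signs. Both kinds of
  shift move the delta to a + b = n and a + b = -n, so the inhomogeneous terms cancel.\<close>

lemma vop_relation_mixed:
  "(vop 1 a (vop (- 1) b p) + vop (- 1) (b + 1) (vop 1 (a - 1) p))
    - (vop 1 a (vop (- 1) (b - 2) p) + vop (- 1) (b - 1) (vop 1 (a - 1) p))
    = (if a + b = 0 then p else 0)"
  (is "?M a b p = _")
proof (induction p arbitrary: a b rule: fock_induct)
  case one
  show ?case using vop_relation_mixed_one by (simp add: vop_one)
next
  case (add p q)
  have "?M a b (p + q) = ?M a b p + ?M a b q" by (simp add: vop_linear algebra_simps)
  then show ?case using add by simp
next
  case (scale d p)
  have "?M a b (fock_scale d p) = fock_scale d (?M a b p)"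
    by (simp add: vop_linear fock.scale_right_distrib fock.scale_right_diff_distrib)
  then show ?case using scale by simp
next
  case (var n p)
  have "?M a b (fock_var n * p) = fock_var n * ?M a b p - (?M (a - int n) b p + ?M (a + int n) b p)
      + (?M a (b - int n) p + ?M a (b + int n) p)"
    by (simp only: vop_var[OF var(1)] vop_linear) (simp add: algebra_simps)
  then show ?case by (simp add: var(2))
qed

lemma Y_op_linear: "fock_linear (Y_op n)"
  unfolding Y_op_eq by (rule fock_linear_vop)

lemma Ys_op_linear: "fock_linear (Ys_op n)"
  unfolding Ys_op_eq[abs_def] by (intro fock_linear_diff fock_linear_vop)

lemma Y_op_relation: "Y_op m (Y_op n p) + Y_op (n + 1) (Y_op (m - 1) p) = 0"
  using vop_relation_same[of 1 "- m" "- n" p] by (simp add: Y_op_eq)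

text \<open>The prefactors (1 - z^2) (1 - w^2) are symmetric in z and w, so four shifted instances
  of \<open>vop_relation_same\<close> suffice.\<close>

lemma Ys_op_relation: "Ys_op m (Ys_op n p) + Ys_op (n + 1) (Ys_op (m - 1) p) = 0"
proof -
  let ?O = "\<lambda>a b. vop (- 1) a (vop (- 1) b p) + vop (- 1) (b - 1) (vop (- 1) (a + 1) p)"
  have "Ys_op m (Ys_op n p) + Ys_op (n + 1) (Ys_op (m - 1) p)
      = ?O (- m) (- n) - ?O (- m) (- n - 2) - ?O (- m - 2) (- n) + ?O (- m - 2) (- n - 2)"
  proof -
    have "- (n + 1) = - n - 1" "- (m - 1) = - m + 1" "- n - 1 - 2 = - n - 2 - 1" "- m + 1 - 2 = - m - 2 + 1"
      by simp_all
    then show ?thesis by (simp only: Ys_op_eq vop_linear) (simp only: algebra_simps)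
  qed
  moreover have "?O a b = 0" for a b by (rule vop_relation_same) simp
  ultimately show ?thesis by (simp only: diff_zero add_0)
qed

lemma Y_op_Ys_op_relation:
  "Y_op m (Ys_op n p) + Ys_op (n - 1) (Y_op (m + 1) p) = (if m + n = 0 then p else 0)"
proof -
  have "Y_op m (Ys_op n p) + Ys_op (n - 1) (Y_op (m + 1) p)
      = (vop 1 (- m) (vop (- 1) (- n) p) + vop (- 1) (- n + 1) (vop 1 (- m - 1) p))
        - (vop 1 (- m) (vop (- 1) (- n - 2) p) + vop (- 1) (- n - 1) (vop 1 (- m - 1) p))"
  proof -
    have "- (n - 1) = - n + 1" "- (m + 1) = - m - 1" "- n + 1 - 2 = - n - 1" by simp_all
    then show ?thesis by (simp only: Y_op_eq Ys_op_eq vop_linear) simp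
  qed
  then show ?thesis unfolding vop_relation_mixed by auto
qed

section \<open>Straightening in the free algebra\<close>

definition homogeneous :: "int \<Rightarrow> free_algebra \<Rightarrow> bool"
  where "homogeneous d f \<longleftrightarrow> (\<forall>w\<in>Poly_Mapping.keys f. word_degree w = d)"

abbreviation free_scalar :: "complex \<Rightarrow> free_algebra"
  where "free_scalar c \<equiv> Poly_Mapping.single 0 c"

lemma free_scalar_commute: "f * free_scalar c = free_scalar c * f"
  by (induction f rule: free_algebra_induct) (simp_all add: mult_single algebra_simps mult.commute)

lemma word_degree_simps [simp]: "word_degree 0 = 0" "word_degree (u + v) = word_degree u + word_degree v"
  "word_degree (Word [g]) = generator_degree g"
  by (simp_all add: word_degree_def zero_word_def plus_word_def)

lemma homogeneous_zero [simp]: "homogeneous d 0"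
  by (simp add: homogeneous_def)

lemma homogeneous_add: "homogeneous d f \<Longrightarrow> homogeneous d g \<Longrightarrow> homogeneous d (f + g)"
  using keys_add[of f g] by (auto simp: homogeneous_def)

lemma homogeneous_uminus: "homogeneous d f \<Longrightarrow> homogeneous d (- f)"
  by (auto simp: homogeneous_def in_keys_iff)

lemma homogeneous_diff: "homogeneous d f \<Longrightarrow> homogeneous d g \<Longrightarrow> homogeneous d (f - g)"
  using homogeneous_add[of d f "- g"] homogeneous_uminus by simp

lemma homogeneous_mult: "homogeneous d f \<Longrightarrow> homogeneous e g \<Longrightarrow> homogeneous (d + e) (f * g)"
  using keys_mult[of f g] by (fastforce simp: homogeneous_def)

lemma homogeneous_single: "homogeneous (word_degree w) (Poly_Mapping.single w c)"
  by (simp add: homogeneous_def)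

lemma homogeneous_free_scalar [simp]: "homogeneous 0 (free_scalar c)"
  by (simp add: homogeneous_def)

lemma homogeneous_one [simp]: "homogeneous 0 1"
  using homogeneous_free_scalar[of 1] by simp

lemma homogeneous_free_Y: "homogeneous (- n) (free_Y n)" "homogeneous (- n) (free_Ys n)"
  by (simp_all add: homogeneous_def free_Y_def free_Ys_def)

lemma homogeneous_Y_mult:
  "homogeneous e f \<Longrightarrow> homogeneous (a + e) (free_Y (- a) * f)"
  "homogeneous e f \<Longrightarrow> homogeneous (a + e) (free_Ys (- a) * f)"
  using homogeneous_mult[OF homogeneous_free_Y(1)[of "- a"]]
    homogeneous_mult[OF homogeneous_free_Y(2)[of "- a"]] by auto

lemma homogeneous_mult': "homogeneous d f \<Longrightarrow> homogeneous e g \<Longrightarrow> k = d + e \<Longrightarrow> homogeneous k (f * g)"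
  using homogeneous_mult by simp

lemma free_relations:
  "free_Y m * free_Y n + free_Y (n + 1) * free_Y (m - 1) \<in> relation_ideal"
  "free_Ys m * free_Ys n + free_Ys (n + 1) * free_Ys (m - 1) \<in> relation_ideal"
  "free_Y m * free_Ys n + free_Ys (n - 1) * free_Y (m + 1) - (if m + n = 0 then 1 else 0) \<in> relation_ideal"
  by (rule subsetD[OF defining_relations_subset], unfold defining_relations_def, blast)+

text \<open>The elements of degree \<open>d\<close> that vanish, by the defining relations alone, on every vector killed
  by \<open>Y n\<close>, \<open>Ys n\<close> for \<open>n > 0\<close> and fixed by \<open>Y 0\<close>, \<open>Ys 0\<close>.\<close>

inductive vac_null :: "int \<Rightarrow> free_algebra \<Rightarrow> bool" where
  rel: "f \<in> relation_ideal \<Longrightarrow> homogeneous d f \<Longrightarrow> vac_null d f"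
| add: "vac_null d f \<Longrightarrow> vac_null d g \<Longrightarrow> vac_null d (f + g)"
| Y: "n > 0 \<Longrightarrow> homogeneous (d + n) f \<Longrightarrow> vac_null d (f * free_Y n)"
| Ys: "n > 0 \<Longrightarrow> homogeneous (d + n) f \<Longrightarrow> vac_null d (f * free_Ys n)"
| Y0: "homogeneous d f \<Longrightarrow> vac_null d (f * (free_Y 0 - 1))"
| Ys0: "homogeneous d f \<Longrightarrow> vac_null d (f * (free_Ys 0 - 1))"

lemma vac_null_zero [simp]: "vac_null d 0"
  by (rule vac_null.rel) (simp_all add: relation_ideal_closed)

lemma vac_null_mult:
  assumes "vac_null d f" "homogeneous e g"
  shows "vac_null (e + d) (g * f)"
  using assms(1)
proof (induction rule: vac_null.induct)
  case (rel f d)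
  then show ?case using assms(2)
    by (intro vac_null.rel homogeneous_mult relation_ideal_closed) auto
next
  case (Y n d f)
  then show ?case unfolding mult.assoc[symmetric]
    by (intro vac_null.Y homogeneous_mult'[OF assms(2)]) auto
next
  case (Ys n d f)
  then show ?case unfolding mult.assoc[symmetric]
    by (intro vac_null.Ys homogeneous_mult'[OF assms(2)]) auto
qed (auto simp: distrib_left mult.assoc[symmetric] intro: vac_null.intros homogeneous_mult assms(2))

lemma vac_null_mult': "vac_null d f \<Longrightarrow> homogeneous e g \<Longrightarrow> k = e + d \<Longrightarrow> vac_null k (g * f)"
  using vac_null_mult by simp

lemma vac_null_scale: "vac_null d f \<Longrightarrow> vac_null d (free_scalar c * f)"
  using vac_null_mult[of d f 0 "free_scalar c"] by simp

lemma vac_null_uminus: "vac_null d f \<Longrightarrow> vac_null d (- f)"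
  using vac_null_scale[of d f "- 1"] by (simp add: single_uminus)

lemma vac_null_trans: "vac_null d (f - g) \<Longrightarrow> vac_null d (g - h) \<Longrightarrow> vac_null d (f - h)"
  using vac_null.add[of d "f - g" "g - h"] by simp

lemma vac_null_sym: "vac_null d (f - g) \<Longrightarrow> vac_null d (g - f)"
  using vac_null_uminus[of d "f - g"] by simp

definition Y_word :: "int list \<Rightarrow> free_algebra"
  where "Y_word ns = foldr (\<lambda>n f. free_Y (- n) * f) ns 1"

definition Ys_word :: "int list \<Rightarrow> free_algebra"
  where "Ys_word ns = foldr (\<lambda>n f. free_Ys (- n) * f) ns 1"

lemma Y_word_simps [simp]: "Y_word [] = 1" "Y_word (n # ns) = free_Y (- n) * Y_word ns"
  by (simp_all add: Y_word_def)

lemma Ys_word_simps [simp]: "Ys_word [] = 1" "Ys_word (n # ns) = free_Ys (- n) * Ys_word ns"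
  by (simp_all add: Ys_word_def)

lemma homogeneous_Y_word: "homogeneous (sum_list ns) (Y_word ns)"
  by (induction ns) (auto intro: homogeneous_mult' homogeneous_free_Y)

definition part_list :: "int list \<Rightarrow> bool"
  where "part_list ns \<longleftrightarrow> sorted_wrt (\<ge>) ns \<and> (\<forall>n\<in>set ns. n \<ge> 1)"

lemma part_list_Nil [simp]: "part_list []"
  by (simp add: part_list_def)

lemma part_list_Cons: "part_list (n # ns) \<longleftrightarrow> n \<ge> 1 \<and> (\<forall>x\<in>set ns. x \<le> n) \<and> part_list ns"
  by (auto simp: part_list_def)

lemma part_list_sum: "part_list ns \<Longrightarrow> 0 \<le> sum_list ns" "part_list ns \<Longrightarrow> sum_list ns = 0 \<longleftrightarrow> ns = []"
proof -
  have "part_list ns \<Longrightarrow> 0 \<le> sum_list ns \<and> (sum_list ns = 0 \<longleftrightarrow> ns = [])"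
    by (induction ns) (auto simp: part_list_Cons)
  then show "part_list ns \<Longrightarrow> 0 \<le> sum_list ns" "part_list ns \<Longrightarrow> sum_list ns = 0 \<longleftrightarrow> ns = []" by auto
qed

lemma Y_word_swap:
  assumes "homogeneous e x" "d = m + l + e"
  shows "vac_null d (free_Y (- m) * (free_Y (- l) * x) - (- 1) * (free_Y (- (l - 1)) * (free_Y (- (m + 1)) * x)))"
proof (rule vac_null.rel)
  have "(free_Y (- m) * free_Y (- l) + free_Y (- l + 1) * free_Y (- m - 1)) * x \<in> relation_ideal"
    by (rule relation_ideal_closed(4)[OF free_relations(1)])
  then show "free_Y (- m) * (free_Y (- l) * x) - (- 1) * (free_Y (- (l - 1)) * (free_Y (- (m + 1)) * x)) \<in> relation_ideal"
    by (simp add: distrib_right mult.assoc)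
  have "homogeneous d (free_Y (- m) * (free_Y (- l) * x))"
    using homogeneous_Y_mult(1)[OF homogeneous_Y_mult(1)[OF assms(1)], of m l] assms(2)
    by (simp add: algebra_simps)
  moreover have "homogeneous d (free_Y (- (l - 1)) * (free_Y (- (m + 1)) * x))"
    using homogeneous_Y_mult(1)[OF homogeneous_Y_mult(1)[OF assms(1)], of "l - 1" "m + 1"] assms(2)
    by (simp add: algebra_simps)
  ultimately show "homogeneous d (free_Y (- m) * (free_Y (- l) * x) - (- 1) * (free_Y (- (l - 1)) * (free_Y (- (m + 1)) * x)))"
    by (simp only: mult_minus1 diff_minus_eq_add) (rule homogeneous_add)
qed

lemma Ys_Y_swap:
  assumes "homogeneous e x" "d = k + l + e"
  shows "vac_null d (free_Ys (- k) * (free_Y (- l) * x)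
    - ((if k + l = 0 then x else 0) - free_Y (- (l + 1)) * (free_Ys (- (k - 1)) * x)))"
    (is "vac_null d ?f")
proof (rule vac_null.rel)
  have "(free_Y (- l - 1) * free_Ys (- k + 1) + free_Ys (- k + 1 - 1) * free_Y (- l - 1 + 1)
      - (if - l - 1 + (- k + 1) = 0 then 1 else 0)) * x \<in> relation_ideal"
    by (rule relation_ideal_closed(4)[OF free_relations(3)])
  moreover have "- l - 1 + (- k + 1) = 0 \<longleftrightarrow> k + l = 0" by auto
  moreover have "- (l + 1) = - l - 1" "- (k - 1) = - k + 1" by simp_all
  ultimately show "?f \<in> relation_ideal"
    by (simp only:) (simp add: distrib_right left_diff_distrib mult.assoc algebra_simps split: if_splits)
  have "homogeneous d (if k + l = 0 then x else 0)" using assms by auto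
  moreover have "homogeneous d (free_Ys (- k) * (free_Y (- l) * x))"
    using homogeneous_Y_mult(2)[OF homogeneous_Y_mult(1)[OF assms(1)], of k l] assms(2)
    by (simp add: algebra_simps)
  moreover have "homogeneous d (free_Y (- (l + 1)) * (free_Ys (- (k - 1)) * x))"
    using homogeneous_Y_mult(1)[OF homogeneous_Y_mult(2)[OF assms(1)], of "l + 1" "k - 1"] assms(2)
    by (simp add: algebra_simps)
  ultimately show "homogeneous d ?f" by (intro homogeneous_diff)
qed

text \<open>The bound \<open>max m (b - 1)\<close> makes the induction close: after an exchange the
  head l - 1 is put in front of the word obtained from m + 1, and since m + 1 <= l - 1 all parts of
  that word are at most l - 1. The result is a multiple of a single word, never a proper
  sum.\<close>

lemma Y_word_insert:
  assumes "part_list ns" "\<forall>x\<in>set ns. x \<le> b"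
  shows "vac_null (m + sum_list ns) (Y_word (m # ns)) \<or>
    (\<exists>c ms. part_list ms \<and> sum_list ms = m + sum_list ns \<and> (\<forall>x\<in>set ms. x \<le> max m (b - 1)) \<and>
      vac_null (m + sum_list ns) (Y_word (m # ns) - free_scalar c * Y_word ms))"
  using assms
proof (induction ns arbitrary: m b)
  case Nil
  consider "m < 0" | "m = 0" | "m > 0" by linarith
  then show ?case
  proof cases
    case 1
    then show ?thesis using vac_null.Y[of "- m" m 1] by simp
  next
    case 2
    have "vac_null 0 (Y_word [0] - free_scalar 1 * Y_word [])"
      using vac_null.Y0[of 0 1] by simp
    then show ?thesis using 2 by (intro disjI2 exI[of _ 1] exI[of _ "[]"]) auto
  next
    case 3
    then show ?thesis by (intro disjI2 exI[of _ 1] exI[of _ "[m]"]) (auto simp: part_list_Cons)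
  qed
next
  case (Cons l ns)
  have l: "l \<ge> 1" "\<forall>x\<in>set ns. x \<le> l" "part_list ns" "l \<le> b"
    using Cons.prems by (auto simp: part_list_Cons)
  let ?d = "m + sum_list (l # ns)"
  have swap: "vac_null ?d (Y_word (m # l # ns) - (- 1) * Y_word ((l - 1) # (m + 1) # ns))"
    using Y_word_swap[OF homogeneous_Y_word[of ns], of ?d m l] by simp
  \<comment> \<open>The exchange sends (m, l) to (l - 1, m + 1). At its fixed point m = l - 1 the
    word equals its own negative and vanishes.\<close>
  consider "m \<ge> l" | "m = l - 1" | "m < l - 1" by linarith
  then show ?case
  proof cases
    case 1
    then show ?thesis using Cons.prems(1) l
      by (intro disjI2 exI[of _ 1] exI[of _ "m # l # ns"]) (auto simp: part_list_Cons)
  next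
    case 2
    have "vac_null ?d (free_scalar (1 / 2) * (Y_word (m # l # ns) + Y_word (m # l # ns)))"
      using swap by (intro vac_null_scale) (simp add: 2)
    also have "free_scalar (1 / 2) * (Y_word (m # l # ns) + Y_word (m # l # ns)) = Y_word (m # l # ns)"
    proof -
      have "free_scalar (1 / 2) + free_scalar (1 / 2) = (1 :: free_algebra)"
        by (simp flip: single_add)
      then have "free_scalar (1 / 2) * (f + f) = f" for f
        by (metis distrib_left distrib_right mult_1)
      then show ?thesis .
    qed
    finally show ?thesis by blast
  next
    case 3
    have hom: "homogeneous (l - 1) (free_Y (- (l - 1)))" using homogeneous_free_Y(1)[of "- (l - 1)"] by simp
    from Cons.IH[OF l(3,2), of "m + 1"] show ?thesis
    proof (elim disjE exE conjE)
      assume "vac_null (m + 1 + sum_list ns) (Y_word ((m + 1) # ns))"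
      then have "vac_null ?d (Y_word ((l - 1) # (m + 1) # ns))"
        using vac_null_mult'[OF _ hom, of _ _ ?d] by simp
      from vac_null.add[OF swap vac_null_uminus[OF this]] show ?thesis by simp
    next
      fix c ms
      assume ms: "part_list ms" "sum_list ms = m + 1 + sum_list ns" "\<forall>x\<in>set ms. x \<le> max (m + 1) (l - 1)"
        "vac_null (m + 1 + sum_list ns) (Y_word ((m + 1) # ns) - free_scalar c * Y_word ms)"
      have "vac_null ?d (free_Y (- (l - 1)) * (Y_word ((m + 1) # ns) - free_scalar c * Y_word ms))"
        by (rule vac_null_mult'[OF ms(4) hom]) simp
      also have "free_Y (- (l - 1)) * (Y_word ((m + 1) # ns) - free_scalar c * Y_word ms)
          = Y_word ((l - 1) # (m + 1) # ns) - free_scalar c * Y_word ((l - 1) # ms)"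
        by (simp add: right_diff_distrib mult.assoc[symmetric] free_scalar_commute)
      finally have "vac_null ?d ((- 1) * Y_word ((l - 1) # (m + 1) # ns) - (- 1) * (free_scalar c * Y_word ((l - 1) # ms)))"
        using vac_null_uminus by fastforce
      from vac_null_trans[OF swap this]
      have eq: "vac_null ?d (Y_word (m # l # ns) - free_scalar (- c) * Y_word ((l - 1) # ms))"
        by (simp add: single_uminus)
      show ?thesis
      proof (cases "l = 1")
        \<comment> \<open>Here m < 0, so no positive part fits below the bound and \<open>ms\<close>
          is empty; the head \<open>Y 0\<close> is absorbed by the vacuum.\<close>
        case True
        then have "ms = []" using ms(1,3) 3 by (cases ms) (auto simp: part_list_Cons)
        have "vac_null 0 (free_scalar (- c) * (free_Y 0 - 1))"
          by (rule vac_null.Y0) simp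
        moreover have "?d = 0" using ms(2) \<open>ms = []\<close> True by simp
        ultimately have "vac_null ?d (free_scalar (- c) * Y_word ((l - 1) # ms) - free_scalar (- c) * Y_word [])"
          using True \<open>ms = []\<close> by (simp add: right_diff_distrib)
        from vac_null_trans[OF eq this] show ?thesis
          using \<open>?d = 0\<close> by (intro disjI2 exI[of _ "- c"] exI[of _ "[]"]) auto
      next
        case False
        then show ?thesis using eq ms l 3
          by (intro disjI2 exI[of _ "- c"] exI[of _ "(l - 1) # ms"]) (auto simp: part_list_Cons)
      qed
    qed
  qed
qed

section \<open>Words in both kinds of generators\<close>

inductive straight :: "int \<Rightarrow> free_algebra \<Rightarrow> bool" where
  part: "part_list ns \<Longrightarrow> sum_list ns = d \<Longrightarrow> straight d (free_scalar c * Y_word ns)"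
| null: "vac_null d f \<Longrightarrow> straight d f"
| add: "straight d f \<Longrightarrow> straight d g \<Longrightarrow> straight d (f + g)"

lemma straight_scale: "straight d f \<Longrightarrow> straight d (free_scalar c * f)"
proof (induction rule: straight.induct)
  case (part ns d b)
  then show ?case
    using straight.part[of ns d "c * b"] by (simp add: mult_single flip: mult.assoc)
qed (auto simp: distrib_left intro: straight.intros vac_null_scale)

lemma straight_uminus: "straight d f \<Longrightarrow> straight d (- f)"
  using straight_scale[of d f "- 1"] by (simp add: single_uminus)

lemma straight_cong: "vac_null d (f - g) \<Longrightarrow> straight d g \<Longrightarrow> straight d f"
  using straight.add[of d "f - g" g] straight.null by simp

lemma straight_Y: "straight d f \<Longrightarrow> straight (m + d) (free_Y (- m) * f)"
proof (induction rule: straight.induct)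
  case (part ns d c)
  have e: "free_Y (- m) * (free_scalar c * Y_word ns) = free_scalar c * Y_word (m # ns)"
    by (simp add: free_scalar_commute flip: mult.assoc)
  have b: "\<forall>x\<in>set ns. x \<le> sum_list ns"
    using part(1) by (induction ns) (auto simp: part_list_Cons dest: part_list_sum(1))
  have "straight (m + d) (Y_word (m # ns))"
    using Y_word_insert[OF part(1) b, of m] part(2)
    by (auto intro: straight.null straight_cong straight.part simp del: Y_word_simps)
  then show ?case unfolding e by (rule straight_scale)
next
  case (null d f)
  then show ?case using vac_null_mult[OF null homogeneous_free_Y(1)[of "- m"]] by (simp add: straight.null)
qed (simp add: distrib_left straight.add)

text \<open>With \<open>Y 0\<close> inserted in front of the vacuum, the exchange relation turns
  Ys_(-k) into - Y_(-1) Ys_(-(k-1)) for k > 0.\<close>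

lemma straight_Ys_one: "straight (int k) (free_Ys (- int k))"
proof (induction k)
  case 0
  have "vac_null 0 (free_Ys 0 - 1)" using vac_null.Ys0[of 0 1] by simp
  then show ?case using straight_cong straight.part[of "[]" 0 1] by simp
next
  case (Suc k)
  let ?d = "int (Suc k)"
  have "vac_null ?d (free_Ys (- ?d) * (free_Y 0 - 1))"
    using homogeneous_free_Y(2)[of "- ?d"] by (intro vac_null.Y0) (simp add: add.commute)
  then have 1: "vac_null ?d (free_Ys (- ?d) - free_Ys (- ?d) * free_Y 0)"
    using vac_null_uminus by (fastforce simp: right_diff_distrib)
  have 2: "vac_null ?d (free_Ys (- ?d) * free_Y 0 - (- (free_Y (- 1) * free_Ys (- int k))))"
    using Ys_Y_swap[OF homogeneous_one, of ?d ?d 0] by simp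
  have "straight ?d (- (free_Y (- 1) * free_Ys (- int k)))"
    using straight_Y[OF Suc, of 1] by (intro straight_uminus) simp
  then show ?case using straight_cong vac_null_trans[OF 1 2] by blast
qed

text \<open>\<open>Ys\<close> moves through the partition one factor at a time. The factor Y_(-l-1)
  left outside need not be in the right place, which \<open>straight_Y\<close> repairs.\<close>

lemma straight_Ys_Y_word:
  "part_list ns \<Longrightarrow> straight (k + sum_list ns) (free_Ys (- k) * Y_word ns)"
proof (induction ns arbitrary: k)
  case Nil
  show ?case
  proof (cases "k < 0")
    case True
    then show ?thesis using vac_null.Ys[of "- k" k 1] by (simp add: straight.null)
  next
    case False
    then show ?thesis using straight_Ys_one[of "nat k"] by simp
  qed
next
  case (Cons l ns)
  let ?d = "k + sum_list (l # ns)"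
  have ns: "part_list ns" using Cons.prems by (simp add: part_list_Cons)
  have "straight ((l + 1) + (k - 1 + sum_list ns)) (free_Y (- (l + 1)) * (free_Ys (- (k - 1)) * Y_word ns))"
    by (rule straight_Y[OF Cons.IH[OF ns]])
  then have "straight ?d (- (free_Y (- (l + 1)) * (free_Ys (- (k - 1)) * Y_word ns)))"
    using straight_uminus by (simp add: algebra_simps)
  moreover have "straight ?d (if k + l = 0 then Y_word ns else 0)"
    using straight.part[OF ns, of ?d 1] by (auto intro: straight.null)
  ultimately have "straight ?d ((if k + l = 0 then Y_word ns else 0)
      - free_Y (- (l + 1)) * (free_Ys (- (k - 1)) * Y_word ns))"
    using straight.add by fastforce
  then show ?case
    using straight_cong[OF Ys_Y_swap[OF homogeneous_Y_word[of ns], of ?d k l]] by simp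
qed

lemma straight_Ys: "straight d f \<Longrightarrow> straight (m + d) (free_Ys (- m) * f)"
proof (induction rule: straight.induct)
  case (part ns d c)
  have e: "free_Ys (- m) * (free_scalar c * Y_word ns) = free_scalar c * (free_Ys (- m) * Y_word ns)"
    by (simp add: free_scalar_commute flip: mult.assoc)
  show ?case unfolding e using straight_scale straight_Ys_Y_word[OF part(1)] part(2) by blast
next
  case (null d f)
  then show ?case using vac_null_mult[OF null homogeneous_free_Y(2)[of "- m"]] by (simp add: straight.null)
qed (simp add: distrib_left straight.add)

lemma single_Word_Cons:
  "Poly_Mapping.single (Word (g # gs)) c =
    (case g of Gen_Y n \<Rightarrow> free_Y n | Gen_Ys n \<Rightarrow> free_Ys n) * Poly_Mapping.single (Word gs) c"
  by (cases g) (simp_all add: free_Y_def free_Ys_def mult_single plus_word_def)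

lemma straight_single: "straight (word_degree w) (Poly_Mapping.single w c)"
proof -
  have "straight (word_degree (Word gs)) (Poly_Mapping.single (Word gs) c)" for gs
  proof (induction gs)
    case Nil
    then show ?case using straight.part[of "[]" 0 c] by (simp add: word_degree_def zero_word_def)
  next
    case (Cons g gs)
    then show ?case
      using straight_Y[OF Cons, of "generator_degree g"] straight_Ys[OF Cons, of "generator_degree g"]
      by (cases g) (simp_all add: single_Word_Cons word_degree_def)
  qed
  then show ?thesis by (cases w) simp
qed

lemma homogeneous_induct [consumes 1, case_names zero single add]:
  assumes "homogeneous d f" "P 0" "\<And>w c. word_degree w = d \<Longrightarrow> P (Poly_Mapping.single w c)"
    "\<And>f g. homogeneous d f \<Longrightarrow> homogeneous d g \<Longrightarrow> P f \<Longrightarrow> P g \<Longrightarrow> P (f + g)"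
  shows "P f"
proof -
  have sub: "P (\<Sum>w\<in>K. Poly_Mapping.single w (Poly_Mapping.lookup f w)) \<and>
      homogeneous d (\<Sum>w\<in>K. Poly_Mapping.single w (Poly_Mapping.lookup f w))"
    if "finite K" "K \<subseteq> Poly_Mapping.keys f" for K
    using that
  proof (induction K)
    case (insert w K)
    then have "word_degree w = d" using assms(1) by (auto simp: homogeneous_def)
    then have "P (Poly_Mapping.single w (Poly_Mapping.lookup f w))"
      "homogeneous d (Poly_Mapping.single w (Poly_Mapping.lookup f w))"
      using assms(3) homogeneous_single by auto
    then show ?case using insert assms(4) homogeneous_add by auto
  qed (simp add: assms(2))
  have "(\<Sum>w\<in>Poly_Mapping.keys f. Poly_Mapping.single w (Poly_Mapping.lookup f w)) = f"
    by (rule poly_mapping_eqI) (auto simp: lookup_sum lookup_single when_def in_keys_iff)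
  then show ?thesis using sub[of "Poly_Mapping.keys f"] by simp
qed

lemma straight_homogeneous: "homogeneous d f \<Longrightarrow> straight d f"
  by (induction rule: homogeneous_induct) (auto intro: straight.intros straight_single)

text \<open>No partition has negative size, so elements of negative degree kill the vacuum.\<close>

lemma straight_negative: "straight d f \<Longrightarrow> d < 0 \<Longrightarrow> vac_null d f"
proof (induction rule: straight.induct)
  case (part ns d c)
  then show ?case using part_list_sum(1)[of ns] by simp
qed (auto intro: vac_null.add)

text \<open>The empty partition is the only one of size 0, so degree 0 acts on the vacuum by a
  character; this is what ties any \<open>C1_action\<close> to the Fock space.\<close>

lemma straight_0: "straight 0 f \<Longrightarrow> \<exists>c. vac_null 0 (f - free_scalar c)"
proof (induction "0 :: int" f rule: straight.induct)
  case (part ns c)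
  then have "ns = []" using part_list_sum(2) by blast
  then show ?case by (intro exI[of _ c]) simp
next
  case (null f)
  then show ?case by (intro exI[of _ 0]) simp
next
  case (add f g)
  then obtain b c where "vac_null 0 (f - free_scalar b)" "vac_null 0 (g - free_scalar c)" by blast
  then have "vac_null 0 (f + g - free_scalar (b + c))"
    using vac_null.add by (fastforce simp: single_add algebra_simps)
  then show ?case ..
qed

section \<open>Expansion in the words of partitions modulo the vacuum ideal\<close>

definition word_comb :: "(int list \<Rightarrow>\<^sub>0 complex) \<Rightarrow> free_algebra"
  where "word_comb a = (\<Sum>ns\<in>Poly_Mapping.keys a. free_scalar (Poly_Mapping.lookup a ns) * Y_word ns)"

lemma word_comb_add: "word_comb (a + b) = word_comb a + word_comb b"
  unfolding word_comb_def by (rule setsum_keys_plus_distrib) (simp_all add: single_add distrib_right)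

lemma word_comb_zero [simp]: "word_comb 0 = 0"
  by (simp add: word_comb_def)

lemma word_comb_single [simp]: "word_comb (Poly_Mapping.single ns c) = free_scalar c * Y_word ns"
  by (simp add: word_comb_def)

lemma straight_expand:
  "straight d f \<Longrightarrow>
    \<exists>a. Poly_Mapping.keys a \<subseteq> {ns. part_list ns \<and> sum_list ns = d} \<and> vac_null d (f - word_comb a)"
proof (induction rule: straight.induct)
  case (part ns d c)
  then show ?case by (intro exI[of _ "Poly_Mapping.single ns c"]) auto
next
  case (null d f)
  then show ?case by (intro exI[of _ 0]) auto
next
  case (add d f g)
  then obtain a b where
    a: "Poly_Mapping.keys a \<subseteq> {ns. part_list ns \<and> sum_list ns = d}" "vac_null d (f - word_comb a)" and
    b: "Poly_Mapping.keys b \<subseteq> {ns. part_list ns \<and> sum_list ns = d}" "vac_null d (g - word_comb b)"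
    by blast
  have "Poly_Mapping.keys (a + b) \<subseteq> {ns. part_list ns \<and> sum_list ns = d}"
    using a(1) b(1) keys_add[of a b] by blast
  moreover have "vac_null d (f + g - word_comb (a + b))"
    using vac_null.add[OF a(2) b(2)] by (simp add: word_comb_add algebra_simps)
  ultimately show ?case by blast
qed

text \<open>The degrees of the summands are forgotten; \<open>vac_ideal_iff\<close> identifies the
  result with the annihilator of the vacuum 1 in the Fock space.\<close>

inductive vac_ideal :: "free_algebra \<Rightarrow> bool" where
  hom: "vac_null d f \<Longrightarrow> vac_ideal f"
| add: "vac_ideal f \<Longrightarrow> vac_ideal g \<Longrightarrow> vac_ideal (f + g)"

lemma free_algebra_expand:
  "\<exists>a. Poly_Mapping.keys a \<subseteq> Collect part_list \<and> vac_ideal (f - word_comb a)"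
proof (induction f rule: free_algebra_induct)
  case (single w c)
  then show ?case using straight_expand[OF straight_single[of w c]] vac_ideal.hom by blast
next
  case (add f g)
  then obtain a b where
    a: "Poly_Mapping.keys a \<subseteq> Collect part_list" "vac_ideal (f - word_comb a)" and
    b: "Poly_Mapping.keys b \<subseteq> Collect part_list" "vac_ideal (g - word_comb b)"
    by blast
  have "Poly_Mapping.keys (a + b) \<subseteq> Collect part_list"
    using a(1) b(1) keys_add[of a b] by blast
  moreover have "vac_ideal (f + g - word_comb (a + b))"
    using vac_ideal.add[OF a(2) b(2)] by (simp add: word_comb_add algebra_simps)
  ultimately show ?case by blast
qed

subsection \<open>Partitions\<close>

definition parts :: "(nat \<Rightarrow> nat) \<Rightarrow> int list"
  where "parts l = map (\<lambda>i. int (l i)) [0..<partition_length l]"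

lemma partition_nonzero_iff:
  assumes "l \<in> partitions"
  shows "l i \<noteq> 0 \<longleftrightarrow> i < partition_length l"
proof -
  have anti: "antimono l" and fin: "finite {i. l i \<noteq> 0}"
    using assms by (auto simp: partitions_def)
  have down: "l j \<noteq> 0" if "l i \<noteq> 0" "j \<le> i" for i j
    using antimonoD[OF anti that(2)] that(1) by simp
  have "{i. l i \<noteq> 0} = {..<card {i. l i \<noteq> 0}}"
  proof (cases "{i. l i \<noteq> 0} = {}")
    case True
    then show ?thesis by (simp only: card.empty lessThan_0)
  next
    case False
    define M where "M = Max {i. l i \<noteq> 0}"
    have M: "l M \<noteq> 0" using Max_in[OF fin False] unfolding M_def by blast
    have "l i \<noteq> 0 \<longleftrightarrow> i \<le> M" for i
      using down[OF M, of i] Max_ge[OF fin, of i] unfolding M_def by blast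
    then have "{i. l i \<noteq> 0} = {..M}" by (simp only: atMost_def)
    then have eq: "{i. l i \<noteq> 0} = {..<Suc M}" by (simp only: lessThan_Suc_atMost)
    show ?thesis unfolding eq by simp
  qed
  then have "i \<in> {i. l i \<noteq> 0} \<longleftrightarrow> i \<in> {..<partition_length l}"
    unfolding partition_length_def by (rule arg_cong)
  then show ?thesis by simp
qed

lemma parts_props:
  assumes "l \<in> partitions"
  shows "part_list (parts l)" "sum_list (parts l) = int (partition_size l)"
proof -
  have anti: "antimono l" using assms by (simp add: partitions_def)
  have "sorted_wrt (\<ge>) (parts l)"
    unfolding sorted_wrt_iff_nth_less
  proof (intro allI impI)
    fix i j assume ij: "i < j" "j < length (parts l)"
    then have "l j \<le> l i" by (intro antimonoD[OF anti]) simp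
    with ij show "parts l ! i \<ge> parts l ! j" by (simp add: parts_def)
  qed
  moreover have "\<forall>n\<in>set (parts l). n \<ge> 1"
  proof
    fix n assume "n \<in> set (parts l)"
    then obtain i where "i < partition_length l" "n = int (l i)" by (auto simp: parts_def)
    then show "n \<ge> 1" using partition_nonzero_iff[OF assms, of i] by simp
  qed
  ultimately show "part_list (parts l)" by (simp add: part_list_def)
  have "{i. l i \<noteq> 0} = {0..<partition_length l}"
    by (simp only: partition_nonzero_iff[OF assms] atLeast0LessThan lessThan_def)
  then show "sum_list (parts l) = int (partition_size l)"
    by (simp only: parts_def partition_size_def interv_sum_list_conv_sum_set_nat set_upt of_nat_sum)
qed

lemma inj_on_parts: "inj_on parts partitions"
proof (rule inj_onI)
  fix l m assume l: "l \<in> partitions" and m: "m \<in> partitions" and e: "parts l = parts m"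
  then have len: "partition_length l = partition_length m"
    by (metis length_map length_upt minus_nat.diff_0 parts_def)
  show "l = m"
  proof
    fix i
    show "l i = m i"
    proof (cases "i < partition_length l")
      case True
      then have "parts l ! i = int (l i)" "parts m ! i = int (m i)" using len by (auto simp: parts_def)
      then show ?thesis using e by simp
    next
      case False
      then show ?thesis using partition_nonzero_iff[OF l] partition_nonzero_iff[OF m] len by metis
    qed
  qed
qed

lemma parts_surj:
  assumes "part_list ns"
  obtains l where "l \<in> partitions" "parts l = ns"
proof
  let ?l = "\<lambda>i. if i < length ns then nat (ns ! i) else 0"
  have pos: "ns ! i \<ge> 1" if "i < length ns" for i
    using assms that by (auto simp: part_list_def)
  have "nat (ns ! i) \<noteq> 0" if "i < length ns" for i using pos[OF that] by simp
  then have eq: "{i. ?l i \<noteq> 0} = {..<length ns}" by (auto simp: not_le)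
  have "antimono ?l"
  proof (rule antimonoI)
    fix x y :: nat assume "x \<le> y"
    then show "?l y \<le> ?l x" using assms
      by (cases "x = y") (auto simp: part_list_def sorted_wrt_iff_nth_less intro!: nat_mono)
  qed
  then show "?l \<in> partitions" unfolding partitions_def using eq by simp
  have "partition_length ?l = length ns" unfolding partition_length_def eq by simp
  moreover have "int (?l i) = ns ! i" if "i < length ns" for i using pos[OF that] that by simp
  ultimately show "parts ?l = ns"
    by (auto simp: parts_def intro!: nth_equalityI)
qed

lemma Y_word_append: "Y_word (ns @ ms) = Y_word ns * Y_word ms"
  by (induction ns) (simp_all add: mult.assoc)

lemma Y_word_pad: "vac_null (sum_list ns) (Y_word (ns @ replicate k 0) - Y_word ns)"
proof (induction k)
  case (Suc k)
  have "homogeneous (sum_list ns) (Y_word (ns @ replicate k 0))"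
    using homogeneous_Y_word[of "ns @ replicate k 0"] by (simp add: sum_list_replicate)
  then have "vac_null (sum_list ns) (Y_word (ns @ replicate k 0) * (free_Y 0 - 1))"
    by (rule vac_null.Y0)
  moreover have "replicate (Suc k) (0::int) = replicate k 0 @ [0]"
    by (simp add: replicate_append_same)
  ultimately have "vac_null (sum_list ns) (Y_word (ns @ replicate (Suc k) 0) - Y_word (ns @ replicate k 0))"
    by (simp add: Y_word_append right_diff_distrib mult.assoc del: replicate_Suc)
  then show ?case using Suc by (rule vac_null_trans)
qed simp

text \<open>Conjugation is handled one column at a time: moving \<open>Ys (- r)\<close> past \<open>r\<close> factors \<open>Y\<close> raises each
  index by one and leaves \<open>Ys 0\<close>, which fixes the vacuum.\<close>

lemma Ys_add_column:
  assumes "\<forall>n\<in>set ns. n \<ge> 0"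
  shows "vac_null (int (length ns) + sum_list ns) (free_Ys (- int (length ns)) * Y_word ns
    - free_scalar ((- 1) ^ length ns) * Y_word (map (\<lambda>n. n + 1) ns))"
  using assms
proof (induction ns)
  case Nil
  show ?case using vac_null.Ys0[of 0 1] by simp
next
  case (Cons n ns)
  let ?r = "int (length ns)" and ?d = "int (length (n # ns)) + sum_list (n # ns)"
  \<comment> \<open>The delta of the mixed relation is absent because r + 1 + n > 0.\<close>
  have "vac_null ?d (free_Ys (- (?r + 1)) * (free_Y (- n) * Y_word ns)
      - (0 - free_Y (- (n + 1)) * (free_Ys (- ?r) * Y_word ns)))"
    using Ys_Y_swap[OF homogeneous_Y_word[of ns], of ?d "?r + 1" n] Cons.prems by simp
  moreover have "vac_null ?d (free_Y (- (n + 1)) * (free_scalar ((- 1) ^ length ns) * Y_word (map (\<lambda>n. n + 1) ns)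
      - free_Ys (- ?r) * Y_word ns))"
    by (rule vac_null_mult'[OF vac_null_sym[OF Cons.IH], where e = "n + 1"])
      (use homogeneous_free_Y(1)[of "- (n + 1)"] Cons.prems in \<open>simp_all add: add.commute\<close>)
  ultimately have "vac_null ?d (free_Ys (- (?r + 1)) * (free_Y (- n) * Y_word ns)
      + free_Y (- (n + 1)) * (free_scalar ((- 1) ^ length ns) * Y_word (map (\<lambda>n. n + 1) ns)))"
    using vac_null.add by (fastforce simp: right_diff_distrib)
  then show ?case
    by (simp add: single_uminus free_scalar_commute add.commute flip: mult.assoc)
qed

lemma conjugate_nonzero_iff:
  assumes "l \<in> partitions"
  shows "conjugate l j \<noteq> 0 \<longleftrightarrow> j < l 0"
proof -
  have "finite {i. l i \<noteq> 0}" using assms by (simp add: partitions_def)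
  then have "finite {i. j < l i}" by (rule rev_finite_subset) auto
  then have "conjugate l j \<noteq> 0 \<longleftrightarrow> (\<exists>i. j < l i)" by (auto simp: conjugate_def)
  also have "\<dots> \<longleftrightarrow> j < l 0"
  proof -
    have "antimono l" using assms by (simp add: partitions_def)
    then have "l i \<le> l 0" for i by (rule antimonoD) simp
    then show ?thesis by (meson order.strict_trans2)
  qed
  finally show ?thesis .
qed

lemma conjugate_length: "l \<in> partitions \<Longrightarrow> partition_length (conjugate l) = l 0"
  unfolding partition_length_def by (simp only: conjugate_nonzero_iff) simp

text \<open>Induction on the number of columns. When the first column, of length r, is removed, the
  conjugate loses its first part r, that is the outermost factor Ys_(-r);
  \<open>Ys_add_column\<close> restores the column at the cost of the sign (-1)^r.\<close>

lemma Y_word_conjugate: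
  "l \<in> partitions \<Longrightarrow> vac_null (int (partition_size l))
    (Y_word (parts l) - free_scalar ((- 1) ^ partition_size l) * Ys_word (parts (conjugate l)))"
proof (induction "l 0" arbitrary: l)
  case 0
  have z: "l i = 0" for i
    using antimonoD[of l 0 i] 0 by (auto simp: partitions_def)
  then have "partition_length l = 0" "partition_length (conjugate l) = 0" "partition_size l = 0"
    by (auto simp: partition_length_def conjugate_def partition_size_def)
  then show ?case by (simp add: parts_def)
next
  case (Suc k)
  let ?r = "partition_length l" and ?l = "\<lambda>i. l i - 1"
  note iff = partition_nonzero_iff[OF Suc.prems]
  have anti: "antimono l" and fin: "finite {i. l i \<noteq> 0}"
    using Suc.prems by (simp_all add: partitions_def)
  have "antimono ?l" by (intro antimonoI diff_le_mono antimonoD[OF anti])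
  moreover have "finite {i. ?l i \<noteq> 0}" by (rule rev_finite_subset[OF fin]) auto
  ultimately have p: "?l \<in> partitions" unfolding partitions_def by (intro CollectI conjI)
  note iff' = partition_nonzero_iff[OF p]
  have lr: "partition_length ?l \<le> ?r"
    using iff[of ?r] iff'[of ?r] by auto
  have pl: "parts ?l @ replicate (?r - partition_length ?l) 0 = map (\<lambda>i. int (l i) - 1) [0..<?r]"
  proof (rule nth_equalityI)
    fix i assume i: "i < length (parts ?l @ replicate (?r - partition_length ?l) 0)"
    then have "i < ?r" using lr by (simp add: parts_def)
    moreover from this have "l i \<noteq> 0" using iff by blast
    ultimately show "(parts ?l @ replicate (?r - partition_length ?l) 0) ! i = map (\<lambda>i. int (l i) - 1) [0..<?r] ! i"
      using iff'[of i] by (auto simp: parts_def nth_append)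
  qed (use lr in \<open>simp add: parts_def\<close>)
  have col: "map (\<lambda>n. n + 1) (map (\<lambda>i. int (l i) - 1) [0..<?r]) = parts l"
    by (simp add: parts_def)
  have rows: "sum_list (map (\<lambda>i. int (l i) - 1) [0..<?r]) = int (partition_size ?l)"
    unfolding pl[symmetric] using parts_props(2)[OF p] by (simp add: sum_list_replicate)
  have size: "int (partition_size l) = int ?r + int (partition_size ?l)"
  proof -
    have "int (partition_size l) = sum_list (map (\<lambda>n. n + 1) (map (\<lambda>i. int (l i) - 1) [0..<?r]))"
      unfolding col by (rule parts_props(2)[OF Suc.prems, symmetric])
    also have "\<dots> = int ?r + sum_list (map (\<lambda>i. int (l i) - 1) [0..<?r])"
      unfolding sum_list_addf by (simp add: sum_list_triv comp_def)
    finally show ?thesis unfolding rows .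
  qed
  have conj: "Ys_word (parts (conjugate l)) = free_Ys (- int ?r) * Ys_word (parts (conjugate ?l))"
  proof -
    have "conjugate l (Suc j) = conjugate ?l j" for j
      by (simp add: conjugate_def less_diff_conv)
    moreover have "conjugate l 0 = ?r" by (simp add: conjugate_def partition_length_def)
    moreover have "[0..<Suc k] = 0 # map Suc [0..<k]" by (simp add: upt_conv_Cons map_Suc_upt del: upt_Suc)
    moreover have "l 0 = Suc k" "partition_length (conjugate ?l) = k"
      using Suc.hyps(2) conjugate_length[OF p] by simp_all
    ultimately show ?thesis
      by (simp add: parts_def conjugate_length[OF Suc.prems] comp_def del: upt_Suc)
  qed
  let ?e = "free_scalar ((- 1) ^ partition_size ?l)"
  have h: "homogeneous (int ?r) (free_Ys (- int ?r))" using homogeneous_free_Y(2)[of "- int ?r"] by simp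
  have "vac_null (int (partition_size ?l)) (Y_word (parts ?l) - ?e * Ys_word (parts (conjugate ?l)))"
    using Suc by (intro Suc.hyps(1) p) simp
  then have "vac_null (int (partition_size ?l)) (Y_word (map (\<lambda>i. int (l i) - 1) [0..<?r])
      - ?e * Ys_word (parts (conjugate ?l)))"
    using vac_null_trans Y_word_pad[of "parts ?l" "?r - partition_length ?l"]
    unfolding pl parts_props(2)[OF p] by blast
  from vac_null_mult'[OF this h size]
  have 1: "vac_null (int (partition_size l)) (free_Ys (- int ?r) * Y_word (map (\<lambda>i. int (l i) - 1) [0..<?r])
      - ?e * Ys_word (parts (conjugate l)))"
    unfolding conj by (simp add: right_diff_distrib free_scalar_commute flip: mult.assoc)
  have nn: "\<forall>n\<in>set (map (\<lambda>i. int (l i) - 1) [0..<?r]). n \<ge> 0"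
  proof
    fix n assume "n \<in> set (map (\<lambda>i. int (l i) - 1) [0..<?r])"
    then obtain i where "i < ?r" "n = int (l i) - 1" by auto
    then show "n \<ge> 0" using iff[of i] by simp
  qed
  have "int (length (map (\<lambda>i. int (l i) - 1) [0..<?r])) + sum_list (map (\<lambda>i. int (l i) - 1) [0..<?r])
      = int (partition_size l)"
    unfolding rows size by simp
  with Ys_add_column[OF nn]
  have 2: "vac_null (int (partition_size l)) (free_Ys (- int ?r) * Y_word (map (\<lambda>i. int (l i) - 1) [0..<?r])
      - free_scalar ((- 1) ^ ?r) * Y_word (parts l))"
    unfolding col by simp
  \<comment> \<open>The sign is its own inverse, so multiplying by it solves the relation for
    \<open>Y_word (parts l)\<close>.\<close>
  have sq: "(- 1) ^ ?r * (- 1) ^ ?r = (1 :: complex)"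
    by (simp flip: power_mult_distrib)
  have tot: "(- 1) ^ ?r * (- 1) ^ partition_size ?l = ((- 1) ^ partition_size l :: complex)"
  proof -
    have "partition_size l = ?r + partition_size ?l" using size by linarith
    then show ?thesis by (simp only: power_add)
  qed
  have cancel: "free_scalar a * (free_scalar a * x - free_scalar b * y) = x - free_scalar (a * b) * y"
    if "a * a = 1" for a b x y
    by (simp only: right_diff_distrib mult.assoc[symmetric] mult_single that add_0 single_one mult_1)
  have "vac_null (int (partition_size l)) (free_scalar ((- 1) ^ ?r) *
      (free_scalar ((- 1) ^ ?r) * Y_word (parts l) - ?e * Ys_word (parts (conjugate l))))"
    by (rule vac_null_scale[OF vac_null_trans[OF vac_null_sym[OF 2] 1]])
  then show ?case unfolding cancel[OF sq] tot .
qed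

lemma Y_neg_eq: "Y_neg l = algA_class (Y_word (parts l))" "Ys_neg l = algA_class (Ys_word (parts l))"
proof -
  have "foldr (\<lambda>i a. Y (- int (l i)) \<otimes>\<^bsub>\<A>\<^esub> a) is \<one>\<^bsub>\<A>\<^esub> = algA_class (Y_word (map (\<lambda>i. int (l i)) is))"
    "foldr (\<lambda>i a. Ys (- int (l i)) \<otimes>\<^bsub>\<A>\<^esub> a) is \<one>\<^bsub>\<A>\<^esub> = algA_class (Ys_word (map (\<lambda>i. int (l i)) is))" for "is"
    by (induction "is") (simp_all add: algA_class_one Y_def Ys_def algA_class_mult)
  then show "Y_neg l = algA_class (Y_word (parts l))" "Ys_neg l = algA_class (Ys_word (parts l))"
    by (simp_all add: Y_neg_def Ys_neg_def parts_def)
qed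

section \<open>The action on the Fock space\<close>

lemma relation_ideal_minimal:
  assumes "defining_relations \<subseteq> K" "0 \<in> K" "\<And>f g. f \<in> K \<Longrightarrow> g \<in> K \<Longrightarrow> f + g \<in> K"
    "\<And>f g. f \<in> K \<Longrightarrow> g * f \<in> K" "\<And>f g. f \<in> K \<Longrightarrow> f * g \<in> K"
  shows "relation_ideal \<subseteq> K"
proof -
  have "ideal K free_ring"
  proof (rule idealI[OF ring_free_ring])
    show "subgroup K (add_monoid free_ring)"
    proof (rule group.subgroupI)
      show "group (add_monoid free_ring)"
        by (rule abelian_group.a_group[OF ring.is_abelian_group[OF ring_free_ring]])
      have inv: "m_inv (add_monoid free_ring) f = - f" for f
        using abelian_group.minus_equality[OF ring.is_abelian_group[OF ring_free_ring], of "- f" f]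
        by (simp add: free_ring_def a_inv_def)
      show "\<And>f. f \<in> K \<Longrightarrow> m_inv (add_monoid free_ring) f \<in> K"
        unfolding inv using assms(4)[of _ "- 1"] by simp
    qed (use assms(2,3) in \<open>auto simp: free_ring_def\<close>)
  qed (use assms(4,5) in \<open>auto simp: free_ring_def\<close>)
  then show ?thesis
    using ring.genideal_minimal[OF ring_free_ring] assms(1) by (simp add: relation_ideal_def)
qed

abbreviation word_action :: "word \<Rightarrow> fock \<Rightarrow> fock"
  where "word_action w \<equiv> foldr generator_action (letters w)"

lemma fock_linear_generator: "fock_linear (generator_action g)"
  by (cases g) (simp_all add: Y_op_linear Ys_op_linear)

lemma fock_linear_word: "fock_linear (word_action w)"
proof -
  have "fock_linear (foldr generator_action gs)" for gs
    using fock_linear_id fock_linear_comp[OF fock_linear_generator]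
    by (induction gs) (simp_all add: id_def comp_def)
  then show ?thesis .
qed

lemma free_action_add: "free_action (f + g) p = free_action f p + free_action g p"
  unfolding free_action_def
  by (rule setsum_keys_plus_distrib) (simp_all add: fock.scale_left_distrib)

lemma free_action_single: "free_action (Poly_Mapping.single w c) p = fock_scale c (word_action w p)"
  by (simp add: free_action_def)

lemma fock_linear_free_action: "fock_linear (free_action f)"
proof (induction f rule: free_algebra_induct)
  case (single w c)
  then show ?case
    unfolding free_action_single[abs_def] by (rule fock_linear_scale[OF fock_linear_word])
next
  case (add f g)
  then show ?case unfolding free_action_add[abs_def] by (rule fock_linear_add)
qed

lemmas free_action_linear = fock_linearD[OF fock_linear_free_action]

lemma free_action_zero [simp]: "free_action 0 p = 0"
  by (simp add: free_action_def)

lemma free_action_uminus: "free_action (- f) p = - free_action f p"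
  using free_action_add[of f "- f" p] by (simp add: eq_neg_iff_add_eq_0 add.commute)

lemma free_action_diff: "free_action (f - g) p = free_action f p - free_action g p"
  using free_action_add[of f "- g" p] by (simp add: free_action_uminus)

lemma free_action_mult: "free_action (f * g) p = free_action f (free_action g p)"
proof (induction f rule: free_algebra_induct)
  case (single w c)
  show ?case
  proof (induction g rule: free_algebra_induct)
    case (single v d)
    show ?case
      by (simp add: mult_single free_action_single plus_word_def fock_linearD[OF fock_linear_word])
  next
    case (add f g)
    then show ?case by (simp add: distrib_left free_action_add free_action_linear)
  qed
next
  case (add f g)
  then show ?case by (simp add: distrib_right free_action_add)
qed

lemma free_action_scalar: "free_action (free_scalar c) p = fock_scale c p"
  by (simp add: free_action_single zero_word_def)

lemma free_action_one [simp]: "free_action 1 p = p"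
  using free_action_scalar[of 1 p] by simp

lemma free_action_gen: "free_action (free_Y n) p = Y_op n p" "free_action (free_Ys n) p = Ys_op n p"
  by (simp_all add: free_Y_def free_Ys_def free_action_single)

lemma free_action_relation:
  assumes "f \<in> relation_ideal"
  shows "free_action f p = 0"
proof -
  have "relation_ideal \<subseteq> {f. \<forall>p. free_action f p = 0}"
  proof (rule relation_ideal_minimal)
    show "defining_relations \<subseteq> {f. \<forall>p. free_action f p = 0}"
      unfolding defining_relations_def
      using Y_op_relation Ys_op_relation Y_op_Ys_op_relation
      by (auto simp: free_action_add free_action_diff free_action_mult free_action_gen)
  qed (auto simp: free_action_add free_action_mult free_action_linear)
  then show ?thesis using assms by blast
qed

text \<open>The relation ideal acts as 0, so all representatives give the same vector and the set in
  the definition of \<open>M1\<close> is a singleton.\<close>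

lemma M1_smult: "algA_class f \<odot>\<^bsub>M1\<^esub> p = free_action f p"
proof -
  have "(\<lambda>g. free_action g p) ` algA_class f = {free_action f p}"
    using relation_ideal_closed(1)
    by (auto simp: algA_class_eq free_action_add free_action_relation image_iff intro: exI[of _ f])
  then show ?thesis by (simp add: M1_def)
qed

lemma vacuum_op:
  "n > 0 \<Longrightarrow> Y_op n 1 = 0" "n > 0 \<Longrightarrow> Ys_op n 1 = 0" "Y_op 0 1 = 1" "Ys_op 0 1 = 1"
  by (simp_all add: Y_op_eq Ys_op_eq vop_one hsym_neg hsym_0)

lemma vac_null_action: "vac_null d f \<Longrightarrow> free_action f 1 = 0"
  by (induction rule: vac_null.induct)
    (simp_all add: free_action_relation free_action_add free_action_mult free_action_gen
      free_action_diff vacuum_op free_action_linear)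

lemma vac_ideal_action: "vac_ideal f \<Longrightarrow> free_action f 1 = 0"
  by (induction rule: vac_ideal.induct) (simp_all add: vac_null_action free_action_add)

subsection \<open>The vectors of the orthonormal basis span\<close>

abbreviation basis_vec :: "int list \<Rightarrow> fock"
  where "basis_vec ns \<equiv> free_action (Y_word ns) 1"

lemma basis_vec_Cons: "basis_vec (n # ns) = Y_op (- n) (basis_vec ns)"
  by (simp add: free_action_mult free_action_gen)

text \<open>As \<open>[x\<^sub>n, Y(z)] = (z\<^sup>n + z\<^sup>-\<^sup>n) Y(z)\<close>, it is enough to reach \<open>x\<^sub>n\<close> itself, by the recursion of
  \<open>hsym_rec\<close> for \<open>hsym 1 n = Y_op (- n) 1\<close>.\<close>

lemma fock_var_mult_cyclic: "n \<ge> 1 \<Longrightarrow> \<exists>g. fock_var n * free_action f 1 = free_action g 1"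
proof (induction n arbitrary: f rule: less_induct)
  case (less n)
  have ex_add: "\<exists>h. p + q = free_action h 1" if "\<exists>f. p = free_action f 1" "\<exists>g. q = free_action g 1" for p q
    using that free_action_add by metis
  have ex_scale: "\<exists>h. fock_scale c p = free_action h 1" if "\<exists>f. p = free_action f 1" for c p
    using that free_action_mult free_action_scalar by metis
  have ex_diff: "\<exists>h. p - q = free_action h 1" if "\<exists>f. p = free_action f 1" "\<exists>g. q = free_action g 1" for p q
    using that free_action_diff by metis
  have ex_sum: "\<exists>h. sum u A = free_action h 1" if "\<And>a. a \<in> A \<Longrightarrow> \<exists>f. u a = free_action f 1" for u :: "nat \<Rightarrow> fock" and A
    using that
  proof (induction A rule: infinite_finite_induct)
    case (insert a A)
    then show ?case using ex_add by simp
  qed (auto intro: exI[of _ 0])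
  have h: "hsym 1 (int k) = free_action (free_Y (- int k)) 1" for k
    by (simp add: free_action_gen Y_op_eq vop_one)
  have "{1..n} = insert n {1..<n}" using less.prems by auto
  then have "of_nat n * hsym 1 (int n) = fock_var n + (\<Sum>i\<in>{1..<n}. fock_var i * hsym 1 (int n - int i))"
    using hsym_rec[of n 1] by (simp add: hsym_0)
  then have "fock_var n = fock_scale (of_nat n) (hsym 1 (int n))
      - (\<Sum>i\<in>{1..<n}. fock_var i * hsym 1 (int (n - i)))"
    by (simp add: of_nat_mult_fock of_nat_diff)
  also have "\<exists>g. \<dots> = free_action g 1"
    unfolding h using less.IH by (intro ex_diff ex_scale ex_sum) auto
  finally have one: "\<exists>g. fock_var n = free_action g 1" .
  show ?case
  proof (induction f rule: free_algebra_induct)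
    case (single w c)
    have "\<exists>g. fock_var n * foldr generator_action gs 1 = free_action g 1" for gs
    proof (induction gs)
      case Nil
      then show ?case using one by simp
    next
      case (Cons x gs)
      define p where "p = foldr generator_action gs 1"
      have p: "p = free_action (Poly_Mapping.single (Word gs) 1) 1"
        by (simp add: p_def free_action_single)
      obtain g where g: "fock_var n * p = free_action g 1" using Cons p_def by auto
      have ex_Y: "\<exists>f. Y_op k q = free_action f 1" "\<exists>f. Ys_op k q = free_action f 1"
        if "\<exists>f. q = free_action f 1" for k q
        using that free_action_mult free_action_gen by metis+
      have Y: "fock_var n * Y_op k p = Y_op k (fock_var n * p) + (Y_op (k + int n) p + Y_op (k - int n) p)" for k
        using vop_var[OF less.prems, of 1 "- k" p] by (simp add: Y_op_eq)
      have Ys: "fock_var n * Ys_op k p = Ys_op k (fock_var n * p) - (Ys_op (k + int n) p + Ys_op (k - int n) p)" for k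
        using vop_var[OF less.prems, of "- 1" _ p] by (simp add: Ys_op_eq algebra_simps)
      show ?case
      proof (cases x)
        case (Gen_Y k)
        have "\<exists>g. fock_var n * Y_op k p = free_action g 1"
          unfolding Y using g p by (intro ex_add ex_Y) blast+
        then show ?thesis by (simp add: Gen_Y p_def)
      next
        case (Gen_Ys k)
        have "\<exists>g. fock_var n * Ys_op k p = free_action g 1"
          unfolding Ys using g p by (intro ex_add ex_diff ex_Y) blast+
        then show ?thesis by (simp add: Gen_Ys p_def)
      qed
    qed
    then show ?case using ex_scale by (simp add: free_action_single fock_scale_mult(2))
  next
    case (add f g)
    then show ?case using ex_add by (simp add: free_action_add distrib_left)
  qed
qed

lemma fock_cyclic: "\<exists>f. p = free_action f 1"
proof (induction p rule: fock_induct)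
  case one
  show ?case by (rule exI[of _ 1]) simp
next
  case (add p q)
  then show ?case using free_action_add by metis
next
  case (scale c p)
  then show ?case using free_action_mult free_action_scalar by metis
next
  case (var n p)
  then show ?case using fock_var_mult_cyclic by metis
qed

lemma word_comb_action:
  "free_action (word_comb a) p = (\<Sum>ns\<in>Poly_Mapping.keys a. fock_scale (Poly_Mapping.lookup a ns) (free_action (Y_word ns) p))"
proof -
  have "free_action (sum h A) p = (\<Sum>x\<in>A. free_action (h x) p)" for h :: "int list \<Rightarrow> free_algebra" and A
    by (induction A rule: infinite_finite_induct) (simp_all add: free_action_add)
  then show ?thesis by (simp add: word_comb_def free_action_mult free_action_scalar)
qed

lemma fock_expand:
  obtains a where "Poly_Mapping.keys a \<subseteq> Collect part_list" "p = free_action (word_comb a) 1"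
proof -
  obtain f where f: "p = free_action f 1" using fock_cyclic by blast
  obtain a where a: "Poly_Mapping.keys a \<subseteq> Collect part_list" "vac_ideal (f - word_comb a)"
    using free_algebra_expand by blast
  have "free_action f 1 = free_action (word_comb a) 1"
    using vac_ideal_action[OF a(2)] by (simp add: free_action_diff)
  with a(1) f show thesis using that by blast
qed

lemma basis_induct:
  assumes "\<And>p q. P p \<Longrightarrow> P q \<Longrightarrow> P (p + q)" "\<And>c p. P p \<Longrightarrow> P (fock_scale c p)"
    "\<And>ns. part_list ns \<Longrightarrow> P (basis_vec ns)"
  shows "P p"
proof -
  obtain a where a: "Poly_Mapping.keys a \<subseteq> Collect part_list" "p = free_action (word_comb a) 1"
    by (rule fock_expand)
  have 0: "P 0" using assms(2)[OF assms(3)[of "[]"], of 0] by simp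
  have "P (\<Sum>ns\<in>A. fock_scale (Poly_Mapping.lookup a ns) (basis_vec ns))" if "A \<subseteq> Collect part_list" for A
    using that by (induction A rule: infinite_finite_induct) (auto intro: 0 assms)
  then show ?thesis using a by (simp add: word_comb_action)
qed

section \<open>The bilinear form\<close>

text \<open>The pairing with the vacuum. In terms of the Gaussian moments it is the functional with
  \<open>vev (x\<^sub>n p) = vev (a\<^sub>n p) + c\<^sub>n vev p\<close>, where \<open>c\<^sub>n\<close> is \<open>- 1\<close> for even \<open>n\<close> and 0 for odd \<open>n\<close>: these
  shifts turn \<open>vev \<circ> Y(z)\<close> into a series in \<open>z\<^sup>-\<^sup>1\<close>.\<close>

definition vev_shift :: "nat \<Rightarrow> complex"
  where "vev_shift n = (if even n then - 1 else 0)"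

text \<open>\<open>moment n a\<close> is the value of the functional at x_n^a; the recursion is
  \<open>vev_var\<close> applied to x_n^(a+1), as a_n x_n^(a+1) = n (a + 1) x_n^a.\<close>

fun moment :: "nat \<Rightarrow> nat \<Rightarrow> complex" where
  "moment n 0 = 1"
| "moment n (Suc 0) = vev_shift n"
| "moment n (Suc (Suc a)) = of_nat (n * Suc a) * moment n a + vev_shift n * moment n (Suc a)"

text \<open>Distinct variables are independent under the Gaussian functional; exponents 0 can be
  omitted because \<open>moment n 0 = 1\<close>.\<close>

definition vev :: "fock \<Rightarrow> complex"
  where "vev p = (\<Sum>m\<in>Poly_Mapping.keys p. Poly_Mapping.lookup p m *
    (\<Prod>i\<in>Poly_Mapping.keys m. moment (Suc i) (Poly_Mapping.lookup m i)))"

lemma vev_add: "vev (p + q) = vev p + vev q"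
  unfolding vev_def by (rule setsum_keys_plus_distrib) (simp_all add: distrib_right)

lemma vev_single:
  "vev (Poly_Mapping.single m c) = c * (\<Prod>i\<in>Poly_Mapping.keys m. moment (Suc i) (Poly_Mapping.lookup m i))"
  by (simp add: vev_def)

lemma vev_scale: "vev (fock_scale c p) = c * vev p"
  by (induction p rule: poly_mapping_single_induct)
    (simp_all add: fock_scale_def mult_single vev_single vev_add distrib_left)

lemma vev_uminus: "vev (- p) = - vev p"
  using vev_scale[of "- 1" p] by simp

lemma vev_diff: "vev (p - q) = vev p - vev q"
  using vev_add[of p "- q"] vev_uminus by simp

lemma vev_zero [simp]: "vev 0 = 0"
  by (simp add: vev_def)

lemma vev_one [simp]: "vev 1 = 1"
  using vev_single[of 0 1] by simp

lemma vev_var: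
  assumes "n \<ge> 1"
  shows "vev (fock_var n * p) = vev (annihilate n p) + vev_shift n * vev p"
proof (induction p rule: poly_mapping_single_induct)
  case (single m c)
  obtain i where n: "n = Suc i" using assms by (cases n) auto
  let ?e = "Poly_Mapping.single i (1::nat)" and ?a = "Poly_Mapping.lookup m i"
  let ?R = "\<Prod>j\<in>Poly_Mapping.keys m - {i}. moment (Suc j) (Poly_Mapping.lookup m j)"
  have prod: "(\<Prod>j\<in>Poly_Mapping.keys m'. moment (Suc j) (Poly_Mapping.lookup m' j))
      = moment n (Poly_Mapping.lookup m' i) * ?R"
    if m': "\<And>j. j \<noteq> i \<Longrightarrow> Poly_Mapping.lookup m' j = Poly_Mapping.lookup m j" for m'
  proof -
    have "x \<in> insert i (Poly_Mapping.keys m - {i})" if "x \<in> Poly_Mapping.keys m'" for x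
      using that m'[of x] by (cases "x = i") (simp_all add: in_keys_iff)
    then have sub: "Poly_Mapping.keys m' \<subseteq> insert i (Poly_Mapping.keys m - {i})" by blast
    have "(\<Prod>j\<in>Poly_Mapping.keys m'. moment (Suc j) (Poly_Mapping.lookup m' j))
        = (\<Prod>j\<in>insert i (Poly_Mapping.keys m - {i}). moment (Suc j) (Poly_Mapping.lookup m' j))"
      by (rule prod.mono_neutral_left[OF _ sub]) (simp_all add: in_keys_iff)
    also have "\<dots> = moment n (Poly_Mapping.lookup m' i) *
        (\<Prod>j\<in>Poly_Mapping.keys m - {i}. moment (Suc j) (Poly_Mapping.lookup m' j))"
      unfolding n by (subst prod.insert) auto
    also have "(\<Prod>j\<in>Poly_Mapping.keys m - {i}. moment (Suc j) (Poly_Mapping.lookup m' j)) = ?R"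
      by (rule prod.cong) (auto simp: m')
    finally show ?thesis .
  qed
  have 1: "vev (fock_var n * Poly_Mapping.single m c) = c * (moment n (Suc ?a) * ?R)"
    using prod[of "?e + m"] by (simp add: n fock_var_def mult_single vev_single lookup_add lookup_single)
  have 2: "vev (annihilate n (Poly_Mapping.single m c)) = of_nat n * (of_nat ?a * c * (moment n (?a - 1) * ?R))"
    using prod[of "m - ?e"]
    by (simp add: n annihilate_def fock_pderiv_single vev_scale vev_single lookup_minus lookup_single)
  have 3: "vev (Poly_Mapping.single m c) = c * (moment n ?a * ?R)"
    using prod[of m] by (simp add: vev_single)
  have "moment n (Suc ?a) = of_nat n * of_nat ?a * moment n (?a - 1) + vev_shift n * moment n ?a"
    by (cases ?a) (simp_all add: algebra_simps)
  then show ?case unfolding 1 2 3 by (simp add: algebra_simps)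
next
  case (add p q)
  then show ?case by (simp add: distrib_left vev_add annihilate_linear)
qed

text \<open>Write v(k) for the value at \<open>hsym 1 k\<close>. The x_i in Newton's identity
  contribute v(m - 2i) from a_i, and - v(m - i) for even i from the shift. With i = 2j in the second
  sum the two cancel, as v vanishes at negative arguments.\<close>

lemma vev_hsym: "n \<ge> 0 \<Longrightarrow> vev (hsym 1 n) = (if n = 0 then 1 else 0)"
proof (cases "n = 0")
  case False
  assume "n \<ge> 0"
  with False obtain m where m: "n = int m" "m > 0" by (metis gr0I nonneg_int_cases of_nat_0)
  let ?v = "\<lambda>k. vev (hsym 1 k)"
  have "of_nat m * ?v (int m) = vev (of_nat m * hsym 1 (int m))"
    by (simp add: of_nat_mult_fock vev_scale)
  also have "\<dots> = (\<Sum>i=1..m. vev (fock_var i * hsym 1 (int m - int i)))"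
  proof -
    have "vev (sum f A) = (\<Sum>a\<in>A. vev (f a))" for f :: "nat \<Rightarrow> fock" and A
      by (induction A rule: infinite_finite_induct) (simp_all add: vev_add)
    then show ?thesis by (simp add: hsym_rec)
  qed
  also have "\<dots> = (\<Sum>i=1..m. ?v (int m - int (2 * i)) + vev_shift i * ?v (int m - int i))"
    by (intro sum.cong refl) (simp add: vev_var annihilate_hsym algebra_simps)
  also have "\<dots> = (\<Sum>i=1..m. ?v (int m - int (2 * i))) + (\<Sum>i=1..m. vev_shift i * ?v (int m - int i))"
    by (rule sum.distrib)
  also have "(\<Sum>i=1..m. vev_shift i * ?v (int m - int i)) = (\<Sum>i\<in>{i\<in>{1..m}. even i}. - ?v (int m - int i))"
    by (subst sum.inter_filter) (auto simp: vev_shift_def intro!: sum.cong)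
  also have "\<dots> = - (\<Sum>i\<in>{i\<in>{1..m}. even i}. ?v (int m - int i))"
    by (rule sum_negf)
  also have "(\<Sum>i\<in>{i\<in>{1..m}. even i}. ?v (int m - int i)) = (\<Sum>i\<in>{1..m div 2}. ?v (int m - int (2 * i)))"
    by (rule sum.reindex_bij_witness[of _ "\<lambda>i. 2 * i" "\<lambda>i. i div 2"]) auto
  also have "\<dots> = (\<Sum>i=1..m. ?v (int m - int (2 * i)))"
    by (intro sum.mono_neutral_left) (auto simp: hsym_neg)
  finally show ?thesis using m by simp
qed (simp add: hsym_0)

text \<open>When x_k is moved out, the terms at n - k from \<open>vop_var\<close> and
  \<open>annihilate_vop\<close> cancel, and the term at n + k vanishes by induction. What remains
  reproduces \<open>vev_var\<close>.\<close>

lemma vev_Y: "n \<le> 0 \<Longrightarrow> vev (Y_op n p) = (if n = 0 then vev p else 0)"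
proof -
  have "n \<ge> 0 \<Longrightarrow> vev (vop 1 n p) = (if n = 0 then vev p else 0)" for n
  proof (induction p arbitrary: n rule: fock_annihilate_induct)
    case one
    then show ?case by (simp add: vop_one vev_hsym)
  next
    case (add p q)
    then show ?case by (simp add: vop_linear vev_add)
  next
    case (scale c p)
    then show ?case by (simp add: vop_linear vev_scale)
  next
    case (var k p)
    have "vev (vop 1 n (fock_var k * p)) = vev (annihilate k (vop 1 n p)) + vev_shift k * vev (vop 1 n p)
        - (vev (vop 1 (n - int k) p) + vev (vop 1 (n + int k) p))"
      by (simp add: vop_var[OF var(1)] vev_diff vev_add vev_var[OF var(1)])
    also have "\<dots> = vev (vop 1 n (annihilate k p)) + vev_shift k * vev (vop 1 n p) - vev (vop 1 (n + int k) p)"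
      by (simp add: annihilate_vop[OF var(1)] vev_add)
    also have "vev (vop 1 (n + int k) p) = 0"
      using var(2)[of "n + int k"] var(1,4) by simp
    finally show ?case using var by (simp add: vev_var)
  qed
  from this[of "- n"] show "n \<le> 0 \<Longrightarrow> ?thesis" by (simp add: Y_op_eq)
qed

lemma vev_basis: "part_list ns \<Longrightarrow> vev (basis_vec ns) = (if ns = [] then 1 else 0)"
proof (cases ns)
  case (Cons n ms)
  moreover assume "part_list ns"
  ultimately show ?thesis by (simp add: basis_vec_Cons part_list_Cons vev_Y del: Y_word_simps)
qed simp

text \<open>Deduced from the relations instead of a second Gaussian computation: on a basis vector,
  \<open>Ys\<close> is moved past the first factor Y_(-l), which leaves Y_(-l-1) outermost, and
  \<open>vev_Y\<close> kills it. The delta would need n = l > 0.\<close>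

lemma vev_Ys: "n \<le> 0 \<Longrightarrow> vev (Ys_op n p) = (if n = 0 then vev p else 0)"
proof (induction p rule: basis_induct)
  case (1 p q)
  then show ?case by (simp add: fock_linearD[OF Ys_op_linear] vev_add)
next
  case (2 c p)
  then show ?case by (simp add: fock_linearD[OF Ys_op_linear] vev_scale)
next
  case (3 ns)
  show ?case
  proof (cases ns)
    case Nil
    have "vev (Ys_op n 1) = 0" if "n < 0"
    proof -
      have "Ys_op n (Y_op 0 1) = - Y_op (- 1) (Ys_op (n + 1) 1)"
        using Y_op_Ys_op_relation[of "- 1" "n + 1" 1] that by (simp add: eq_neg_iff_add_eq_0 add.commute)
      then show ?thesis by (simp add: vacuum_op vev_uminus vev_Y)
    qed
    then show ?thesis using Nil 3 by (cases "n = 0") (simp_all add: vacuum_op)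
  next
    case (Cons l ms)
    then have l: "l \<ge> 1" using 3 by (simp add: part_list_Cons)
    have "Ys_op n (Y_op (- l) (basis_vec ms))
        = (if n = l then basis_vec ms else 0) - Y_op (- l - 1) (Ys_op (n + 1) (basis_vec ms))"
      using Y_op_Ys_op_relation[of "- l - 1" "n + 1" "basis_vec ms"] by (auto simp: algebra_simps)
    then show ?thesis using l 3
      by (simp add: Cons basis_vec_Cons vev_diff vev_uminus vev_Y del: Y_word_simps)
  qed
qed

section \<open>The form attached to the functional\<close>

lemma free_theta_gen: "free_theta (free_Y n) = free_Ys (- n)" "free_theta (free_Ys n) = free_Y (- n)"
  by (simp_all add: free_Y_def free_Ys_def free_theta_single word_theta_def)

lemma free_theta_scalar: "free_theta (free_scalar c) = free_scalar c"
  by (simp add: free_theta_single word_theta_def zero_word_def)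

lemma free_theta_one: "free_theta 1 = 1"
  using free_theta_scalar[of 1] by simp

lemma free_theta_diff: "free_theta (f - g) = free_theta f - free_theta g"
  using free_theta_add[of f "- g"] by (simp add: free_theta_uminus)

text \<open>\<open>theta\<close> turns the right factors that annihilate the vacuum into left
  factors that the functional annihilates.\<close>

lemma vev_theta_null: "vac_null d f \<Longrightarrow> vev (free_action (free_theta f) p) = 0"
proof (induction arbitrary: p rule: vac_null.induct)
  case (rel f d)
  then show ?case by (simp add: free_action_relation free_theta_relation_ideal)
next
  case (add d f g)
  then show ?case by (simp add: free_theta_add free_action_add vev_add)
next
  case (Y n d f)
  then show ?case by (simp add: free_theta_mult free_theta_gen free_action_mult free_action_gen vev_Ys)
next
  case (Ys n d f)
  then show ?case by (simp add: free_theta_mult free_theta_gen free_action_mult free_action_gen vev_Y)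
next
  case (Y0 d f)
  then show ?case
    by (simp add: free_theta_mult free_theta_gen free_theta_diff free_theta_one free_action_diff
        free_action_mult free_action_gen vev_diff vev_Ys)
next
  case (Ys0 d f)
  then show ?case
    by (simp add: free_theta_mult free_theta_gen free_theta_diff free_theta_one free_action_diff
        free_action_mult free_action_gen vev_diff vev_Y)
qed

lemma vev_theta_ideal: "vac_ideal f \<Longrightarrow> vev (free_action (free_theta f) p) = 0"
  by (induction rule: vac_ideal.induct)
    (simp_all add: vev_theta_null free_theta_add free_action_add vev_add)

text \<open>Both sides depend on f only modulo the vacuum ideal, so f may be a combination of words
  of partitions. For a nonempty partition both vanish: \<open>vev\<close> kills the leading Y_(-l),
  and its adjoint Ys_l kills the vacuum.\<close>

lemma vev_theta: "vev (free_action (free_theta f) 1) = vev (free_action f 1)"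
proof -
  obtain a where a: "Poly_Mapping.keys a \<subseteq> Collect part_list" "vac_ideal (f - word_comb a)"
    using free_algebra_expand by blast
  have "vev (free_action f 1) = vev (free_action (word_comb a) 1)"
    using vac_ideal_action[OF a(2)] by (simp add: free_action_diff)
  moreover have "vev (free_action (free_theta f) 1) = vev (free_action (free_theta (word_comb a)) 1)"
    using vev_theta_ideal[OF a(2), of 1] by (simp add: free_theta_diff free_action_diff vev_diff)
  moreover have "vev (free_action (free_theta (word_comb a)) 1) = vev (free_action (word_comb a) 1)"
    using a(1)
  proof (induction a rule: update_induct)
    case const
    then show ?case by (simp add: free_theta_zero)
  next
    case (update a ns c)
    have e: "Poly_Mapping.update ns c a = a + Poly_Mapping.single ns c"
      using update.hyps
      by (intro poly_mapping_eqI) (auto simp: lookup_update lookup_add lookup_single in_keys_iff)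
    have k: "Poly_Mapping.keys a \<subseteq> Collect part_list" "part_list ns"
      using update.prems update.hyps by (auto simp: keys_update split: if_splits)
    have "vev (free_action (free_theta (Y_word ns)) 1) = vev (basis_vec ns)"
    proof (cases ns)
      case Nil
      then show ?thesis by (simp add: free_theta_one)
    next
      case (Cons l ms)
      then show ?thesis using k(2)
        by (simp add: vev_basis free_theta_mult free_theta_gen free_action_mult free_action_gen
            vacuum_op part_list_Cons free_action_linear vev_Y)
    qed
    then show ?case using update.IH[OF k(1)] unfolding e
      by (simp add: word_comb_add free_theta_add free_action_add vev_add free_theta_mult
          free_theta_scalar free_action_mult free_action_scalar free_action_linear vev_scale)
  qed
  ultimately show ?thesis by simp
qed

lemma vev_theta_sym:
  "vev (free_action (free_theta f) (free_action g 1)) = vev (free_action (free_theta g) (free_action f 1))"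
  using vev_theta[of "free_theta f * g"]
  by (simp add: free_theta_mult free_theta_invol free_action_mult)

definition fock_form :: "fock \<Rightarrow> fock \<Rightarrow> complex"
  where "fock_form u v = vev (free_action (free_theta (SOME f. u = free_action f 1)) v)"

text \<open>Independence of the chosen representative: \<open>vev_theta_sym\<close> moves the
  representative to the right argument, where only its value on the vacuum enters.\<close>

lemma fock_form_eq: "fock_form (free_action f 1) v = vev (free_action (free_theta f) v)"
proof -
  define F where "F = (SOME g. free_action f 1 = free_action g 1)"
  have F: "free_action f 1 = free_action F 1" unfolding F_def by (rule someI[of _ f]) simp
  obtain g where g: "v = free_action g 1" using fock_cyclic by blast
  have "fock_form (free_action f 1) v = vev (free_action (free_theta g) (free_action F 1))"
    unfolding fock_form_def F_def[symmetric] g by (rule vev_theta_sym)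
  also have "\<dots> = vev (free_action (free_theta f) v)"
    unfolding F[symmetric] g by (rule vev_theta_sym)
  finally show ?thesis .
qed

lemma fock_form_sym: "fock_form u v = fock_form v u"
proof -
  obtain f g where "u = free_action f 1" "v = free_action g 1" using fock_cyclic by metis
  then show ?thesis by (simp add: fock_form_eq vev_theta_sym)
qed

lemma fock_form_right: "fock_form u (v + w) = fock_form u v + fock_form u w"
  "fock_form u (fock_scale c v) = c * fock_form u v"
  by (simp_all add: fock_form_def free_action_linear vev_add vev_scale)

lemma fock_form_left: "fock_form (u + v) w = fock_form u w + fock_form v w"
  "fock_form (fock_scale c u) w = c * fock_form u w"
  using fock_form_right fock_form_sym by metis+

lemma bilinear_fock_form: "bilinear_form fock_form"
proof -
  have "vector_space ((*) :: complex \<Rightarrow> _)" by standard (simp_all add: algebra_simps)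
  then show ?thesis
    unfolding bilinear_form_def Vector_Spaces.linear_iff
    using fock.vector_space_axioms by (simp add: fock_form_left fock_form_right)
qed

lemma fock_form_invariant: "fock_form (free_action f u) v = fock_form u (free_action (free_theta f) v)"
proof -
  obtain g where g: "u = free_action g 1" using fock_cyclic by blast
  have "fock_form (free_action f u) v = vev (free_action (free_theta (f * g)) v)"
    unfolding g free_action_mult[symmetric] by (rule fock_form_eq)
  then show ?thesis by (simp add: g fock_form_eq free_theta_mult free_action_mult)
qed

section \<open>Orthonormality of the basis vectors\<close>

lemma Ys_basis_Cons:
  "Ys_op k (basis_vec (l # ns)) = (if k = l then basis_vec ns else 0)
    - Y_op (- l - 1) (Ys_op (k + 1) (basis_vec ns))"
  using Y_op_Ys_op_relation[of "- l - 1" "k + 1" "basis_vec ns"]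
  unfolding basis_vec_Cons by (auto simp: algebra_simps)

text \<open>Moving right, the index of \<open>Ys\<close> only grows, so it never meets an equal part
  and ends on the vacuum with a positive index.\<close>

lemma Ys_basis_zero: "k \<ge> 1 \<Longrightarrow> \<forall>x\<in>set ns. x < k \<Longrightarrow> Ys_op k (basis_vec ns) = 0"
proof (induction ns arbitrary: k)
  case (Cons l ns)
  have "Ys_op (k + 1) (basis_vec ns) = 0" using Cons.prems by (intro Cons.IH) auto
  then show ?case using Cons.prems
    by (simp only: Ys_basis_Cons) (simp add: fock_linearD[OF Y_op_linear])
qed (simp add: vacuum_op)

lemma fock_form_basis_Cons:
  "fock_form (basis_vec (l # ls)) v = fock_form (basis_vec ls) (Ys_op l v)"
  by (simp add: fock_form_eq free_theta_mult free_theta_gen free_action_mult free_action_gen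
      del: Y_word_simps) (simp add: fock_form_eq free_theta_mult free_theta_gen free_action_mult free_action_gen)

text \<open>The adjoint Ys_l of the leading factor strips an equal leading part and kills a
  partition with smaller parts. If l < m, symmetry exchanges the roles.\<close>

lemma fock_form_basis:
  "part_list ls \<Longrightarrow> part_list ms \<Longrightarrow>
    fock_form (basis_vec ls) (basis_vec ms) = (if ls = ms then 1 else 0)"
proof (induction ls arbitrary: ms)
  case Nil
  then show ?case using fock_form_eq[of 1 "basis_vec ms"] vev_basis[of ms]
    by (auto simp: free_theta_one)
next
  case (Cons l ls)
  then have l: "l \<ge> 1" "\<forall>x\<in>set ls. x \<le> l" "part_list ls" by (auto simp: part_list_Cons)
  have zero: "fock_form u 0 = 0" for u using fock_form_right(2)[of u 0 0] by simp
  show ?case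
  proof (cases ms)
    case Nil
    then show ?thesis using l zero by (simp only: fock_form_basis_Cons) (simp add: vacuum_op)
  next
    case (Cons m ms')
    then have m: "m \<ge> 1" "\<forall>x\<in>set ms'. x \<le> m" "part_list ms'"
      using Cons.prems by (auto simp: part_list_Cons)
    consider "l > m" | "l = m" | "l < m" by linarith
    then show ?thesis
    proof cases
      case 1
      then have "Ys_op l (basis_vec ms) = 0" using l m Cons by (intro Ys_basis_zero) auto
      then show ?thesis using 1 Cons zero by (simp only: fock_form_basis_Cons) simp
    next
      case 2
      have "Ys_op (l + 1) (basis_vec ms') = 0" using l m 2 by (intro Ys_basis_zero) auto
      then have "Ys_op l (basis_vec ms) = basis_vec ms'"
        unfolding Cons 2 Ys_basis_Cons by (simp add: fock_linearD[OF Y_op_linear])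
      then show ?thesis using Cons.IH[OF l(3) m(3)] 2 Cons by (simp only: fock_form_basis_Cons) simp
    next
      case 3
      then have "Ys_op m (basis_vec (l # ls)) = 0" using l m by (intro Ys_basis_zero) auto
      then have "fock_form (basis_vec (m # ms')) (basis_vec (l # ls)) = 0"
        using zero by (simp only: fock_form_basis_Cons)
      then show ?thesis using 3 Cons by (simp only: fock_form_sym[of "basis_vec (l # ls)"]) simp
    qed
  qed
qed

lemma fock_form_comb:
  assumes "Poly_Mapping.keys a \<subseteq> Collect part_list" "part_list ms"
  shows "fock_form (free_action (word_comb a) 1) (basis_vec ms) = Poly_Mapping.lookup a ms"
proof -
  have 0: "fock_form 0 v = 0" for v using fock_form_left(2)[of 0 0 v] by simp
  have s: "fock_form (sum h A) v = (\<Sum>x\<in>A. fock_form (h x) v)" for h :: "int list \<Rightarrow> fock" and A v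
    by (induction A rule: infinite_finite_induct) (simp_all add: fock_form_left 0)
  have "fock_form (free_action (word_comb a) 1) (basis_vec ms)
      = (\<Sum>ns\<in>Poly_Mapping.keys a. Poly_Mapping.lookup a ns * fock_form (basis_vec ns) (basis_vec ms))"
    by (simp add: word_comb_action s fock_form_left)
  also have "\<dots> = (\<Sum>ns\<in>Poly_Mapping.keys a. if ns = ms then Poly_Mapping.lookup a ms else 0)"
    using assms by (intro sum.cong refl) (auto simp: fock_form_basis)
  also have "\<dots> = Poly_Mapping.lookup a ms" by (simp add: in_keys_iff)
  finally show ?thesis .
qed

lemma part_list_support_eq_0:
  assumes "Poly_Mapping.keys a \<subseteq> Collect part_list" "\<And>ms. part_list ms \<Longrightarrow> Poly_Mapping.lookup a ms = 0"
  shows "a = 0"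
proof (rule poly_mapping_eqI)
  show "Poly_Mapping.lookup a ms = Poly_Mapping.lookup 0 ms" for ms
    using assms by (cases "ms \<in> Poly_Mapping.keys a") (auto simp: in_keys_iff)
qed

lemma fock_form_nondegenerate:
  assumes "\<And>v. fock_form u v = 0"
  shows "u = 0"
proof -
  obtain a where a: "Poly_Mapping.keys a \<subseteq> Collect part_list" "u = free_action (word_comb a) 1"
    by (rule fock_expand)
  have "Poly_Mapping.lookup a ms = 0" if "part_list ms" for ms
    using fock_form_comb[OF a(1) that] assms a(2) by simp
  then have "a = 0" by (rule part_list_support_eq_0[OF a(1)])
  then show ?thesis using a(2) by simp
qed

lemma word_comb_action_zero:
  assumes "Poly_Mapping.keys a \<subseteq> Collect part_list" "free_action (word_comb a) 1 = 0"
  shows "a = 0"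
proof -
  have "Poly_Mapping.lookup a ms = 0" if "part_list ms" for ms
    using fock_form_comb[OF assms(1) that] assms(2) fock_form_left(2)[of 0 0 "basis_vec ms"] by simp
  then show ?thesis by (rule part_list_support_eq_0[OF assms(1)])
qed

text \<open>Modulo the formal left ideal the words of partitions span, and by orthonormality they
  are independent on the Fock space. So the formal ideal is the whole annihilator of the vacuum.
  This is the bridge to the induced module.\<close>

lemma vac_ideal_iff: "vac_ideal f \<longleftrightarrow> free_action f 1 = 0"
proof
  assume f: "free_action f 1 = 0"
  obtain a where a: "Poly_Mapping.keys a \<subseteq> Collect part_list" "vac_ideal (f - word_comb a)"
    using free_algebra_expand by blast
  have "free_action (word_comb a) 1 = 0"
    using vac_ideal_action[OF a(2)] f by (simp add: free_action_diff)
  then show "vac_ideal f" using word_comb_action_zero[OF a(1)] a(2) by simp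
qed (rule vac_ideal_action)

section \<open>The algebra in degree zero and its one-dimensional module\<close>

definition degree_part :: "int \<Rightarrow> free_algebra \<Rightarrow> free_algebra"
  where "degree_part d f = (\<Sum>w\<in>Poly_Mapping.keys f.
    if word_degree w = d then Poly_Mapping.single w (Poly_Mapping.lookup f w) else 0)"

lemma degree_part_add: "degree_part d (f + g) = degree_part d f + degree_part d g"
  unfolding degree_part_def by (rule setsum_keys_plus_distrib) (simp_all add: single_add)

lemma degree_part_single:
  "degree_part d (Poly_Mapping.single w c) = (if word_degree w = d then Poly_Mapping.single w c else 0)"
  by (simp add: degree_part_def)

lemma degree_part_zero [simp]: "degree_part d 0 = 0"
  by (simp add: degree_part_def)

lemma degree_part_uminus: "degree_part d (- f) = - degree_part d f"
  using degree_part_add[of d f "- f"] by (simp add: eq_neg_iff_add_eq_0 add.commute)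

lemma degree_part_diff: "degree_part d (f - g) = degree_part d f - degree_part d g"
  using degree_part_add[of d f "- g"] by (simp add: degree_part_uminus)

lemma degree_part_homogeneous: "homogeneous e f \<Longrightarrow> degree_part d f = (if d = e then f else 0)"
  by (induction rule: homogeneous_induct) (auto simp: degree_part_single degree_part_add)

lemma degree_part_single_mult:
  "degree_part d (Poly_Mapping.single w c * f) = Poly_Mapping.single w c * degree_part (d - word_degree w) f"
  "degree_part d (f * Poly_Mapping.single w c) = degree_part (d - word_degree w) f * Poly_Mapping.single w c"
proof -
  have e: "word_degree w + word_degree v = d \<longleftrightarrow> word_degree v = d - word_degree w"
    "word_degree v + word_degree w = d \<longleftrightarrow> word_degree v = d - word_degree w" for v by auto
  show "degree_part d (Poly_Mapping.single w c * f) = Poly_Mapping.single w c * degree_part (d - word_degree w) f"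
    by (induction f rule: free_algebra_induct)
      (simp_all add: mult_single degree_part_single degree_part_add distrib_left e)
  show "degree_part d (f * Poly_Mapping.single w c) = degree_part (d - word_degree w) f * Poly_Mapping.single w c"
    by (induction f rule: free_algebra_induct)
      (simp_all add: mult_single degree_part_single degree_part_add distrib_right e)
qed

text \<open>The defining relations are homogeneous, so their ideal is graded. Degrees are therefore
  well defined in the quotient, as \<open>degree_zero_component\<close> requires.\<close>

lemma relation_ideal_degree_part:
  assumes "f \<in> relation_ideal"
  shows "degree_part d f \<in> relation_ideal"
proof -
  have "relation_ideal \<subseteq> {f. \<forall>d. degree_part d f \<in> relation_ideal}"
  proof (rule relation_ideal_minimal)
    show "defining_relations \<subseteq> {f. \<forall>d. degree_part d f \<in> relation_ideal}"
    proof
      fix f assume f: "f \<in> defining_relations"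
      have h: "homogeneous k (free_Y m * free_Y n)" "homogeneous k (free_Ys m * free_Ys n)"
        "homogeneous k (free_Y m * free_Ys n)" "homogeneous k (free_Ys m * free_Y n)"
        if "k = - m - n" for m n k
        using that by (auto intro!: homogeneous_mult' homogeneous_free_Y)
      \<comment> \<open>The constant 1 occurs in a relation only if m + n = 0, when the other terms
        have degree 0 too.\<close>
      have d: "homogeneous (- m - n) (if m + n = 0 then 1 else 0)" for m n
      proof (cases "m + n = 0")
        case True
        then have "- m - n = 0" by simp
        then show ?thesis by simp
      qed simp
      have "\<exists>e. homogeneous e f"
        using f unfolding defining_relations_def
      proof (elim UnE CollectE exE conjE)
        fix m n
        assume "f = free_Y m * free_Y n + free_Y (n + 1) * free_Y (m - 1)"
        then have "homogeneous (- m - n) f" by (auto intro!: homogeneous_add h)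
        then show ?thesis ..
      next
        fix m n
        assume "f = free_Ys m * free_Ys n + free_Ys (n + 1) * free_Ys (m - 1)"
        then have "homogeneous (- m - n) f" by (auto intro!: homogeneous_add h)
        then show ?thesis ..
      next
        fix m n
        assume "f = free_Y m * free_Ys n + free_Ys (n - 1) * free_Y (m + 1) - (if m + n = 0 then 1 else 0)"
        then have "homogeneous (- m - n) f" using d[of m n] by (auto intro!: homogeneous_diff homogeneous_add h)
        then show ?thesis ..
      qed
      then show "f \<in> {f. \<forall>d. degree_part d f \<in> relation_ideal}"
        using f defining_relations_subset relation_ideal_closed(1) by (auto simp: degree_part_homogeneous)
    qed
  next
    fix f g :: free_algebra assume f: "f \<in> {f. \<forall>d. degree_part d f \<in> relation_ideal}"
    show "g * f \<in> {f. \<forall>d. degree_part d f \<in> relation_ideal}"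
      using f by (induction g rule: free_algebra_induct)
        (auto simp: degree_part_single_mult distrib_right degree_part_add relation_ideal_closed)
    show "f * g \<in> {f. \<forall>d. degree_part d f \<in> relation_ideal}"
      using f by (induction g rule: free_algebra_induct)
        (auto simp: degree_part_single_mult distrib_left degree_part_add relation_ideal_closed)
  qed (auto simp: degree_part_add relation_ideal_closed)
  then show ?thesis using assms by blast
qed

subsection \<open>The grading of the algebra\<close>

lemma algA_class_zero: "\<zero>\<^bsub>\<A>\<^esub> = algA_class 0"
  unfolding algA_class_eq by (simp add: algA_def FactRing_def)

lemma algA_class_carrier [simp]: "algA_class f \<in> carrier \<A>"
  by (simp add: carrier_algA)

lemma algA_class_uminus: "\<ominus>\<^bsub>\<A>\<^esub> algA_class f = algA_class (- f)"
proof -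
  interpret ring \<A> by (rule ring_algA)
  show ?thesis by (rule minus_equality) (simp_all add: algA_class_add algA_class_zero)
qed

lemma algA_deg_iff: "x \<in> algA_deg d \<longleftrightarrow> (\<exists>f. homogeneous d f \<and> x = algA_class f)"
  by (auto simp: algA_deg_def homogeneous_def)

lemma algA_deg_class: "homogeneous d f \<Longrightarrow> algA_class f \<in> algA_deg d"
  using algA_deg_iff by blast

lemma algA_minus_class:
  assumes "x \<in> algA_minus"
  shows "\<exists>f. x = algA_class f \<and> (\<forall>w\<in>Poly_Mapping.keys f. word_degree w < 0)"
proof -
  interpret ring \<A> by (rule ring_algA)
  show ?thesis
    using assms unfolding algA_minus_def
  proof (induction rule: generate.induct)
    case one
    show ?case by (intro exI[of _ 0]) (simp add: algA_class_zero)
  next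
    case (incl h)
    then show ?case by (force simp: algA_deg_def)
  next
    case (inv h)
    then obtain n f where f: "n \<ge> 1" "\<forall>w\<in>Poly_Mapping.keys f. word_degree w = - n" "h = algA_class f"
      by (auto simp: algA_deg_def)
    have "inv\<^bsub>add_monoid \<A>\<^esub> h = algA_class (- f)"
      using algA_class_uminus[of f] by (simp add: f(3) a_inv_def)
    then show ?case using f(1,2) by (intro exI[of _ "- f"]) (auto simp: in_keys_iff)
  next
    case (eng h1 h2)
    then obtain f g where "h1 = algA_class f" "\<forall>w\<in>Poly_Mapping.keys f. word_degree w < 0"
      "h2 = algA_class g" "\<forall>w\<in>Poly_Mapping.keys g. word_degree w < 0" by blast
    then show ?case using keys_add[of f g]
      by (intro exI[of _ "f + g"]) (auto simp: algA_class_add)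
  qed
qed

lemma degree_part_negative:
  "\<forall>w\<in>Poly_Mapping.keys f. word_degree w < 0 \<Longrightarrow> degree_part 0 f = 0"
  by (auto simp: degree_part_def intro!: sum.neutral)

lemma negative_action:
  assumes "\<forall>w\<in>Poly_Mapping.keys f. word_degree w < 0"
  shows "free_action f 1 = 0"
proof -
  have "fock_scale (Poly_Mapping.lookup f w) (word_action w 1) = 0" if "w \<in> Poly_Mapping.keys f" for w
    using vac_null_action[OF straight_negative[OF straight_single[of w "Poly_Mapping.lookup f w"]]] assms that
    by (simp add: free_action_single)
  then show ?thesis unfolding free_action_def by (intro sum.neutral ballI)
qed

text \<open>The description that defines \<open>extended_action\<close> is unambiguous: two degree
  zero components differ by the degree zero part of an element of the relation ideal.\<close>

lemma degree_zero_component: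
  assumes "x \<in> algA_minus" "homogeneous 0 f"
  shows "(THE a. a \<in> algA_deg 0 \<and> (\<exists>y\<in>algA_minus. x \<oplus>\<^bsub>\<A>\<^esub> algA_class f = y \<oplus>\<^bsub>\<A>\<^esub> a)) = algA_class f"
proof (rule the_equality)
  show "algA_class f \<in> algA_deg 0 \<and> (\<exists>y\<in>algA_minus. x \<oplus>\<^bsub>\<A>\<^esub> algA_class f = y \<oplus>\<^bsub>\<A>\<^esub> algA_class f)"
    using assms algA_deg_iff by blast
next
  fix a assume "a \<in> algA_deg 0 \<and> (\<exists>y\<in>algA_minus. x \<oplus>\<^bsub>\<A>\<^esub> algA_class f = y \<oplus>\<^bsub>\<A>\<^esub> a)"
  then obtain y g where y: "y \<in> algA_minus" "x \<oplus>\<^bsub>\<A>\<^esub> algA_class f = y \<oplus>\<^bsub>\<A>\<^esub> a"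
    and g: "homogeneous 0 g" "a = algA_class g" by (auto simp: algA_deg_iff)
  obtain u v where u: "x = algA_class u" "\<forall>w\<in>Poly_Mapping.keys u. word_degree w < 0"
    and v: "y = algA_class v" "\<forall>w\<in>Poly_Mapping.keys v. word_degree w < 0"
    using algA_minus_class assms(1) y(1) by metis
  have "(v + g) - (u + f) \<in> relation_ideal"
    using y(2) by (simp add: u(1) v(1) g(2) algA_class_add flip: algA_class_eq_iff)
  then have "degree_part 0 ((v + g) - (u + f)) \<in> relation_ideal"
    by (rule relation_ideal_degree_part)
  then have "g - f \<in> relation_ideal"
    using degree_part_negative[OF u(2)] degree_part_negative[OF v(2)] g(1) assms(2)
    by (simp add: degree_part_add degree_part_diff degree_part_homogeneous)
  then show "a = algA_class f" by (simp add: g(2) algA_class_eq_iff)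
qed

subsection \<open>The quotient of the degree zero part\<close>

lemma ring_algA0: "ring algA0"
  unfolding algA0_def
proof (rule ring.subring_is_ring[OF ring_algA], rule ring.subringI[OF ring_algA])
  show "algA_deg 0 \<subseteq> carrier \<A>" by (auto simp: algA_deg_def)
  show "\<one>\<^bsub>\<A>\<^esub> \<in> algA_deg 0" using homogeneous_one algA_deg_iff algA_class_one by blast
  show "\<ominus>\<^bsub>\<A>\<^esub> h \<in> algA_deg 0" if "h \<in> algA_deg 0" for h
    using that by (metis algA_deg_iff algA_class_uminus homogeneous_uminus)
  fix a b assume "a \<in> algA_deg 0" "b \<in> algA_deg 0"
  then obtain f g where f: "homogeneous 0 f" "a = algA_class f" and g: "homogeneous 0 g" "b = algA_class g"
    using algA_deg_iff by metis
  have "homogeneous 0 (f * g)" "homogeneous 0 (f + g)"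
    using homogeneous_mult[OF f(1) g(1)] homogeneous_add[OF f(1) g(1)] by simp_all
  then show "a \<otimes>\<^bsub>\<A>\<^esub> b \<in> algA_deg 0" "a \<oplus>\<^bsub>\<A>\<^esub> b \<in> algA_deg 0"
    unfolding f(2) g(2) algA_class_mult algA_class_add using algA_deg_iff by blast+
qed

text \<open>Lifts the generation of \<open>I0\<close> to the free algebra, where homogeneity can be
  read off.\<close>

inductive null_zero :: "free_algebra \<Rightarrow> bool" where
  zero: "null_zero 0"
| mult: "n \<ge> 1 \<Longrightarrow> homogeneous n f \<Longrightarrow> homogeneous (- n) g \<Longrightarrow> null_zero (f * g)"
| add: "null_zero f \<Longrightarrow> null_zero g \<Longrightarrow> null_zero (f + g)"

lemma null_zero_homogeneous: "null_zero f \<Longrightarrow> homogeneous 0 f"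
proof (induction rule: null_zero.induct)
  case (mult n f g)
  then show ?case using homogeneous_mult[of n f "- n" g] by simp
qed (auto intro: homogeneous_add)

lemma null_zero_mult:
  "null_zero f \<Longrightarrow> homogeneous 0 g \<Longrightarrow> null_zero (g * f)"
  "null_zero f \<Longrightarrow> homogeneous 0 g \<Longrightarrow> null_zero (f * g)"
proof (induction rule: null_zero.induct)
  case (mult n f h)
  { case 1 then show ?case using mult homogeneous_mult[of 0 g n f] null_zero.mult[of n "g * f" h]
      by (simp add: mult.assoc) }
  { case 2 then show ?case using mult homogeneous_mult[of "- n" h 0 g] null_zero.mult[of n f "h * g"]
      by (simp add: mult.assoc) }
qed (auto simp: distrib_left distrib_right intro: null_zero.intros)

lemma null_zero_uminus: "null_zero f \<Longrightarrow> null_zero (- f)"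
  using null_zero_mult(1)[OF _ homogeneous_free_scalar[of "- 1"], of f] by (simp add: single_uminus)

lemma I0_iff: "x \<in> I0 \<longleftrightarrow> (\<exists>f. null_zero f \<and> x = algA_class f)"
proof
  interpret ring \<A> by (rule ring_algA)
  let ?S = "\<Union>n\<in>{1..}. {a \<otimes>\<^bsub>\<A>\<^esub> b |a b. a \<in> algA_deg n \<and> b \<in> algA_deg (- n)}"
  have S: "\<exists>f. null_zero f \<and> h = algA_class f" if hS: "h \<in> ?S" for h
  proof -
    obtain n a b where n: "n \<in> {1..}" and h: "h = a \<otimes>\<^bsub>\<A>\<^esub> b" and ab: "a \<in> algA_deg n" "b \<in> algA_deg (- n)"
      using hS by blast
    obtain f g where f: "homogeneous n f" "a = algA_class f" and g: "homogeneous (- n) g" "b = algA_class g"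
      using ab algA_deg_iff by metis
    have "null_zero (f * g)" using n f(1) g(1) by (intro null_zero.mult) auto
    then show ?thesis unfolding h f(2) g(2) algA_class_mult by blast
  qed
  show "\<exists>f. null_zero f \<and> x = algA_class f" if "x \<in> I0"
    using that unfolding I0_def
  proof (induction rule: generate.induct)
    case one
    show ?case by (intro exI[of _ 0]) (simp add: algA_class_zero null_zero.zero)
  next
    case (incl h)
    then show ?case by (rule S)
  next
    case (inv h)
    then obtain f where f: "null_zero f" "h = algA_class f" using S by blast
    have "inv\<^bsub>add_monoid \<A>\<^esub> h = algA_class (- f)"
      using algA_class_uminus[of f] by (simp add: f(2) a_inv_def)
    then show ?case using null_zero_uminus[OF f(1)] by blast
  next
    case (eng h1 h2)
    then obtain f g where "null_zero f" "h1 = algA_class f" "null_zero g" "h2 = algA_class g" by blast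
    then show ?case using null_zero.add[of f g] by (intro exI[of _ "f + g"]) (simp add: algA_class_add)
  qed
  assume "\<exists>f. null_zero f \<and> x = algA_class f"
  then obtain f where f: "null_zero f" "x = algA_class f" by blast
  from f(1) show "x \<in> I0" unfolding f(2)
  proof (induction rule: null_zero.induct)
    case zero
    show ?case using generate.one[of "add_monoid \<A>" ?S] by (simp add: I0_def algA_class_zero)
  next
    case (mult n f g)
    then have "algA_class f \<otimes>\<^bsub>\<A>\<^esub> algA_class g \<in> ?S" using algA_deg_class by force
    then have "algA_class f \<otimes>\<^bsub>\<A>\<^esub> algA_class g \<in> I0" unfolding I0_def by (rule generate.incl)
    then show ?case by (simp only: algA_class_mult)
  next
    case (add f g)
    then have "algA_class f \<oplus>\<^bsub>\<A>\<^esub> algA_class g \<in> I0"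
      using generate.eng[of _ "add_monoid \<A>" ?S] by (simp add: I0_def)
    then show ?case by (simp only: algA_class_add)
  qed
qed

lemma algA0_simps [simp]: "carrier algA0 = algA_deg 0" "monoid.mult algA0 = monoid.mult \<A>"
  "ring.add algA0 = ring.add \<A>" "monoid.one algA0 = monoid.one \<A>" "ring.zero algA0 = ring.zero \<A>"
  by (simp_all add: algA0_def)

lemma algA0_uminus: "homogeneous 0 f \<Longrightarrow> \<ominus>\<^bsub>algA0\<^esub> algA_class f = algA_class (- f)"
proof -
  assume f: "homogeneous 0 f"
  interpret ring algA0 by (rule ring_algA0)
  show ?thesis
    using algA_deg_class[OF f] algA_deg_class[OF homogeneous_uminus[OF f]]
    by (intro minus_equality) (simp_all add: algA_class_add algA_class_zero)
qed

lemma ideal_I0: "ideal I0 algA0"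
proof (rule idealI[OF ring_algA0])
  show "subgroup I0 (add_monoid algA0)"
  proof (rule group.subgroupI)
    show "group (add_monoid algA0)"
      by (rule abelian_group.a_group[OF ring.is_abelian_group[OF ring_algA0]])
    show "I0 \<subseteq> carrier (add_monoid algA0)"
    proof
      fix a assume "a \<in> I0"
      then obtain f where f: "null_zero f" "a = algA_class f" using I0_iff by blast
      show "a \<in> carrier (add_monoid algA0)"
        using algA_deg_class[OF null_zero_homogeneous[OF f(1)]] by (simp add: f(2))
    qed
    show "I0 \<noteq> {}" using null_zero.zero I0_iff by blast
    show "m_inv (add_monoid algA0) a \<in> I0" if a: "a \<in> I0" for a
    proof -
      obtain f where f: "null_zero f" "a = algA_class f" using a I0_iff by blast
      have "m_inv (add_monoid algA0) a = algA_class (- f)"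
        using algA0_uminus[OF null_zero_homogeneous[OF f(1)]] by (simp add: f(2) a_inv_def)
      then show ?thesis using null_zero_uminus[OF f(1)] I0_iff by blast
    qed
    show "a \<otimes>\<^bsub>add_monoid algA0\<^esub> b \<in> I0" if ab: "a \<in> I0" "b \<in> I0" for a b
    proof -
      obtain f g where "null_zero f" "a = algA_class f" "null_zero g" "b = algA_class g"
        using ab I0_iff by metis
      then have "null_zero (f + g)" "a \<oplus>\<^bsub>\<A>\<^esub> b = algA_class (f + g)"
        by (simp_all add: null_zero.add algA_class_add)
      then show ?thesis by (simp add: I0_iff) blast
    qed
  qed
  fix a x assume a: "a \<in> I0" and x: "x \<in> carrier algA0"
  obtain f where f: "null_zero f" "a = algA_class f" using a I0_iff by blast
  obtain g where g: "homogeneous 0 g" "x = algA_class g" using x by (metis algA_deg_iff algA0_simps(1))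
  show "x \<otimes>\<^bsub>algA0\<^esub> a \<in> I0" "a \<otimes>\<^bsub>algA0\<^esub> x \<in> I0"
    using null_zero_mult[OF f(1) g(1)] unfolding f(2) g(2) algA0_simps algA_class_mult
    by (metis I0_iff)+
qed

definition zero_coset :: "free_algebra \<Rightarrow> alg set"
  where "zero_coset f = I0 +>\<^bsub>algA0\<^esub> algA_class f"

lemma zero_coset_carrier:
  "C \<in> carrier algA0_bar \<longleftrightarrow> (\<exists>f. homogeneous 0 f \<and> C = zero_coset f)"
proof -
  have "C \<in> carrier algA0_bar \<longleftrightarrow> (\<exists>a\<in>algA_deg 0. C = I0 +>\<^bsub>algA0\<^esub> a)"
    unfolding algA0_bar_def FactRing_def A_RCOSETS_def' by simp
  then show ?thesis unfolding zero_coset_def by (metis algA_deg_iff)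
qed

lemma zero_coset_in_carrier: "homogeneous 0 f \<Longrightarrow> zero_coset f \<in> carrier algA0_bar"
  using zero_coset_carrier by blast

lemma zero_coset_ops:
  assumes "homogeneous 0 f" "homogeneous 0 g"
  shows "zero_coset f \<oplus>\<^bsub>algA0_bar\<^esub> zero_coset g = zero_coset (f + g)"
    "zero_coset f \<otimes>\<^bsub>algA0_bar\<^esub> zero_coset g = zero_coset (f * g)"
    "\<one>\<^bsub>algA0_bar\<^esub> = zero_coset 1"
proof -
  have h: "(+>\<^bsub>algA0\<^esub>) I0 \<in> ring_hom algA0 algA0_bar"
    unfolding algA0_bar_def by (rule ideal.rcos_ring_hom[OF ideal_I0])
  have c: "algA_class f \<in> carrier algA0" "algA_class g \<in> carrier algA0"
    using assms algA_deg_class by simp_all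
  show "zero_coset f \<oplus>\<^bsub>algA0_bar\<^esub> zero_coset g = zero_coset (f + g)"
    using ring_hom_add[OF h c] by (simp add: zero_coset_def algA_class_add)
  show "zero_coset f \<otimes>\<^bsub>algA0_bar\<^esub> zero_coset g = zero_coset (f * g)"
    using ring_hom_mult[OF h c] by (simp add: zero_coset_def algA_class_mult)
  show "\<one>\<^bsub>algA0_bar\<^esub> = zero_coset 1"
    using ring_hom_one[OF h] by (simp add: zero_coset_def algA_class_one)
qed

lemma zero_coset_elem:
  "x \<in> zero_coset f \<longleftrightarrow> (\<exists>g. null_zero g \<and> x = algA_class (g + f))"
proof -
  have "x \<in> zero_coset f \<longleftrightarrow> (\<exists>h\<in>I0. x = h \<oplus>\<^bsub>\<A>\<^esub> algA_class f)"
    by (auto simp: zero_coset_def a_r_coset_def')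
  also have "\<dots> \<longleftrightarrow> (\<exists>g. null_zero g \<and> x = algA_class g \<oplus>\<^bsub>\<A>\<^esub> algA_class f)"
    by (metis I0_iff)
  finally show ?thesis by (simp only: algA_class_add)
qed

lemma zero_coset_null: "null_zero f \<Longrightarrow> zero_coset f = zero_coset 0"
proof -
  assume f: "null_zero f"
  have "algA_class (g + f) \<in> zero_coset 0" if "null_zero g" for g
    unfolding zero_coset_elem using null_zero.add[OF that f] by (intro exI[of _ "g + f"]) simp
  moreover have "algA_class (g + 0) \<in> zero_coset f" if "null_zero g" for g
    unfolding zero_coset_elem using null_zero.add[OF that null_zero_uminus[OF f]]
    by (intro exI[of _ "g + - f"]) simp
  ultimately show ?thesis unfolding set_eq_iff zero_coset_elem[of _ f] zero_coset_elem[of _ 0]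
    by (metis zero_coset_elem)
qed

lemma null_zero_action: "null_zero f \<Longrightarrow> free_action f 1 = 0"
proof (induction rule: null_zero.induct)
  case (mult n f g)
  then have "free_action g 1 = 0"
    using vac_null_action[OF straight_negative[OF straight_homogeneous]] by simp
  then show ?case by (simp add: free_action_mult free_action_linear)
qed (simp_all add: free_action_add)

lemma C1_action_zero_coset:
  assumes "C1_action s"
  shows "homogeneous 0 f \<Longrightarrow> homogeneous 0 g \<Longrightarrow> s (zero_coset (f + g)) z = s (zero_coset f) z + s (zero_coset g) z"
    "homogeneous 0 f \<Longrightarrow> homogeneous 0 g \<Longrightarrow> s (zero_coset (f * g)) z = s (zero_coset f) (s (zero_coset g) z)"
    "s (zero_coset (free_scalar c)) z = c * z"
    "s (zero_coset (free_Y 0)) z = z" "s (zero_coset (free_Ys 0)) z = z"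
proof -
  have lm: "left_module algA0_bar (complex_module s)" using assms by (simp add: C1_action_def)
  show "s (zero_coset (f + g)) z = s (zero_coset f) z + s (zero_coset g) z"
    if "homogeneous 0 f" "homogeneous 0 g"
    using left_module.smult_l_distr[OF lm zero_coset_in_carrier[OF that(1)] zero_coset_in_carrier[OF that(2)], of z]
    by (simp add: zero_coset_ops[OF that] complex_module_def)
  show "s (zero_coset (f * g)) z = s (zero_coset f) (s (zero_coset g) z)"
    if "homogeneous 0 f" "homogeneous 0 g"
    using left_module.smult_assoc[OF lm zero_coset_in_carrier[OF that(1)] zero_coset_in_carrier[OF that(2)], of z]
    by (simp add: zero_coset_ops[OF that] complex_module_def)
  show "s (zero_coset (free_scalar c)) z = c * z"
    "s (zero_coset (free_Y 0)) z = z" "s (zero_coset (free_Ys 0)) z = z"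
    using assms by (simp_all add: C1_action_def zero_coset_def scalar_def Y_def Ys_def)
qed

text \<open>In degree 0 the clause f Y_n has f of degree n, so the product lies in
  \<open>I0\<close>; Y_0 - 1 and Ys_0 - 1 act as 0 by the choice of s. Homogeneity is part of the
  claim because the additivity of s is available for homogeneous elements.\<close>

lemma C1_action_vac_null:
  assumes s: "C1_action s"
  shows "vac_null 0 f \<Longrightarrow> s (zero_coset f) z = 0 \<and> homogeneous 0 f"
proof (induction "0 :: int" f arbitrary: z rule: vac_null.induct)
  note S = C1_action_zero_coset[OF s]
  have S0: "s (zero_coset 0) z = 0" for z using S(3)[of 0 z] by simp
  have Y0: "homogeneous 0 (free_Y 0)" "homogeneous 0 (free_Ys 0)"
    using homogeneous_free_Y[of 0] by simp_all
  have m1: "s (zero_coset (free_scalar (- 1))) z = - z" for z using S(3)[of "- 1" z] by simp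
  {
    case (rel f)
    then have "algA_class f = algA_class 0" by (simp add: algA_class_eq_iff)
    then have "zero_coset f = zero_coset 0" by (simp only: zero_coset_def)
    then show ?case using rel S0 by simp
  next
    case (add f g)
    then show ?case by (simp add: S(1) homogeneous_add)
  next
    case (Y n f)
    then have "null_zero (f * free_Y n)" using homogeneous_free_Y(1)[of n] by (intro null_zero.mult[of n]) auto
    then show ?case using zero_coset_null S0 null_zero_homogeneous by simp
  next
    case (Ys n f)
    then have "null_zero (f * free_Ys n)" using homogeneous_free_Y(2)[of n] by (intro null_zero.mult[of n]) auto
    then show ?case using zero_coset_null S0 null_zero_homogeneous by simp
  next
    case (Y0 f)
    have h: "homogeneous 0 (free_Y 0 + free_scalar (- 1))" using Y0 homogeneous_add homogeneous_free_scalar \<open>homogeneous 0 (free_Y 0)\<close> by blast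
    have "s (zero_coset (free_Y 0 + free_scalar (- 1))) z = 0" for z
      using S(1)[OF \<open>homogeneous 0 (free_Y 0)\<close> homogeneous_free_scalar] S(4) m1 by simp
    moreover have "s (zero_coset f) 0 = 0" using S(2)[OF Y0 homogeneous_zero, of 0] S0 by simp
    ultimately show ?case
      using S(2)[OF Y0 h, of z] homogeneous_mult[OF Y0 h] by (simp add: single_uminus)
  next
    case (Ys0 f)
    have h: "homogeneous 0 (free_Ys 0 + free_scalar (- 1))" using homogeneous_add homogeneous_free_scalar \<open>homogeneous 0 (free_Ys 0)\<close> by blast
    have "s (zero_coset (free_Ys 0 + free_scalar (- 1))) z = 0" for z
      using S(1)[OF \<open>homogeneous 0 (free_Ys 0)\<close> homogeneous_free_scalar] S(5) m1 by simp
    moreover have "s (zero_coset f) 0 = 0" using S(2)[OF Ys0 homogeneous_zero, of 0] S0 by simp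
    ultimately show ?case
      using S(2)[OF Ys0 h, of z] homogeneous_mult[OF Ys0 h] by (simp add: single_uminus)
  }
qed

text \<open>Hence any \<open>C1_action\<close> agrees on cosets with the eigenvalue of degree zero
  elements on the vacuum of the Fock space.\<close>

lemma C1_action_eq:
  assumes s: "C1_action s" and f: "homogeneous 0 f"
  obtains c where "free_action f 1 = fock_scale c 1" "\<And>z. s (zero_coset f) z = c * z"
proof -
  obtain c where c: "vac_null 0 (f - free_scalar c)"
    using straight_0[OF straight_homogeneous[OF f]] by blast
  have "free_action f 1 = fock_scale c 1"
    using vac_null_action[OF c] by (simp add: free_action_diff free_action_scalar)
  moreover have "s (zero_coset f) z = c * z" for z
    using C1_action_zero_coset(1)[OF s, of "f - free_scalar c" "free_scalar c" z]
      C1_action_vac_null[OF s c, of z] C1_action_zero_coset(3)[OF s, of c z] by simp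
  ultimately show ?thesis by (rule that)
qed

lemma abelian_group_complex_module: "abelian_group (complex_module s)"
proof (rule abelian_groupI)
  show "\<exists>y\<in>carrier (complex_module s). y \<oplus>\<^bsub>complex_module s\<^esub> x = \<zero>\<^bsub>complex_module s\<^esub>" for x
    by (rule bexI[of _ "- x"]) (simp_all add: complex_module_def)
qed (simp_all add: complex_module_def)

lemma C1_action_exists: "\<exists>s. C1_action s"
proof -
  \<comment> \<open>The character is the eigenvalue of a degree zero element on the vacuum, read off
    by \<open>vev\<close>.\<close>
  define chi where "chi f = vev (free_action f 1)" for f
  define s :: "alg set \<Rightarrow> complex \<Rightarrow> complex"
    where "s C z = the_elem ((\<lambda>a. vev (a \<odot>\<^bsub>M1\<^esub> 1)) ` C) * z" for C z
  have s: "s (zero_coset f) z = chi f * z" for f z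
  proof -
    have "(\<lambda>a. vev (a \<odot>\<^bsub>M1\<^esub> 1)) ` zero_coset f = {chi f}"
    proof
      show "(\<lambda>a. vev (a \<odot>\<^bsub>M1\<^esub> 1)) ` zero_coset f \<subseteq> {chi f}"
        by (auto simp: zero_coset_elem M1_smult free_action_add null_zero_action chi_def)
      have "algA_class (0 + f) \<in> zero_coset f" unfolding zero_coset_elem using null_zero.zero by blast
      then show "{chi f} \<subseteq> (\<lambda>a. vev (a \<odot>\<^bsub>M1\<^esub> 1)) ` zero_coset f"
        by (auto simp: chi_def M1_smult intro!: image_eqI[of _ _ "algA_class f"])
    qed
    then show ?thesis by (simp add: s_def)
  qed
  \<comment> \<open>For g of degree 0 the vector g 1 is a multiple of 1, which makes
    \<open>chi\<close> multiplicative.\<close>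
  have chi_mult: "chi (f * g) = chi f * chi g" if g: "homogeneous 0 g" for f g
  proof -
    obtain c where c: "vac_null 0 (g - free_scalar c)"
      using straight_0[OF straight_homogeneous[OF g]] by blast
    have "free_action g 1 = fock_scale c 1"
      using vac_null_action[OF c] by (simp add: free_action_diff free_action_scalar)
    then show ?thesis by (simp add: chi_def free_action_mult free_action_linear vev_scale)
  qed
  have "left_module algA0_bar (complex_module s)"
  proof -
    have R: "ring algA0_bar" unfolding algA0_bar_def by (rule ideal.quotient_is_ring[OF ideal_I0])
    show ?thesis
    proof (intro left_module.intro left_module_axioms.intro R abelian_group_complex_module)
      show "a \<odot>\<^bsub>complex_module s\<^esub> x \<in> carrier (complex_module s)" for a x by (simp add: complex_module_def)
      show "\<one>\<^bsub>algA0_bar\<^esub> \<odot>\<^bsub>complex_module s\<^esub> x = x" for x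
        by (simp add: complex_module_def zero_coset_ops[OF homogeneous_zero homogeneous_zero] s chi_def)
      fix a b x y assume "a \<in> carrier algA0_bar" 
      then obtain f where f: "homogeneous 0 f" "a = zero_coset f" using zero_coset_carrier by blast
      show "a \<odot>\<^bsub>complex_module s\<^esub> (x \<oplus>\<^bsub>complex_module s\<^esub> y)
          = a \<odot>\<^bsub>complex_module s\<^esub> x \<oplus>\<^bsub>complex_module s\<^esub> a \<odot>\<^bsub>complex_module s\<^esub> y"
        by (simp add: complex_module_def f s distrib_left)
      assume "b \<in> carrier algA0_bar"
      then obtain g where g: "homogeneous 0 g" "b = zero_coset g" using zero_coset_carrier by blast
      show "(a \<oplus>\<^bsub>algA0_bar\<^esub> b) \<odot>\<^bsub>complex_module s\<^esub> x
          = a \<odot>\<^bsub>complex_module s\<^esub> x \<oplus>\<^bsub>complex_module s\<^esub> b \<odot>\<^bsub>complex_module s\<^esub> x"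
        using f g by (simp add: complex_module_def zero_coset_ops s chi_def free_action_add vev_add distrib_right)
      show "(a \<otimes>\<^bsub>algA0_bar\<^esub> b) \<odot>\<^bsub>complex_module s\<^esub> x
          = a \<odot>\<^bsub>complex_module s\<^esub> (b \<odot>\<^bsub>complex_module s\<^esub> x)"
        using f g by (simp add: complex_module_def zero_coset_ops s chi_mult)
    qed
  qed
  moreover have "s (I0 +>\<^bsub>algA0\<^esub> scalar c) z = c * z" for c z
    using s[of "free_scalar c" z] by (simp add: zero_coset_def scalar_def chi_def free_action_scalar vev_scale)
  moreover have "s (I0 +>\<^bsub>algA0\<^esub> Y 0) z = z" "s (I0 +>\<^bsub>algA0\<^esub> Ys 0) z = z" for z
    using s[of "free_Y 0" z] s[of "free_Ys 0" z]
    by (simp_all add: zero_coset_def Y_def Ys_def chi_def free_action_gen vacuum_op)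
  ultimately show ?thesis unfolding C1_action_def by blast
qed

section \<open>Left modules\<close>

context left_module
begin

lemma smult_zero_left: "x \<in> carrier M \<Longrightarrow> \<zero> \<odot>\<^bsub>M\<^esub> x = \<zero>\<^bsub>M\<^esub>"
  by (metis R.r_zero R.zero_closed M.add.r_cancel_one smult_closed smult_l_distr)

lemma smult_zero_right: "a \<in> carrier R \<Longrightarrow> a \<odot>\<^bsub>M\<^esub> \<zero>\<^bsub>M\<^esub> = \<zero>\<^bsub>M\<^esub>"
  by (metis M.r_zero M.zero_closed M.add.r_cancel_one smult_closed smult_r_distr)

lemma smult_minus_left: "a \<in> carrier R \<Longrightarrow> x \<in> carrier M \<Longrightarrow> (\<ominus> a) \<odot>\<^bsub>M\<^esub> x = \<ominus>\<^bsub>M\<^esub> (a \<odot>\<^bsub>M\<^esub> x)"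
  by (metis M.minus_equality R.a_inv_closed R.l_neg smult_closed smult_l_distr smult_zero_left)

lemma submodule_zero: "submodule {\<zero>\<^bsub>M\<^esub>} R M"
proof (intro submodule.intro submodule_axioms.intro)
  show "subgroup {\<zero>\<^bsub>M\<^esub>} (add_monoid M)"
    using group.triv_subgroup[OF M.a_group] by simp
qed (simp add: smult_zero_right)

lemma generated_submodule_zero: "S \<subseteq> {\<zero>\<^bsub>M\<^esub>} \<Longrightarrow> generated_submodule R M S = {\<zero>\<^bsub>M\<^esub>}"
proof -
  assume S: "S \<subseteq> {\<zero>\<^bsub>M\<^esub>}"
  have "\<zero>\<^bsub>M\<^esub> \<in> N" if "submodule N R M" for N
    using subgroup.one_closed[OF submodule.axioms(1)[OF that]] by simp
  then show ?thesis unfolding generated_submodule_def using S submodule_zero by blast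
qed

lemma graded_submodule_zero: "graded_submodule R M G {\<zero>\<^bsub>M\<^esub>}"
  unfolding graded_submodule_def
proof (intro conjI submodule_zero subset_antisym)
  let ?S = "\<Union>n. {\<zero>\<^bsub>M\<^esub>} \<inter> G n"
  show "{\<zero>\<^bsub>M\<^esub>} \<subseteq> generate (add_monoid M) ?S"
    using generate.one[of "add_monoid M" ?S] by simp
  show "generate (add_monoid M) ?S \<subseteq> {\<zero>\<^bsub>M\<^esub>}"
  proof
    fix x assume "x \<in> generate (add_monoid M) ?S"
    then show "x \<in> {\<zero>\<^bsub>M\<^esub>}"
    proof (induction rule: generate.induct)
      case (inv h)
      then have "h = \<zero>\<^bsub>M\<^esub>" by blast
      then show ?case using monoid.inv_one[OF group.is_monoid[OF M.a_group]] by simp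
    qed auto
  qed
qed

text \<open>Evaluates the description in \<open>LA1\<close> for a simple module: 0 is itself a
  proper graded submodule, and nothing lies strictly between it and the module.\<close>

lemma simple_maximal_graded_submodule:
  assumes "carrier M \<noteq> {\<zero>\<^bsub>M\<^esub>}"
    "\<And>N. submodule N R M \<Longrightarrow> N \<noteq> {\<zero>\<^bsub>M\<^esub>} \<Longrightarrow> N = carrier M"
  shows "(THE N. maximal_graded_submodule R M G N) = {\<zero>\<^bsub>M\<^esub>}"
proof (rule the_equality)
  show "maximal_graded_submodule R M G {\<zero>\<^bsub>M\<^esub>}"
    unfolding maximal_graded_submodule_def
    using assms graded_submodule_zero by (metis graded_submodule_def)
  fix N assume "maximal_graded_submodule R M G N"
  then show "N = {\<zero>\<^bsub>M\<^esub>}"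
    unfolding maximal_graded_submodule_def graded_submodule_def using assms(2) by metis
qed

lemma quotient_zero_coset: "x \<in> carrier M \<Longrightarrow> {\<zero>\<^bsub>M\<^esub>} +>\<^bsub>M\<^esub> x = {x}"
  by (simp add: a_r_coset_def')

text \<open>Dividing by 0 replaces each vector by its singleton, so the quotient is isomorphic to
  the module but not equal to it.\<close>

lemma quotient_zero_simps:
  "carrier (quotient_module M {\<zero>\<^bsub>M\<^esub>}) = (\<lambda>x. {x}) ` carrier M"
  "\<zero>\<^bsub>quotient_module M {\<zero>\<^bsub>M\<^esub>}\<^esub> = {\<zero>\<^bsub>M\<^esub>}"
  "{x} \<oplus>\<^bsub>quotient_module M {\<zero>\<^bsub>M\<^esub>}\<^esub> {y} = {x \<oplus>\<^bsub>M\<^esub> y}"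
  "a \<in> carrier R \<Longrightarrow> x \<in> carrier M \<Longrightarrow> a \<odot>\<^bsub>quotient_module M {\<zero>\<^bsub>M\<^esub>}\<^esub> {x} = {a \<odot>\<^bsub>M\<^esub> x}"
  by (auto simp: quotient_module_def A_RCOSETS_def' quotient_zero_coset set_add_def' smult_closed)

lemma left_module_quotient_zero: "left_module R (quotient_module M {\<zero>\<^bsub>M\<^esub>})"
proof (intro left_module.intro left_module_axioms.intro R.ring_axioms)
  let ?Q = "quotient_module M {\<zero>\<^bsub>M\<^esub>}"
  note q = quotient_zero_simps
  show "abelian_group ?Q"
  proof (rule abelian_groupI)
    fix x assume "x \<in> carrier ?Q"
    then obtain x' where x: "x' \<in> carrier M" "x = {x'}" unfolding q(1) by blast
    show "\<exists>y\<in>carrier ?Q. y \<oplus>\<^bsub>?Q\<^esub> x = \<zero>\<^bsub>?Q\<^esub>"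
      using x(1) by (intro bexI[of _ "{\<ominus>\<^bsub>M\<^esub> x'}"]) (simp_all add: x(2) q M.l_neg)
    show "\<zero>\<^bsub>?Q\<^esub> \<oplus>\<^bsub>?Q\<^esub> x = x" using x(1) by (simp add: x(2) q)
    fix y assume "y \<in> carrier ?Q"
    then obtain y' where y: "y' \<in> carrier M" "y = {y'}" unfolding q(1) by blast
    show "x \<oplus>\<^bsub>?Q\<^esub> y \<in> carrier ?Q" using x(1) y(1) by (simp add: x(2) y(2) q)
    show "x \<oplus>\<^bsub>?Q\<^esub> y = y \<oplus>\<^bsub>?Q\<^esub> x" using x(1) y(1) by (simp add: x(2) y(2) q M.a_comm)
    fix z assume "z \<in> carrier ?Q"
    then obtain z' where z: "z' \<in> carrier M" "z = {z'}" unfolding q(1) by blast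
    show "x \<oplus>\<^bsub>?Q\<^esub> y \<oplus>\<^bsub>?Q\<^esub> z = x \<oplus>\<^bsub>?Q\<^esub> (y \<oplus>\<^bsub>?Q\<^esub> z)"
      using x(1) y(1) z(1) by (simp add: x(2) y(2) z(2) q M.a_assoc)
  qed (simp add: q)
  fix x assume "x \<in> carrier ?Q"
  then obtain x' where x: "x' \<in> carrier M" "x = {x'}" unfolding q(1) by blast
  show "\<one> \<odot>\<^bsub>?Q\<^esub> x = x" using x(1) by (simp add: x(2) q smult_one)
  fix a assume a: "a \<in> carrier R"
  show "a \<odot>\<^bsub>?Q\<^esub> x \<in> carrier ?Q" using a x(1) by (simp add: x(2) q smult_closed)
  fix b assume b: "b \<in> carrier R"
  show "(a \<oplus> b) \<odot>\<^bsub>?Q\<^esub> x = a \<odot>\<^bsub>?Q\<^esub> x \<oplus>\<^bsub>?Q\<^esub> b \<odot>\<^bsub>?Q\<^esub> x"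
    using a b x(1) by (simp add: x(2) q smult_l_distr)
  show "(a \<otimes> b) \<odot>\<^bsub>?Q\<^esub> x = a \<odot>\<^bsub>?Q\<^esub> (b \<odot>\<^bsub>?Q\<^esub> x)"
    using a b x(1) by (simp add: x(2) q smult_assoc smult_closed)
next
  let ?Q = "quotient_module M {\<zero>\<^bsub>M\<^esub>}"
  note q = quotient_zero_simps
  fix a x y assume a: "a \<in> carrier R" and "x \<in> carrier ?Q" "y \<in> carrier ?Q"
  then obtain x' y' where x: "x' \<in> carrier M" "x = {x'}" and y: "y' \<in> carrier M" "y = {y'}"
    unfolding q(1) by blast
  show "a \<odot>\<^bsub>?Q\<^esub> (x \<oplus>\<^bsub>?Q\<^esub> y) = a \<odot>\<^bsub>?Q\<^esub> x \<oplus>\<^bsub>?Q\<^esub> a \<odot>\<^bsub>?Q\<^esub> y"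
    using a x(1) y(1) by (simp add: x(2) y(2) q smult_r_distr smult_closed)
qed

lemma quotient_zero_isomorphic:
  assumes "module_isomorphic R M L"
  shows "module_isomorphic R (quotient_module M {\<zero>\<^bsub>M\<^esub>}) L"
proof -
  let ?Q = "quotient_module M {\<zero>\<^bsub>M\<^esub>}"
  note q = quotient_zero_simps
  obtain h where L: "left_module R L" and h: "bij_betw h (carrier M) (carrier L)"
    "\<And>x y. x \<in> carrier M \<Longrightarrow> y \<in> carrier M \<Longrightarrow> h (x \<oplus>\<^bsub>M\<^esub> y) = h x \<oplus>\<^bsub>L\<^esub> h y"
    "\<And>a x. a \<in> carrier R \<Longrightarrow> x \<in> carrier M \<Longrightarrow> h (a \<odot>\<^bsub>M\<^esub> x) = a \<odot>\<^bsub>L\<^esub> h x"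
    using assms unfolding module_isomorphic_def by blast
  have "bij_betw the_elem (carrier ?Q) (carrier M)"
    unfolding q(1) by (rule bij_betw_byWitness[of _ "\<lambda>x. {x}"]) auto
  then have "bij_betw (h \<circ> the_elem) (carrier ?Q) (carrier L)"
    using h(1) by (rule bij_betw_trans)
  moreover have "\<forall>x\<in>carrier ?Q. \<forall>y\<in>carrier ?Q.
      (h \<circ> the_elem) (x \<oplus>\<^bsub>?Q\<^esub> y) = (h \<circ> the_elem) x \<oplus>\<^bsub>L\<^esub> (h \<circ> the_elem) y"
    unfolding q(1) ball_simps(9) by (simp add: q h)
  moreover have "\<forall>a\<in>carrier R. \<forall>x\<in>carrier ?Q.
      (h \<circ> the_elem) (a \<odot>\<^bsub>?Q\<^esub> x) = a \<odot>\<^bsub>L\<^esub> (h \<circ> the_elem) x"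
    unfolding q(1) ball_simps(9) by (simp add: q h)
  ultimately show ?thesis
    unfolding module_isomorphic_def using left_module_quotient_zero L by blast
qed

end

section \<open>Tensor products\<close>

locale tensor_data = ring R for R :: "('a, 'r) ring_scheme" (structure) +
  fixes B :: "'a set" and N :: "('a, 'b, 'n) module_scheme"
  assumes B_subset: "B \<subseteq> carrier R" and N_group: "abelian_group N"
    and action_closed: "b \<in> B \<Longrightarrow> x \<in> carrier N \<Longrightarrow> b \<odot>\<^bsub>N\<^esub> x \<in> carrier N"
begin

interpretation N: abelian_group N by (rule N_group)

abbreviation F where "F \<equiv> free_Abelian_group (carrier R \<times> carrier N)"
abbreviation K where "K \<equiv> tensor_null R B N"
abbreviation T where "T \<equiv> tensor_module R B N"

definition cls :: "('a \<times> 'b \<Rightarrow>\<^sub>0 int) \<Rightarrow> ('a \<times> 'b \<Rightarrow>\<^sub>0 int) set"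
  where "cls g = K #>\<^bsub>F\<^esub> g"

definition left_mult :: "'a \<Rightarrow> ('a \<times> 'b \<Rightarrow>\<^sub>0 int) \<Rightarrow> 'a \<times> 'b \<Rightarrow>\<^sub>0 int"
  where "left_mult r = frag_extend (\<lambda>(a, x). frag_of (r \<otimes> a, x))"

lemma carrier_diff: "f \<in> carrier F \<Longrightarrow> g \<in> carrier F \<Longrightarrow> f - g \<in> carrier F"
  using keys_diff[of f g] by auto

lemma carrier_add: "f \<in> carrier F \<Longrightarrow> g \<in> carrier F \<Longrightarrow> f + g \<in> carrier F"
  using keys_add[of f g] by auto

lemma tensor_relations_cases:
  assumes "h \<in> tensor_relations R B N"
  obtains a b x where "h = frag_of (a \<oplus> b, x) - frag_of (a, x) - frag_of (b, x)"
      "a \<in> carrier R" "b \<in> carrier R" "x \<in> carrier N"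
  | a x y where "h = frag_of (a, x \<oplus>\<^bsub>N\<^esub> y) - frag_of (a, x) - frag_of (a, y)"
      "a \<in> carrier R" "x \<in> carrier N" "y \<in> carrier N"
  | a b x where "h = frag_of (a \<otimes> b, x) - frag_of (a, b \<odot>\<^bsub>N\<^esub> x)"
      "a \<in> carrier R" "b \<in> B" "x \<in> carrier N"
  using assms unfolding tensor_relations_def by blast

lemma tensor_relations_carrier: "tensor_relations R B N \<subseteq> carrier F"
proof
  fix h assume "h \<in> tensor_relations R B N"
  then show "h \<in> carrier F"
    using B_subset action_closed
    by (cases rule: tensor_relations_cases)
      (simp_all only:, (intro carrier_diff; simp add: keys_frag_of subsetD)+)
qed

lemma K_subgroup: "subgroup K F"
  unfolding tensor_null_def by (rule group.generate_is_subgroup) (simp_all add: tensor_relations_carrier)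

lemma K_closed: "0 \<in> K" "f \<in> K \<Longrightarrow> g \<in> K \<Longrightarrow> f + g \<in> K" "f \<in> K \<Longrightarrow> - f \<in> K" "f \<in> K \<Longrightarrow> f \<in> carrier F"
  using subgroup.one_closed[OF K_subgroup] subgroup.m_closed[OF K_subgroup, of f g]
    subgroup.m_inv_closed[OF K_subgroup, of f] subgroup.mem_carrier[OF K_subgroup, of f]
  by auto

lemma K_diff: "f \<in> K \<Longrightarrow> g \<in> K \<Longrightarrow> f - g \<in> K"
  using K_closed(2)[of f "- g"] K_closed(3) by simp

lemma cls_mem: "f \<in> cls g \<longleftrightarrow> f - g \<in> K"
proof -
  have "f \<in> cls g \<longleftrightarrow> (\<exists>k\<in>K. f = k + g)" by (auto simp: cls_def r_coset_def)
  then show ?thesis by (metis add_diff_cancel_right' diff_add_cancel)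
qed

lemma cls_eq_iff: "cls f = cls g \<longleftrightarrow> f - g \<in> K"
proof
  assume "cls f = cls g"
  then show "f - g \<in> K" using K_closed(1) cls_mem[of f f] cls_mem[of f g] by simp
next
  assume fg: "f - g \<in> K"
  have "h - f \<in> K \<longleftrightarrow> h - g \<in> K" for h
    using K_closed(2)[OF _ fg, of "h - f"] K_diff[OF _ fg, of "h - g"] by auto
  then show "cls f = cls g" by (simp add: set_eq_iff cls_mem)
qed

lemma carrier_T: "carrier T = cls ` carrier F"
  unfolding tensor_module_def Let_def cls_def by (simp add: RCOSETS_def) blast

lemma zero_T: "\<zero>\<^bsub>T\<^esub> = cls 0"
  unfolding tensor_module_def Let_def by (simp add: set_eq_iff cls_mem)

lemma add_T: "cls f \<oplus>\<^bsub>T\<^esub> cls g = cls (f + g)"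
proof -
  have "cls f \<oplus>\<^bsub>T\<^esub> cls g = (\<Union>u\<in>cls f. \<Union>v\<in>cls g. {u + v})"
    by (simp add: tensor_module_def Let_def set_mult_def)
  also have "\<dots> = cls (f + g)"
  proof (intro subset_antisym subsetI)
    fix h assume "h \<in> (\<Union>u\<in>cls f. \<Union>v\<in>cls g. {u + v})"
    then obtain u v where "u - f \<in> K" "v - g \<in> K" "h = u + v" by (auto simp: cls_mem)
    then show "h \<in> cls (f + g)" using K_closed(2)[of "u - f" "v - g"] by (simp add: cls_mem algebra_simps)
  next
    fix h assume "h \<in> cls (f + g)"
    then have "h - g \<in> cls f" "g \<in> cls g" using K_closed(1) by (simp_all add: cls_mem algebra_simps)
    moreover have "h = (h - g) + g" by simp
    ultimately show "h \<in> (\<Union>u\<in>cls f. \<Union>v\<in>cls g. {u + v})" by blast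
  qed
  finally show ?thesis .
qed

lemma left_mult_simps:
  "left_mult r 0 = 0" "left_mult r (f + g) = left_mult r f + left_mult r g"
  "left_mult r (f - g) = left_mult r f - left_mult r g" "left_mult r (- f) = - left_mult r f"
  "left_mult r (frag_of (a, x)) = frag_of (r \<otimes> a, x)"
  by (simp_all add: left_mult_def frag_extend_add frag_extend_diff frag_extend_minus)

lemma left_mult_carrier:
  assumes "r \<in> carrier R" "g \<in> carrier F"
  shows "left_mult r g \<in> carrier F"
proof -
  have "Poly_Mapping.keys g \<subseteq> carrier R \<times> carrier N" using assms(2) by simp
  then show ?thesis
  proof (induction g rule: frag_induction)
    case zero
    show ?case by (simp add: left_mult_simps)
  next
    case (one p)
    then show ?case using assms(1) by (cases p) (simp add: left_mult_simps)
  next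
    case (diff a b)
    then show ?case unfolding left_mult_simps by (rule carrier_diff)
  qed
qed

lemma K_incl: "h \<in> tensor_relations R B N \<Longrightarrow> h \<in> K"
  unfolding tensor_null_def by (rule generate.incl)

lemma K_add_left:
  "a \<in> carrier R \<Longrightarrow> b \<in> carrier R \<Longrightarrow> x \<in> carrier N \<Longrightarrow> frag_of (a \<oplus> b, x) - frag_of (a, x) - frag_of (b, x) \<in> K"
  by (rule K_incl) (unfold tensor_relations_def, blast)

lemma K_add_right:
  "a \<in> carrier R \<Longrightarrow> x \<in> carrier N \<Longrightarrow> y \<in> carrier N \<Longrightarrow>
    frag_of (a, x \<oplus>\<^bsub>N\<^esub> y) - frag_of (a, x) - frag_of (a, y) \<in> K"
  by (rule K_incl) (unfold tensor_relations_def, blast)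

lemma K_balanced:
  "a \<in> carrier R \<Longrightarrow> b \<in> B \<Longrightarrow> x \<in> carrier N \<Longrightarrow> frag_of (a \<otimes> b, x) - frag_of (a, b \<odot>\<^bsub>N\<^esub> x) \<in> K"
  by (rule K_incl) (unfold tensor_relations_def, blast)

text \<open>Left multiplication commutes with the right action of \<open>B\<close>, so it maps each
  kind of relation to one of the same kind.\<close>

lemma left_mult_relation:
  assumes r: "r \<in> carrier R" and h: "h \<in> tensor_relations R B N"
  shows "left_mult r h \<in> K"
  using h
proof (cases rule: tensor_relations_cases)
  case (1 a b x)
  then show ?thesis using r K_add_left[of "r \<otimes> a" "r \<otimes> b" x]
    by (simp add: left_mult_simps r_distr)
next
  case (2 a x y)
  then show ?thesis using r K_add_right[of "r \<otimes> a" x y] by (simp add: left_mult_simps)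
next
  case (3 a b x)
  then show ?thesis using r K_balanced[of "r \<otimes> a" b x] B_subset
    by (simp add: left_mult_simps m_assoc subsetD)
qed

lemma left_mult_K:
  assumes r: "r \<in> carrier R" and k: "k \<in> K"
  shows "left_mult r k \<in> K"
  using k unfolding tensor_null_def[of R B N]
proof (induction rule: generate.induct)
  case one
  show ?case using K_closed(1) by (simp add: left_mult_simps tensor_null_def)
next
  case (incl h)
  then show ?case using left_mult_relation[OF r] by (simp add: tensor_null_def)
next
  case (inv h)
  have "inv\<^bsub>F\<^esub> h = - h" using inv tensor_relations_carrier by auto
  then show ?case using K_closed(3)[OF left_mult_relation[OF r inv]] by (simp add: left_mult_simps tensor_null_def)
next
  case (eng f g)
  then show ?case using K_closed(2) by (simp add: left_mult_simps tensor_null_def)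
qed

text \<open>Each representative contributes the same coset, so the union in the definition of the
  action is that coset.\<close>

lemma smult_T:
  assumes "r \<in> carrier R"
  shows "r \<odot>\<^bsub>T\<^esub> cls g = cls (left_mult r g)"
proof -
  have "r \<odot>\<^bsub>T\<^esub> cls g = (\<Union>f\<in>cls g. cls (left_mult r f))"
    by (simp add: tensor_module_def Let_def left_mult_def cls_def)
  also have "\<dots> = (\<Union>f\<in>cls g. cls (left_mult r g))"
  proof (rule SUP_cong[OF refl])
    fix f assume "f \<in> cls g"
    then show "cls (left_mult r f) = cls (left_mult r g)"
      using left_mult_K[OF assms, of "f - g"] by (simp add: cls_eq_iff cls_mem left_mult_simps)
  qed
  also have "\<dots> = cls (left_mult r g)" using K_closed(1) cls_mem[of g g] by auto
  finally show ?thesis .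
qed

lemma T_elem: "x \<in> carrier T \<Longrightarrow> \<exists>g\<in>carrier F. x = cls g"
  unfolding carrier_T by blast

lemma cls_carrier: "g \<in> carrier F \<Longrightarrow> cls g \<in> carrier T"
  unfolding carrier_T by blast

lemma left_module_T: "left_module R T"
proof (intro left_module.intro left_module_axioms.intro ring_axioms)
  show "abelian_group T"
  proof (rule abelian_groupI)
    show "\<zero>\<^bsub>T\<^esub> \<in> carrier T" unfolding zero_T by (rule cls_carrier) simp
    fix x assume "x \<in> carrier T"
    then obtain f where f: "f \<in> carrier F" "x = cls f" using T_elem by blast
    show "\<zero>\<^bsub>T\<^esub> \<oplus>\<^bsub>T\<^esub> x = x" by (simp add: f(2) zero_T add_T)
    have "- f \<in> carrier F" using f(1) by simp
    then show "\<exists>y\<in>carrier T. y \<oplus>\<^bsub>T\<^esub> x = \<zero>\<^bsub>T\<^esub>"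
      by (intro bexI[of _ "cls (- f)"] cls_carrier) (simp_all add: f(2) zero_T add_T)
    fix y assume "y \<in> carrier T"
    then obtain g where g: "g \<in> carrier F" "y = cls g" using T_elem by blast
    show "x \<oplus>\<^bsub>T\<^esub> y \<in> carrier T"
      unfolding f(2) g(2) add_T by (rule cls_carrier[OF carrier_add[OF f(1) g(1)]])
    show "x \<oplus>\<^bsub>T\<^esub> y = y \<oplus>\<^bsub>T\<^esub> x" unfolding f(2) g(2) add_T by (simp add: add.commute)
    fix z assume "z \<in> carrier T"
    then obtain h where h: "z = cls h" using T_elem by blast
    show "x \<oplus>\<^bsub>T\<^esub> y \<oplus>\<^bsub>T\<^esub> z = x \<oplus>\<^bsub>T\<^esub> (y \<oplus>\<^bsub>T\<^esub> z)"
      unfolding f(2) g(2) h add_T by (simp add: add.assoc)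
  qed
next
  fix a x assume a: "a \<in> carrier R" and "x \<in> carrier T"
  then obtain f where f: "f \<in> carrier F" "x = cls f" using T_elem by blast
  show "a \<odot>\<^bsub>T\<^esub> x \<in> carrier T"
    unfolding f(2) smult_T[OF a] by (rule cls_carrier[OF left_mult_carrier[OF a f(1)]])
  fix y assume "y \<in> carrier T"
  then obtain g where g: "y = cls g" using T_elem by blast
  show "a \<odot>\<^bsub>T\<^esub> (x \<oplus>\<^bsub>T\<^esub> y) = a \<odot>\<^bsub>T\<^esub> x \<oplus>\<^bsub>T\<^esub> a \<odot>\<^bsub>T\<^esub> y"
    unfolding f(2) g add_T smult_T[OF a] by (simp add: left_mult_simps)
next
  fix a b x assume a: "a \<in> carrier R" and b: "b \<in> carrier R" and "x \<in> carrier T"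
  then obtain f where f: "Poly_Mapping.keys f \<subseteq> carrier R \<times> carrier N" "x = cls f"
    using T_elem by (metis carrier_free_Abelian_group_iff)
  have "left_mult (a \<oplus> b) f - (left_mult a f + left_mult b f) \<in> K"
    using f(1)
  proof (induction f rule: frag_induction)
    case zero
    show ?case using K_closed(1) by (simp add: left_mult_simps)
  next
    case (one p)
    obtain c x where p: "p = (c, x)" by (cases p)
    then show ?case using K_add_left[of "a \<otimes> c" "b \<otimes> c" x] one a b
      by (simp add: left_mult_simps l_distr diff_diff_eq)
  next
    case (diff f g)
    have "left_mult (a \<oplus> b) (f - g) - (left_mult a (f - g) + left_mult b (f - g))
      = (left_mult (a \<oplus> b) f - (left_mult a f + left_mult b f))
        - (left_mult (a \<oplus> b) g - (left_mult a g + left_mult b g))"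
      by (simp add: left_mult_simps)
    then show ?case using K_diff[OF diff] by simp
  qed
  then show "(a \<oplus> b) \<odot>\<^bsub>T\<^esub> x = a \<odot>\<^bsub>T\<^esub> x \<oplus>\<^bsub>T\<^esub> b \<odot>\<^bsub>T\<^esub> x"
    using a b by (simp add: f(2) smult_T add_T cls_eq_iff)
  have "left_mult (a \<otimes> b) f = left_mult a (left_mult b f)"
    using f(1)
  proof (induction f rule: frag_induction)
    case (one p)
    then show ?case using a b by (cases p) (simp add: left_mult_simps m_assoc)
  qed (simp_all add: left_mult_simps)
  then show "(a \<otimes> b) \<odot>\<^bsub>T\<^esub> x = a \<odot>\<^bsub>T\<^esub> (b \<odot>\<^bsub>T\<^esub> x)"
    using a b by (simp add: f(2) smult_T)
next
  fix x assume "x \<in> carrier T"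
  then obtain f where f: "Poly_Mapping.keys f \<subseteq> carrier R \<times> carrier N" "x = cls f"
    using T_elem by (metis carrier_free_Abelian_group_iff)
  have "left_mult \<one> f = f"
    using f(1)
  proof (induction f rule: frag_induction)
    case (one p)
    then show ?case by (cases p) (simp add: left_mult_simps)
  qed (simp_all add: left_mult_simps)
  then show "\<one> \<odot>\<^bsub>T\<^esub> x = x" by (simp add: f(2) smult_T)
qed

lemma pure_cls: "pure_tensor R B N a x = cls (frag_of (a, x))"
  by (simp add: pure_tensor_def cls_def)

lemma pure_carrier: "a \<in> carrier R \<Longrightarrow> x \<in> carrier N \<Longrightarrow> pure_tensor R B N a x \<in> carrier T"
  unfolding pure_cls by (rule cls_carrier) simp

lemma smult_pure: "r \<in> carrier R \<Longrightarrow> r \<odot>\<^bsub>T\<^esub> pure_tensor R B N a x = pure_tensor R B N (r \<otimes> a) x"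
  by (simp add: pure_cls smult_T left_mult_simps)

lemma pure_balanced:
  "a \<in> carrier R \<Longrightarrow> b \<in> B \<Longrightarrow> x \<in> carrier N \<Longrightarrow>
    pure_tensor R B N (a \<otimes> b) x = pure_tensor R B N a (b \<odot>\<^bsub>N\<^esub> x)"
  by (simp add: pure_cls cls_eq_iff K_balanced)

lemma pure_zero_right: "a \<in> carrier R \<Longrightarrow> pure_tensor R B N a \<zero>\<^bsub>N\<^esub> = \<zero>\<^bsub>T\<^esub>"
  using K_closed(3)[OF K_add_right[of a "\<zero>\<^bsub>N\<^esub>" "\<zero>\<^bsub>N\<^esub>"]] by (simp add: pure_cls zero_T cls_eq_iff)

lemma T_induct [consumes 1, case_names zero pure diff]:
  assumes "u \<in> carrier T" "P \<zero>\<^bsub>T\<^esub>" "\<And>a x. a \<in> carrier R \<Longrightarrow> x \<in> carrier N \<Longrightarrow> P (pure_tensor R B N a x)"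
    "\<And>u v. u \<in> carrier T \<Longrightarrow> v \<in> carrier T \<Longrightarrow> P u \<Longrightarrow> P v \<Longrightarrow> P (u \<ominus>\<^bsub>T\<^esub> v)"
  shows "P u"
proof -
  interpret T: left_module R T by (rule left_module_T)
  obtain f where f: "Poly_Mapping.keys f \<subseteq> carrier R \<times> carrier N" "u = cls f"
    using T_elem[OF assms(1)] by (metis carrier_free_Abelian_group_iff)
  have "f \<in> carrier F \<and> P (cls f)"
    using f(1)
  proof (induction f rule: frag_induction)
    case zero
    show ?case using assms(2) by (simp add: zero_T)
  next
    case (one p)
    then show ?case using assms(3) by (cases p) (auto simp: pure_cls)
  next
    case (diff f g)
    have c: "cls f \<in> carrier T" "cls g \<in> carrier T" "cls (f - g) \<in> carrier T"
      using diff carrier_diff cls_carrier by blast+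
    have "cls (f - g) \<oplus>\<^bsub>T\<^esub> cls g = cls f" by (simp add: add_T)
    then have "cls (f - g) = cls f \<ominus>\<^bsub>T\<^esub> cls g"
      using c by (metis T.M.add.inv_solve_right' T.M.minus_eq)
    then show ?case using assms(4) diff c carrier_diff by simp
  qed
  then show ?thesis by (simp add: f(2))
qed

section \<open>Additive maps out of the tensor product\<close>

definition lift_sum :: "('a \<times> 'b \<Rightarrow> fock) \<Rightarrow> ('a \<times> 'b \<Rightarrow>\<^sub>0 int) \<Rightarrow> fock"
  where "lift_sum t f = (\<Sum>p\<in>Poly_Mapping.keys f. fock_scale (of_int (Poly_Mapping.lookup f p)) (t p))"

lemma lift_sum_simps:
  "lift_sum t 0 = 0" "lift_sum t (f + g) = lift_sum t f + lift_sum t g"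
  "lift_sum t (- f) = - lift_sum t f" "lift_sum t (f - g) = lift_sum t f - lift_sum t g"
  "lift_sum t (frag_of p) = t p"
proof -
  show z: "lift_sum t 0 = 0" by (simp add: lift_sum_def)
  show a: "lift_sum t (f + g) = lift_sum t f + lift_sum t g" for f g
    unfolding lift_sum_def by (rule setsum_keys_plus_distrib) (simp_all add: fock.scale_left_distrib)
  show m: "lift_sum t (- f) = - lift_sum t f" for f
    using a[of f "- f"] z by (simp add: eq_neg_iff_add_eq_0 add.commute)
  show "lift_sum t (f - g) = lift_sum t f - lift_sum t g"
    using a[of f "- g"] m[of g] by simp
  show "lift_sum t (frag_of p) = t p" by (simp add: lift_sum_def)
qed

text \<open>The part of the universal property that detects nonzero tensors: a biadditive balanced t
  extends to an additive map that vanishes on all relations. Pure tensors are enough, since every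
  element of \<open>MA1 s\<close> has the form f v_1.\<close>

lemma tensor_lift:
  fixes t :: "'a \<times> 'b \<Rightarrow> fock"
  assumes "\<And>a b x. a \<in> carrier R \<Longrightarrow> b \<in> carrier R \<Longrightarrow> x \<in> carrier N \<Longrightarrow> t (a \<oplus> b, x) = t (a, x) + t (b, x)"
    "\<And>a x y. a \<in> carrier R \<Longrightarrow> x \<in> carrier N \<Longrightarrow> y \<in> carrier N \<Longrightarrow> t (a, x \<oplus>\<^bsub>N\<^esub> y) = t (a, x) + t (a, y)"
    "\<And>a b x. a \<in> carrier R \<Longrightarrow> b \<in> B \<Longrightarrow> x \<in> carrier N \<Longrightarrow> t (a \<otimes> b, x) = t (a, b \<odot>\<^bsub>N\<^esub> x)"
    and "pure_tensor R B N a x = \<zero>\<^bsub>T\<^esub>"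
  shows "t (a, x) = 0"
proof -
  have rel: "lift_sum t h = 0" if "h \<in> tensor_relations R B N" for h
    using that by (cases rule: tensor_relations_cases) (simp_all add: lift_sum_simps assms(1-3))
  have "lift_sum t k = 0" if "k \<in> K" for k
    using that unfolding tensor_null_def
  proof (induction rule: generate.induct)
    case (inv h)
    have "inv\<^bsub>F\<^esub> h = - h" using inv tensor_relations_carrier by auto
    then show ?case using rel[OF inv] by (simp add: lift_sum_simps)
  qed (simp_all add: lift_sum_simps rel)
  moreover have "frag_of (a, x) \<in> K" using assms(4) by (simp add: pure_cls zero_T cls_eq_iff)
  ultimately show ?thesis using lift_sum_simps(5)[of t "(a, x)"] by simp
qed

end

section \<open>The induced module\<close>

lemma algA_minus_zero: "\<zero>\<^bsub>\<A>\<^esub> \<in> algA_minus"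
  unfolding algA_minus_def using generate.one[of "add_monoid \<A>"] by simp

lemma algA_le0_iff:
  "b \<in> algA_le0 \<longleftrightarrow> (\<exists>x f. x \<in> algA_minus \<and> homogeneous 0 f \<and> b = x \<oplus>\<^bsub>\<A>\<^esub> algA_class f)"
proof -
  have "b \<in> algA_le0 \<longleftrightarrow> (\<exists>x\<in>algA_minus. \<exists>a\<in>algA_deg 0. b = x \<oplus>\<^bsub>\<A>\<^esub> a)"
    unfolding algA_le0_def set_add_def' by simp
  then show ?thesis by (metis algA_deg_iff)
qed

lemma algA_minus_le0: "x \<in> algA_minus \<Longrightarrow> x \<in> algA_le0"
proof -
  assume x: "x \<in> algA_minus"
  obtain f where "x = algA_class f" using algA_minus_class[OF x] by blast
  then have "x = x \<oplus>\<^bsub>\<A>\<^esub> algA_class 0" by (simp add: algA_class_add)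
  then show ?thesis using x homogeneous_zero algA_le0_iff by blast
qed

lemma algA_zero_add: "\<zero>\<^bsub>\<A>\<^esub> \<oplus>\<^bsub>\<A>\<^esub> algA_class f = algA_class f"
  by (simp add: algA_class_zero algA_class_add)

lemma algA_deg0_le0: "homogeneous 0 f \<Longrightarrow> algA_class f \<in> algA_le0"
  unfolding algA_le0_iff using algA_minus_zero algA_zero_add by metis

lemma extended_action_eq:
  "x \<in> algA_minus \<Longrightarrow> homogeneous 0 f \<Longrightarrow> extended_action s (x \<oplus>\<^bsub>\<A>\<^esub> algA_class f) z = s (zero_coset f) z"
  by (simp add: extended_action_def degree_zero_component zero_coset_def)

lemma extended_action_deg0: "homogeneous 0 f \<Longrightarrow> extended_action s (algA_class f) z = s (zero_coset f) z"
  using extended_action_eq[OF algA_minus_zero, of f s z] by (simp add: algA_zero_add)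

lemma extended_action_minus:
  assumes "C1_action s" "x \<in> algA_minus"
  shows "extended_action s x z = 0"
proof -
  obtain f where "x = algA_class f" using algA_minus_class[OF assms(2)] by blast
  then have "x \<oplus>\<^bsub>\<A>\<^esub> algA_class (free_scalar 0) = x" by (simp add: algA_class_add)
  then show ?thesis
    using extended_action_eq[OF assms(2) homogeneous_free_scalar[of 0], of s z]
      C1_action_zero_coset(3)[OF assms(1), of 0 z] by simp
qed

lemma tensor_data_MA1: "tensor_data \<A> algA_le0 (complex_module s)"
proof (intro tensor_data.intro tensor_data_axioms.intro ring_algA abelian_group_complex_module)
  show "algA_le0 \<subseteq> carrier \<A>"
  proof
    fix b assume "b \<in> algA_le0"
    then obtain x f where "x \<in> algA_minus" "b = x \<oplus>\<^bsub>\<A>\<^esub> algA_class f" using algA_le0_iff by blast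
    then show "b \<in> carrier \<A>" using algA_minus_class[of x] by (auto simp: algA_class_add)
  qed
qed (simp add: complex_module_def)

lemma left_module_MA1: "left_module \<A> (MA1 s)"
  unfolding MA1_def by (rule tensor_data.left_module_T[OF tensor_data_MA1])

lemma v1_carrier: "v1 s \<in> carrier (MA1 s)"
  unfolding MA1_def v1_def MA1_tensor_def algA_class_one
  by (rule tensor_data.pure_carrier[OF tensor_data_MA1]) (simp_all add: complex_module_def)

lemma smult_v1:
  "algA_class f \<odot>\<^bsub>MA1 s\<^esub> v1 s = pure_tensor \<A> algA_le0 (complex_module (extended_action s)) (algA_class f) 1"
  unfolding MA1_def v1_def MA1_tensor_def
  using tensor_data.smult_pure[OF tensor_data_MA1, of "algA_class f" "extended_action s" "\<one>\<^bsub>\<A>\<^esub>" 1]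
  by (simp add: algA_class_one algA_class_mult)

lemma smult_v1_le0:
  assumes "algA_class f \<in> algA_le0"
  shows "algA_class f \<odot>\<^bsub>MA1 s\<^esub> v1 s = MA1_tensor s \<one>\<^bsub>\<A>\<^esub> (extended_action s (algA_class f) 1)"
  using tensor_data.pure_balanced[OF tensor_data_MA1, of "\<one>\<^bsub>\<A>\<^esub>" "algA_class f" 1 "extended_action s"] assms
  by (simp add: smult_v1 MA1_tensor_def algA_class_one algA_class_mult) (simp add: complex_module_def)

lemma MA1_tensor_zero: "MA1_tensor s \<one>\<^bsub>\<A>\<^esub> 0 = \<zero>\<^bsub>MA1 s\<^esub>"
  using tensor_data.pure_zero_right[OF tensor_data_MA1, of "\<one>\<^bsub>\<A>\<^esub>" "extended_action s"]
  by (simp add: MA1_tensor_def MA1_def algA_class_one) (simp add: complex_module_def)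

text \<open>Apart from the relations, each generator of the vacuum ideal has a right factor in A_-
  or equal to Y_0 - 1 or Ys_0 - 1; this factor can be moved through the tensor sign, where it acts
  as 0.\<close>

lemma MA1_vac_null:
  assumes s: "C1_action s"
  shows "vac_null d f \<Longrightarrow> algA_class f \<odot>\<^bsub>MA1 s\<^esub> v1 s = \<zero>\<^bsub>MA1 s\<^esub>"
proof (induction rule: vac_null.induct)
  interpret L: left_module \<A> "MA1 s" by (rule left_module_MA1)
  note mult = algA_class_mult[symmetric] L.smult_assoc[OF algA_class_carrier algA_class_carrier v1_carrier]
  have minus: "algA_class g \<odot>\<^bsub>MA1 s\<^esub> v1 s = \<zero>\<^bsub>MA1 s\<^esub>" if "homogeneous (- n) g" "n > 0" for g n
  proof -
    have g: "algA_class g \<in> algA_minus"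
      unfolding algA_minus_def using algA_deg_class[OF that(1)] that(2)
      by (intro generate.incl UN_I[of n]) simp_all
    show ?thesis
      unfolding smult_v1_le0[OF algA_minus_le0[OF g]] extended_action_minus[OF s g] by (rule MA1_tensor_zero)
  qed
  have zero: "algA_class g \<odot>\<^bsub>MA1 s\<^esub> v1 s = \<zero>\<^bsub>MA1 s\<^esub>" if "vac_null 0 g" for g
  proof -
    have g: "s (zero_coset g) 1 = 0" "homogeneous 0 g" using C1_action_vac_null[OF s that] by simp_all
    show ?thesis
      unfolding smult_v1_le0[OF algA_deg0_le0[OF g(2)]] extended_action_deg0[OF g(2)] g(1)
      by (rule MA1_tensor_zero)
  qed
  {
    case (rel f d)
    then have "algA_class f = \<zero>\<^bsub>\<A>\<^esub>" by (simp add: algA_class_zero algA_class_eq_iff)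
    then show ?case using L.smult_zero_left[OF v1_carrier] by simp
  next
    case (add d f g)
    then show ?case
      using L.smult_l_distr[OF algA_class_carrier algA_class_carrier v1_carrier, of f g]
      by (simp add: algA_class_add)
  next
    case (Y n d f)
    then show ?case unfolding mult using minus[OF homogeneous_free_Y(1)] by (simp add: L.smult_zero_right)
  next
    case (Ys n d f)
    then show ?case unfolding mult using minus[OF homogeneous_free_Y(2)] by (simp add: L.smult_zero_right)
  next
    case (Y0 d f)
    show ?case unfolding mult using zero[of "free_Y 0 - 1"] vac_null.Y0[of 0 1] by (simp add: L.smult_zero_right)
  next
    case (Ys0 d f)
    show ?case unfolding mult using zero[of "free_Ys 0 - 1"] vac_null.Ys0[of 0 1] by (simp add: L.smult_zero_right)
  }
qed

lemma MA1_vac_ideal: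
  assumes s: "C1_action s"
  shows "vac_ideal f \<Longrightarrow> algA_class f \<odot>\<^bsub>MA1 s\<^esub> v1 s = \<zero>\<^bsub>MA1 s\<^esub>"
proof (induction rule: vac_ideal.induct)
  case (add f g)
  interpret L: left_module \<A> "MA1 s" by (rule left_module_MA1)
  show ?case
    using L.smult_l_distr[OF algA_class_carrier algA_class_carrier v1_carrier, of f g] add
    by (simp add: algA_class_add)
qed (rule MA1_vac_null[OF s])

lemma smult_v1_diff:
  "algA_class (f - g) \<odot>\<^bsub>MA1 s\<^esub> v1 s = algA_class f \<odot>\<^bsub>MA1 s\<^esub> v1 s \<ominus>\<^bsub>MA1 s\<^esub> algA_class g \<odot>\<^bsub>MA1 s\<^esub> v1 s"
proof -
  interpret L: left_module \<A> "MA1 s" by (rule left_module_MA1)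
  show ?thesis
    using L.smult_l_distr[OF algA_class_carrier algA_class_carrier v1_carrier, of f "- g"]
      L.smult_minus_left[OF algA_class_carrier v1_carrier, of g]
    by (simp add: algA_class_add algA_class_uminus L.M.minus_eq)
qed

text \<open>A complex number in the second tensor factor is the result of a scalar of degree 0
  acting on 1, so it can be moved to the first factor.\<close>

lemma MA1_cyclic:
  assumes s: "C1_action s"
  shows "u \<in> carrier (MA1 s) \<Longrightarrow> \<exists>f. u = algA_class f \<odot>\<^bsub>MA1 s\<^esub> v1 s"
  unfolding MA1_def
proof (induction rule: tensor_data.T_induct[OF tensor_data_MA1, consumes 1])
  case 1
  interpret L: left_module \<A> "MA1 s" by (rule left_module_MA1)
  show ?case using L.smult_zero_left[OF v1_carrier] by (metis MA1_def algA_class_zero)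
next
  case (2 a x)
  then obtain f where a: "a = algA_class f" by (auto simp: carrier_algA)
  have "pure_tensor \<A> algA_le0 (complex_module (extended_action s)) (a \<otimes>\<^bsub>\<A>\<^esub> algA_class (free_scalar x)) 1
      = pure_tensor \<A> algA_le0 (complex_module (extended_action s)) a
          (algA_class (free_scalar x) \<odot>\<^bsub>complex_module (extended_action s)\<^esub> 1)"
    using algA_deg0_le0[of "free_scalar x"]
    by (intro tensor_data.pure_balanced[OF tensor_data_MA1]) (simp_all add: a complex_module_def)
  also have "algA_class (free_scalar x) \<odot>\<^bsub>complex_module (extended_action s)\<^esub> 1 = x"
    using C1_action_zero_coset(3)[OF s, of x 1]
    by (simp add: complex_module_def extended_action_deg0)
  finally show ?case using smult_v1[where f = "f * free_scalar x" and s = s] by (metis MA1_def a algA_class_mult)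
next
  case (3 u v)
  then obtain f g where "u = algA_class f \<odot>\<^bsub>MA1 s\<^esub> v1 s" "v = algA_class g \<odot>\<^bsub>MA1 s\<^esub> v1 s"
    unfolding MA1_def by blast
  then show ?case using smult_v1_diff[where f = f and g = g and s = s] unfolding MA1_def by metis
qed

text \<open>From left to right by the balanced map that sends the tensor of a and z to z (a 1); from
  right to left because the annihilator of 1 is the formal ideal, which kills v_1.\<close>

lemma MA1_smult_zero_iff:
  assumes s: "C1_action s"
  shows "algA_class f \<odot>\<^bsub>MA1 s\<^esub> v1 s = \<zero>\<^bsub>MA1 s\<^esub> \<longleftrightarrow> free_action f 1 = 0"
proof
  assume zero: "algA_class f \<odot>\<^bsub>MA1 s\<^esub> v1 s = \<zero>\<^bsub>MA1 s\<^esub>"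
  have z: "pure_tensor \<A> algA_le0 (complex_module (extended_action s)) (algA_class f) 1
      = \<zero>\<^bsub>tensor_module \<A> algA_le0 (complex_module (extended_action s))\<^esub>"
    unfolding smult_v1[symmetric] MA1_def[symmetric] by (rule zero)
  define t where "t = (\<lambda>(a, z). a \<odot>\<^bsub>M1\<^esub> fock_scale z 1)"
  have t: "t (algA_class g, z) = fock_scale z (free_action g 1)" for g z
    by (simp add: t_def M1_smult free_action_linear)
  have "t (algA_class f, 1) = 0"
  proof (rule tensor_data.tensor_lift[OF tensor_data_MA1 _ _ _ z])
    fix a x assume "a \<in> carrier \<A>"
    then obtain g where a: "a = algA_class g" by (auto simp: carrier_algA)
    show "t (a, x \<oplus>\<^bsub>complex_module (extended_action s)\<^esub> y) = t (a, x) + t (a, y)" for y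
      by (simp add: a t complex_module_def fock.scale_left_distrib)
    show "t (a \<oplus>\<^bsub>\<A>\<^esub> b, x) = t (a, x) + t (b, x)" if "b \<in> carrier \<A>" for b
      using that by (auto simp: carrier_algA a t algA_class_add free_action_add fock.scale_right_distrib)
    \<comment> \<open>Balancedness: the part of b in A_- kills 1, and the degree zero part acts on 1
      by the scalar c that \<open>s\<close> prescribes.\<close>
    show "t (a \<otimes>\<^bsub>\<A>\<^esub> b, x) = t (a, b \<odot>\<^bsub>complex_module (extended_action s)\<^esub> x)" if le0: "b \<in> algA_le0" for b
    proof -
      obtain y h where y: "y \<in> algA_minus" and h: "homogeneous 0 h" and b: "b = y \<oplus>\<^bsub>\<A>\<^esub> algA_class h"
        using le0 algA_le0_iff by blast
      obtain u where u: "y = algA_class u" "\<forall>w\<in>Poly_Mapping.keys u. word_degree w < 0"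
        using algA_minus_class[OF y] by blast
      obtain c where c: "free_action h 1 = fock_scale c 1" "\<And>z. s (zero_coset h) z = c * z"
        using C1_action_eq[OF s h] by blast
      have "b \<odot>\<^bsub>complex_module (extended_action s)\<^esub> x = c * x"
        using extended_action_eq[OF y h, of s x] by (simp add: complex_module_def b c(2))
      moreover have "a \<otimes>\<^bsub>\<A>\<^esub> b = algA_class (g * (u + h))"
        by (simp add: a b u(1) algA_class_add algA_class_mult)
      ultimately show ?thesis
        by (simp add: a t free_action_mult free_action_add negative_action[OF u(2)] c(1)
            free_action_linear mult.commute)
    qed
  qed
  then show "free_action f 1 = 0" by (simp add: t)
next
  assume "free_action f 1 = 0"
  then show "algA_class f \<odot>\<^bsub>MA1 s\<^esub> v1 s = \<zero>\<^bsub>MA1 s\<^esub>"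
    using MA1_vac_ideal[OF s] vac_ideal_iff by blast
qed

lemma MA1_smult_eq_iff:
  assumes s: "C1_action s"
  shows "algA_class f \<odot>\<^bsub>MA1 s\<^esub> v1 s = algA_class g \<odot>\<^bsub>MA1 s\<^esub> v1 s \<longleftrightarrow> free_action f 1 = free_action g 1"
proof -
  interpret L: left_module \<A> "MA1 s" by (rule left_module_MA1)
  let ?x = "algA_class f \<odot>\<^bsub>MA1 s\<^esub> v1 s" and ?y = "algA_class g \<odot>\<^bsub>MA1 s\<^esub> v1 s"
  have c: "?x \<in> carrier (MA1 s)" "?y \<in> carrier (MA1 s)"
    by (simp_all add: L.smult_closed v1_carrier)
  have "?x = ?y \<longleftrightarrow> ?x \<ominus>\<^bsub>MA1 s\<^esub> ?y = \<zero>\<^bsub>MA1 s\<^esub>"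
  proof
    assume "?x \<ominus>\<^bsub>MA1 s\<^esub> ?y = \<zero>\<^bsub>MA1 s\<^esub>"
    then have "\<ominus>\<^bsub>MA1 s\<^esub> (\<ominus>\<^bsub>MA1 s\<^esub> ?y) = ?x"
      using c by (intro L.M.minus_equality) (simp_all add: L.M.minus_eq)
    then show "?x = ?y" using c by simp
  qed (use c in \<open>simp add: L.M.minus_eq L.M.r_neg\<close>)
  then have "?x = ?y \<longleftrightarrow> algA_class (f - g) \<odot>\<^bsub>MA1 s\<^esub> v1 s = \<zero>\<^bsub>MA1 s\<^esub>"
    unfolding smult_v1_diff .
  then show ?thesis by (simp add: MA1_smult_zero_iff[OF s] free_action_diff)
qed

section \<open>The isomorphism with the Fock space\<close>

lemma left_module_M1: "left_module \<A> M1"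
proof (intro left_module.intro left_module_axioms.intro ring_algA)
  have M1: "carrier M1 = UNIV" "\<zero>\<^bsub>M1\<^esub> = 0" "p \<oplus>\<^bsub>M1\<^esub> q = p + q" for p q
    by (simp_all add: M1_def)
  show "abelian_group M1"
  proof (rule abelian_groupI)
    show "\<exists>y\<in>carrier M1. y \<oplus>\<^bsub>M1\<^esub> x = \<zero>\<^bsub>M1\<^esub>" for x
      by (rule bexI[of _ "- x"]) (simp_all add: M1)
  qed (simp_all add: M1 add_ac)
  show "\<one>\<^bsub>\<A>\<^esub> \<odot>\<^bsub>M1\<^esub> x = x" for x by (simp add: algA_class_one M1_smult)
  fix a x assume "a \<in> carrier \<A>"
  then obtain f where a: "a = algA_class f" by (auto simp: carrier_algA)
  show "a \<odot>\<^bsub>M1\<^esub> x \<in> carrier M1" by (simp add: M1)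
  show "a \<odot>\<^bsub>M1\<^esub> (x \<oplus>\<^bsub>M1\<^esub> y) = a \<odot>\<^bsub>M1\<^esub> x \<oplus>\<^bsub>M1\<^esub> a \<odot>\<^bsub>M1\<^esub> y" for y
    by (simp add: a M1 M1_smult free_action_linear)
  fix b assume "b \<in> carrier \<A>"
  then obtain g where b: "b = algA_class g" by (auto simp: carrier_algA)
  show "(a \<oplus>\<^bsub>\<A>\<^esub> b) \<odot>\<^bsub>M1\<^esub> x = a \<odot>\<^bsub>M1\<^esub> x \<oplus>\<^bsub>M1\<^esub> b \<odot>\<^bsub>M1\<^esub> x"
    by (simp add: a b M1 algA_class_add M1_smult free_action_add)
  show "(a \<otimes>\<^bsub>\<A>\<^esub> b) \<odot>\<^bsub>M1\<^esub> x = a \<odot>\<^bsub>M1\<^esub> (b \<odot>\<^bsub>M1\<^esub> x)"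
    by (simp add: a b algA_class_mult M1_smult free_action_mult)
qed

lemma MA1_isomorphic_M1:
  assumes s: "C1_action s"
  shows "module_isomorphic \<A> (MA1 s) M1"
proof -
  interpret L: left_module \<A> "MA1 s" by (rule left_module_MA1)
  let ?v = "\<lambda>f. algA_class f \<odot>\<^bsub>MA1 s\<^esub> v1 s"
  \<comment> \<open>The map f v_1 -> f 1; \<open>MA1_smult_eq_iff\<close> gives both its
    independence of the choice of f and its injectivity.\<close>
  define h where "h u = free_action (SOME f. u = ?v f) 1" for u
  have h: "h (?v f) = free_action f 1" for f
  proof -
    have "?v f = ?v (SOME g. ?v f = ?v g)" by (rule someI[of _ f]) simp
    then show ?thesis unfolding h_def MA1_smult_eq_iff[OF s] by simp
  qed
  have ex: "\<exists>f. u = ?v f" if "u \<in> carrier (MA1 s)" for u by (rule MA1_cyclic[OF s that])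
  have "inj_on h (carrier (MA1 s))"
  proof (rule inj_onI)
    fix x y assume "x \<in> carrier (MA1 s)" "y \<in> carrier (MA1 s)" and e: "h x = h y"
    then obtain f g where fg: "x = ?v f" "y = ?v g" using ex by metis
    show "x = y" using e unfolding fg h MA1_smult_eq_iff[OF s] .
  qed
  moreover have "h ` carrier (MA1 s) = carrier M1"
  proof -
    have "p \<in> h ` carrier (MA1 s)" for p
    proof -
      obtain f where "p = free_action f 1" using fock_cyclic by blast
      then have "p = h (?v f)" by (simp add: h)
      then show ?thesis using L.smult_closed[OF algA_class_carrier v1_carrier] by blast
    qed
    then show ?thesis by (auto simp: M1_def)
  qed
  ultimately have "bij_betw h (carrier (MA1 s)) (carrier M1)" by (simp add: bij_betw_def)
  moreover have "h (x \<oplus>\<^bsub>MA1 s\<^esub> y) = h x \<oplus>\<^bsub>M1\<^esub> h y"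
    if xy: "x \<in> carrier (MA1 s)" "y \<in> carrier (MA1 s)" for x y
  proof -
    obtain f g where fg: "x = ?v f" "y = ?v g" using ex xy by metis
    have "x \<oplus>\<^bsub>MA1 s\<^esub> y = ?v (f + g)"
      using L.smult_l_distr[OF algA_class_carrier algA_class_carrier v1_carrier, of f g]
      by (simp add: fg algA_class_add)
    then show ?thesis by (simp add: h fg free_action_add) (simp add: M1_def)
  qed
  moreover have "h (a \<odot>\<^bsub>MA1 s\<^esub> x) = a \<odot>\<^bsub>M1\<^esub> h x"
    if ax: "a \<in> carrier \<A>" "x \<in> carrier (MA1 s)" for a x
  proof -
    obtain f where f: "x = ?v f" using ex ax by metis
    obtain g where g: "a = algA_class g" using ax(1) by (auto simp: carrier_algA)
    have "a \<odot>\<^bsub>MA1 s\<^esub> x = ?v (g * f)"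
      using L.smult_assoc[OF algA_class_carrier algA_class_carrier v1_carrier, of g f]
      by (simp add: f g algA_class_mult)
    then show ?thesis by (simp add: h f g M1_smult free_action_mult)
  qed
  ultimately show ?thesis
    unfolding module_isomorphic_def using left_module_MA1 left_module_M1 by blast
qed

subsection \<open>Irreducibility\<close>

lemma homogeneous_theta_Y_word: "homogeneous (- sum_list ns) (free_theta (Y_word ns))"
proof (induction ns)
  case (Cons n ns)
  then show ?case
    using homogeneous_mult'[OF Cons homogeneous_free_Y(2)[of n], of "- n - sum_list ns"]
    by (simp add: free_theta_mult free_theta_gen)
qed (simp add: free_theta_one)

text \<open>Applying the adjoint of \<open>Y_word ms\<close> for a partition \<open>ms\<close> of maximal size in the expansion
  of \<open>p\<close> leaves only its coefficient.\<close>

lemma fock_reach_vacuum: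
  assumes "p \<noteq> 0"
  obtains g where "free_action g p = 1"
proof -
  obtain a where a: "Poly_Mapping.keys a \<subseteq> Collect part_list" "p = free_action (word_comb a) 1"
    by (rule fock_expand)
  have "a \<noteq> 0" using a(2) assms by auto
  then have ne: "Poly_Mapping.keys a \<noteq> {}" by simp
  define m where "m = Max (sum_list ` Poly_Mapping.keys a)"
  have "m \<in> sum_list ` Poly_Mapping.keys a" unfolding m_def using ne by (intro Max_in) simp_all
  then obtain ms where ms: "ms \<in> Poly_Mapping.keys a" "sum_list ms = m" by blast
  define c where "c = Poly_Mapping.lookup a ms"
  have c: "c \<noteq> 0" using ms(1) by (simp add: c_def in_keys_iff)
  have pms: "part_list ms" using ms(1) a(1) by blast
  have coeff: "free_action (free_theta (Y_word ms)) (basis_vec ns) = (if ns = ms then 1 else 0)"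
    if ns: "ns \<in> Poly_Mapping.keys a" for ns
  proof -
    have pns: "part_list ns" using ns a(1) by blast
    let ?f = "free_theta (Y_word ms) * Y_word ns"
    have hom: "homogeneous (sum_list ns - sum_list ms) ?f"
      using homogeneous_mult'[OF homogeneous_theta_Y_word homogeneous_Y_word] by simp
    have form: "vev (free_action ?f 1) = (if ns = ms then 1 else 0)"
      using fock_form_basis[OF pms pns] by (auto simp: fock_form_eq free_action_mult)
    have le: "sum_list ns \<le> sum_list ms"
      unfolding ms(2) m_def using ns by (intro Max_ge) simp_all
    \<comment> \<open>Equal size: \<open>?f\<close> has degree 0, so the vector is a multiple of 1,
      which \<open>vev\<close> determines. Smaller size: \<open>?f\<close> has negative degree and
      kills the vacuum.\<close>
    show ?thesis
    proof (cases "sum_list ns = sum_list ms")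
      case True
      then have "homogeneous 0 ?f" using hom by simp
      then obtain d where "vac_null 0 (?f - free_scalar d)" using straight_0 straight_homogeneous by blast
      then have "free_action ?f 1 = fock_scale d 1"
        using vac_null_action[of 0 "?f - free_scalar d"] by (simp add: free_action_diff free_action_scalar)
      then show ?thesis using form by (simp add: free_action_mult vev_scale split: if_splits)
    next
      case False
      then have "free_action ?f 1 = 0"
        using le vac_null_action[OF straight_negative[OF straight_homogeneous[OF hom]]] by simp
      then show ?thesis using False by (auto simp: free_action_mult)
    qed
  qed
  have "free_action (free_theta (Y_word ms)) p
      = (\<Sum>ns\<in>Poly_Mapping.keys a. fock_scale (Poly_Mapping.lookup a ns) (free_action (free_theta (Y_word ms)) (basis_vec ns)))"
    unfolding a(2) word_comb_action fock_linear_sum[OF fock_linear_free_action] by (simp add: free_action_linear)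
  also have "\<dots> = (\<Sum>ns\<in>Poly_Mapping.keys a. if ns = ms then fock_scale c 1 else 0)"
    by (intro sum.cong refl) (simp add: coeff c_def)
  also have "\<dots> = fock_scale c 1" using ms(1) by simp
  finally have "free_action (free_scalar (1 / c) * free_theta (Y_word ms)) p = 1"
    using c by (simp add: free_action_mult free_action_scalar)
  then show thesis by (rule that)
qed

text \<open>A nonzero u = f v_1 in N is carried back to v_1: if g f 1 = 1, then k g f v_1 = k v_1
  for all k, since vectors of the induced module are determined by their images in the Fock
  space.\<close>

lemma MA1_simple:
  assumes s: "C1_action s" and N: "submodule N \<A> (MA1 s)" "N \<noteq> {\<zero>\<^bsub>MA1 s\<^esub>}"
  shows "N = carrier (MA1 s)"
proof
  interpret L: left_module \<A> "MA1 s" by (rule left_module_MA1)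
  have sub: "N \<subseteq> carrier (MA1 s)"
    using subgroup.subset[OF submodule.axioms(1)[OF N(1)]] by simp
  then show "N \<subseteq> carrier (MA1 s)" .
  have closed: "a \<odot>\<^bsub>MA1 s\<^esub> x \<in> N" if "a \<in> carrier \<A>" "x \<in> N" for a x
    using submodule.smult_closed[OF N(1) that] .
  have "\<zero>\<^bsub>MA1 s\<^esub> \<in> N"
    using subgroup.one_closed[OF submodule.axioms(1)[OF N(1)]] by simp
  then obtain u where u: "u \<in> N" "u \<noteq> \<zero>\<^bsub>MA1 s\<^esub>" using N(2) by blast
  obtain f where f: "u = algA_class f \<odot>\<^bsub>MA1 s\<^esub> v1 s" using MA1_cyclic[OF s] u(1) sub by blast
  then have "free_action f 1 \<noteq> 0" using u(2) MA1_smult_zero_iff[OF s] by simp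
  then obtain g where g: "free_action g (free_action f 1) = 1" by (rule fock_reach_vacuum)
  show "carrier (MA1 s) \<subseteq> N"
  proof
    fix x assume "x \<in> carrier (MA1 s)"
    then obtain k where k: "x = algA_class k \<odot>\<^bsub>MA1 s\<^esub> v1 s" using MA1_cyclic[OF s] by blast
    have "x = algA_class (k * g * f) \<odot>\<^bsub>MA1 s\<^esub> v1 s"
      unfolding k MA1_smult_eq_iff[OF s] by (simp add: free_action_mult g)
    also have "\<dots> = algA_class (k * g) \<odot>\<^bsub>MA1 s\<^esub> u"
      using L.smult_assoc[OF algA_class_carrier algA_class_carrier v1_carrier, of "k * g" f]
      by (simp add: f algA_class_mult)
    finally show "x \<in> N" using closed[OF algA_class_carrier u(1)] by simp
  qed
qed

section \<open>The two quotient modules and the basis\<close>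

lemma v1_nonzero: "C1_action s \<Longrightarrow> v1 s \<noteq> \<zero>\<^bsub>MA1 s\<^esub>"
  using MA1_smult_zero_iff[of s 1] left_module.smult_one[OF left_module_MA1 v1_carrier]
  by (simp add: algA_class_one)

lemma LA1_eq: "C1_action s \<Longrightarrow> LA1 s = quotient_module (MA1 s) {\<zero>\<^bsub>MA1 s\<^esub>}"
proof -
  assume s: "C1_action s"
  have "carrier (MA1 s) \<noteq> {\<zero>\<^bsub>MA1 s\<^esub>}" using v1_carrier[of s] v1_nonzero[OF s] by blast
  then have "(THE N. maximal_graded_submodule \<A> (MA1 s) (MA1_deg s) N) = {\<zero>\<^bsub>MA1 s\<^esub>}"
    by (intro left_module.simple_maximal_graded_submodule[OF left_module_MA1] MA1_simple[OF s])
  then show ?thesis by (simp add: LA1_def)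
qed

lemma J_eq: "C1_action s \<Longrightarrow> J s = {\<zero>\<^bsub>MA1 s\<^esub>}"
proof -
  assume s: "C1_action s"
  interpret L: left_module \<A> "MA1 s" by (rule left_module_MA1)
  have "Y_neg l \<odot>\<^bsub>MA1 s\<^esub> v1 s \<ominus>\<^bsub>MA1 s\<^esub>
      scalar ((- 1) ^ partition_size l) \<odot>\<^bsub>MA1 s\<^esub> (Ys_neg (conjugate l) \<odot>\<^bsub>MA1 s\<^esub> v1 s) = \<zero>\<^bsub>MA1 s\<^esub>"
    if l: "l \<in> partitions" for l
  proof -
    let ?c = "free_scalar ((- 1) ^ partition_size l)" and ?g = "Ys_word (parts (conjugate l))"
    have "scalar ((- 1) ^ partition_size l) \<odot>\<^bsub>MA1 s\<^esub> (Ys_neg (conjugate l) \<odot>\<^bsub>MA1 s\<^esub> v1 s)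
        = algA_class (?c * ?g) \<odot>\<^bsub>MA1 s\<^esub> v1 s"
      using L.smult_assoc[OF algA_class_carrier algA_class_carrier v1_carrier, of ?c ?g]
      by (simp add: scalar_def Y_neg_eq algA_class_mult)
    then show ?thesis
      using MA1_vac_null[OF s Y_word_conjugate[OF l]] by (simp add: Y_neg_eq smult_v1_diff)
  qed
  then show ?thesis unfolding J_def by (intro L.generated_submodule_zero) blast
qed

lemma fock_basis:
  fixes S assumes S: "S = {Y_neg l \<odot>\<^bsub>M1\<^esub> 1 | l. l \<in> partitions}"
  shows "fock.independent S" "fock.span S = UNIV"
proof -
  have S': "S = basis_vec ` Collect part_list"
  proof -
    have "S = (\<lambda>l. basis_vec (parts l)) ` partitions" 
      unfolding S Y_neg_eq M1_smult by blast
    also have "\<dots> = basis_vec ` (parts ` partitions)" by (simp add: image_image)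
    also have "parts ` partitions = Collect part_list"
    proof (intro subset_antisym subsetI)
      fix ns assume "ns \<in> Collect part_list"
      then obtain l where "l \<in> partitions" "parts l = ns" using parts_surj by blast
      then show "ns \<in> parts ` partitions" by blast
    qed (use parts_props(1) in blast)
    finally show ?thesis .
  qed
  show "fock.span S = UNIV"
  proof -
    have "p \<in> fock.span S" for p
    proof (induction p rule: basis_induct)
      case (3 ns)
      then have "basis_vec ns \<in> S" unfolding S' by blast
      then show ?case by (rule fock.span_base)
    qed (simp_all only: fock.span_add fock.span_scale)
    then show ?thesis by blast
  qed
  show "fock.independent S"
    unfolding fock.dependent_explicit
  proof (intro notI, elim exE conjE bexE)
    fix t u v assume t: "finite t" "t \<subseteq> S" "(\<Sum>v\<in>t. fock_scale (u v) v) = 0" "v \<in> t" "u v \<noteq> 0"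
    \<comment> \<open>Distinct vectors come from distinct partitions, so pairing the linear relation
      with v isolates the coefficient \<open>u v\<close>.\<close>
    have orth: "fock_form w v = (if w = v then 1 else 0)" if w: "w \<in> t" for w
    proof -
      obtain ls ms where l: "w = basis_vec ls" "part_list ls" and m: "v = basis_vec ms" "part_list ms"
        using w t(2,4) unfolding S' by blast
      show ?thesis
      proof (cases "w = v")
        case True
        then show ?thesis using fock_form_basis[OF l(2) l(2)] by (simp add: l(1))
      next
        case False
        then have "ls \<noteq> ms" using l(1) m(1) by blast
        then show ?thesis using False fock_form_basis[OF l(2) m(2)] unfolding l(1) m(1) by simp
      qed
    qed
    have 0: "fock_form 0 v = 0" using fock_form_left(2)[of 0 0 v] by simp
    have "fock_form (\<Sum>w\<in>A. fock_scale (u w) w) v = (\<Sum>w\<in>A. u w * fock_form w v)" for A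
      by (induction A rule: infinite_finite_induct) (simp_all add: fock_form_left 0)
    from this[of t] have "0 = (\<Sum>w\<in>t. u w * fock_form w v)" by (simp only: t(3) 0)
    also have "\<dots> = (\<Sum>w\<in>t. if w = v then u v else 0)"
      by (intro sum.cong refl) (simp add: orth)
    also have "\<dots> = u v" using t(1,4) by simp
    finally show False using t(5) by simp
  qed
qed

theorem theorem3p11:
  shows "(\<exists>s. C1_action s) \<and>
    (\<forall>n p. Y n \<odot>\<^bsub>M1\<^esub> p = Y_op n p \<and> Ys n \<odot>\<^bsub>M1\<^esub> p = Ys_op n p) \<and>
    (\<forall>s. C1_action s \<longrightarrow>
      LA1 s = quotient_module (MA1 s) (J s) \<and>
      module_isomorphic \<A> (quotient_module (MA1 s) (J s)) M1) \<and>
    (\<exists>B. bilinear_form B \<and> nondegenerate_form B \<and> symmetric_form B \<and> invariant_form B \<and>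
      (\<forall>l\<in>partitions. \<forall>m\<in>partitions.
        B (Y_neg l \<odot>\<^bsub>M1\<^esub> 1) (Y_neg m \<odot>\<^bsub>M1\<^esub> 1) = (if l = m then 1 else 0)) \<and>
      fock.independent {Y_neg l \<odot>\<^bsub>M1\<^esub> 1 | l. l \<in> partitions} \<and>
      fock.span {Y_neg l \<odot>\<^bsub>M1\<^esub> 1 | l. l \<in> partitions} = UNIV)"
proof (intro conjI allI impI exI[of _ fock_form] ballI)
  show "\<exists>s. C1_action s" by (rule C1_action_exists)
  show "Y n \<odot>\<^bsub>M1\<^esub> p = Y_op n p" "Ys n \<odot>\<^bsub>M1\<^esub> p = Ys_op n p" for n p
    by (simp_all add: Y_def Ys_def M1_smult free_action_gen)
  show "LA1 s = quotient_module (MA1 s) (J s)" if "C1_action s" for s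
    by (simp add: LA1_eq J_eq that)
  show "module_isomorphic \<A> (quotient_module (MA1 s) (J s)) M1" if s: "C1_action s" for s
    unfolding J_eq[OF s]
    by (rule left_module.quotient_zero_isomorphic[OF left_module_MA1 MA1_isomorphic_M1[OF s]])
  show "bilinear_form fock_form" by (rule bilinear_fock_form)
  show "nondegenerate_form fock_form"
    unfolding nondegenerate_form_def using fock_form_nondegenerate by blast
  show "symmetric_form fock_form" unfolding symmetric_form_def using fock_form_sym by blast
  show "invariant_form fock_form"
    unfolding invariant_form_def
    by (auto simp: carrier_algA theta_class M1_smult fock_form_invariant)
  show "fock_form (Y_neg l \<odot>\<^bsub>M1\<^esub> 1) (Y_neg m \<odot>\<^bsub>M1\<^esub> 1) = (if l = m then 1 else 0)"
    if "l \<in> partitions" "m \<in> partitions" for l m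
    using fock_form_basis[OF parts_props(1)[OF that(1)] parts_props(1)[OF that(2)]]
      inj_on_eq_iff[OF inj_on_parts that]
    by (simp add: Y_neg_eq M1_smult)
  show "fock.independent {Y_neg l \<odot>\<^bsub>M1\<^esub> 1 | l. l \<in> partitions}"
    "fock.span {Y_neg l \<odot>\<^bsub>M1\<^esub> 1 | l. l \<in> partitions} = UNIV"
    using fock_basis[OF refl] by blast+
qed

end
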